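(* Let $(M,\Omega)$ be a symplectic manifold of dimension $2$. The map $\mathcal{S}(M,\Omega)\to \Lambda^{1}(M)/d'\Lambda^{2}(M)$ sending a symplectic connection $\nabla$ to the equivalence class $-\tfrac12[\rho(\nabla)]$ of $-\tfrac12$ times its curvature one-form is a moment map for the action (by pullback) of the group $\mathrm{Symp}(M,\Omega)$ of compactly supported symplectomorphisms on the symplectic affine space $\mathcal{S}(M,\Omega)$, equivariant with respect to the natural actions of $\mathrm{Symp}(M,\Omega)$.
   Context: Abstract index notation is used. Indices are raised and lowered by $X_i=X^p\Omega_{pi}$, $X^i=\Omega^{ip}X_p$, where $\Omega^{ip}\Omega_{pj}=-\delta_j{}^i$. A symplectic connection is a torsion-free affine connection $\nabla$ with $\nabla\Omega=0$; $\mathcal{S}(M,\Omega)$ denotes the set of these, an affine space modeled on $\Gamma(S^3(T^*M))$ (the connection $\nabla+t\Pi$ has difference tensor $t\Pi_{ij}{}^k=t\,\Omega^{kp}\Pi_{ijp}$ with $\nabla$). Curvature: $\nabla_i\nabla_jX^k-\nabla_j\nabla_iX^k=R_{ijp}{}^kX^p$, $R_{ij}=R_{pij}{}^p$ (symmetric for symplectic connections). The curvature one-form is $\rho(\nabla)_i=2\nabla^pR_{ip}$. For sections $\alpha,\beta$ of $S^k(T^*M)$, at least one compactly supported, $\langle\alpha,\beta\rangle=\int_M\alpha_{i_1\dots i_k}\beta^{i_1\dots i_k}\,\Omega$ (here $\dim M=2$). The symplectic form on $\mathcal{S}(M,\Omega)$ is $\mathbf{\Omega}_\nabla(\alpha,\beta)=\langle\alpha,\beta\rangle$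 for $\alpha,\beta\in T_\nabla\mathcal{S}(M,\Omega)=\Gamma(S^3(T^*M))$. The Lie algebra $\mathfrak{symp}(M,\Omega)$ of $\mathrm{Symp}(M,\Omega)$ consists of the compactly supported vector fields $X$ such that $X^\flat=\Omega(X,\cdot)$ (i.e. $X^\flat_i=X_i$) is closed. $\Lambda^k(M)$ is the space of smooth $k$-forms, and $d'$ is the symplectic codifferential $(d'\alpha)_{i_1\dots i_{k-1}}=-\nabla^p\alpha_{pi_1\dots i_{k-1}}$ (independent of the choice of $\nabla\in\mathcal{S}(M,\Omega)$). The space $\Lambda^1(M)/d'\Lambda^2(M)$ is regarded as a space of linear functionals on $\mathfrak{symp}(M,\Omega)$ via $X\mapsto\langle X^\flat,\mu\rangle$ (well defined on classes $[\mu]$). The infinitesimal action of $X$ is $(\mathfrak{L}_X\nabla)_{ij}{}^k=\nabla_i\nabla_jX^k+X^pR_{pij}{}^k$; for $X\in\mathfrak{symp}(M,\Omega)$, $(\mathfrak{L}_X\nabla)_{ijk}$ is completely symmetric. That $\mu:\mathcal{S}(M,\Omega)\to\Lambda^1(M)/d'\Lambda^2(M)$ is an equivariant moment map means that $\mu(\phi^*\nabla)=\phi^*\mu(\nabla)$ for $\phi\in\mathrm{Symp}(M,\Omega)$ and $\tfrac{d}{dt}\big|_{t=0}\langle X^\flat,\mu(\nabla+t\Pi)\rangle=\mathbf{\Omega}_\nabla(\mathfrak{L}_X\nabla,\Pi)$ for all $\nabla\in\mathcal{S}(M,\Omega)$, $X\in\mathfrak{symp}(M,\Omega)$, $\Pi\in\Gamma(S^3(T^*M))$.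 *)

theory Defs
  imports "HOL-Analysis.Analysis" "HOL-Library.Function_Algebras"
begin

section \<open>Smooth functions on open subsets of the plane\<close>

fun Ck_on :: "nat \<Rightarrow> (real^2) set \<Rightarrow> (real^2 \<Rightarrow> real) \<Rightarrow> bool" where
  "Ck_on 0 S f \<longleftrightarrow> continuous_on S f"
| "Ck_on (Suc k) S f \<longleftrightarrow> (\<forall>x\<in>S. f differentiable (at x)) \<and>
     (\<forall>i::2. Ck_on k S (\<lambda>x. frechet_derivative f (at x) (axis i 1)))"

definition smooth_on :: "(real^2) set \<Rightarrow> (real^2 \<Rightarrow> real) \<Rightarrow> bool" where
  "smooth_on S f \<longleftrightarrow> (\<forall>k. Ck_on k S f)"


section \<open>Charts and tensor components\<close>

text \<open>A chart is a pair of its domain and its coordinate map; values of the coordinate map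
  outside the domain are irrelevant.\<close>

type_synonym 'a chart = "'a set \<times> ('a \<Rightarrow> real^2)"

definition inv_chart :: "'a chart \<Rightarrow> real^2 \<Rightarrow> 'a" where
  "inv_chart c = inv_into (fst c) (snd c)"

text \<open>The partial derivative of a function on the surface along the \<open>i\<close>-th coordinate of the
  chart \<open>c\<close>, at the point \<open>p\<close>.\<close>

definition pd :: "'a chart \<Rightarrow> 2 \<Rightarrow> ('a \<Rightarrow> real) \<Rightarrow> 'a \<Rightarrow> real" where
  "pd c i f p = frechet_derivative (\<lambda>x. f (inv_chart c x)) (at (snd c p)) (axis i 1)"

text \<open>A tensor field is the family of its components: \<open>T c p i j \<dots>\<close> is the component with
  indices \<open>i j \<dots>\<close> with respect to the coordinates of the chart \<open>c\<close> at the point \<open>p\<close>. In the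
  same way \<open>\<Gamma> c p i j k\<close> is the Christoffel symbol with lower indices \<open>i j\<close> and upper
  index \<open>k\<close>, so that \<open>\<nabla>\<^sub>i Y\<^sup>k = \<partial>\<^sub>i Y\<^sup>k + \<Gamma>\<^sub>i\<^sub>j\<^sup>k Y\<^sup>j\<close>.\<close>

type_synonym 'a field1 = "'a chart \<Rightarrow> 'a \<Rightarrow> 2 \<Rightarrow> real"
type_synonym 'a field2 = "'a chart \<Rightarrow> 'a \<Rightarrow> 2 \<Rightarrow> 2 \<Rightarrow> real"
type_synonym 'a field3 = "'a chart \<Rightarrow> 'a \<Rightarrow> 2 \<Rightarrow> 2 \<Rightarrow> 2 \<Rightarrow> real"
type_synonym 'a field4 = "'a chart \<Rightarrow> 'a \<Rightarrow> 2 \<Rightarrow> 2 \<Rightarrow> 2 \<Rightarrow> 2 \<Rightarrow> real"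

definition smooth_comp :: "'a chart \<Rightarrow> ('a \<Rightarrow> real) \<Rightarrow> bool" where
  "smooth_comp c f \<longleftrightarrow> smooth_on (snd c ` fst c) (\<lambda>x. f (inv_chart c x))"

text \<open>With \<open>x\<close> the coordinates of \<open>c\<close> and \<open>y\<close> those of \<open>d\<close>: the first derivatives
  \<open>\<partial>(y\<^sup>a \<circ> \<phi>) / \<partial>x\<^sup>i\<close> and the second derivatives \<open>\<partial>\<^sup>2(y\<^sup>a \<circ> \<phi>) / \<partial>x\<^sup>i \<partial>x\<^sup>j\<close>
  at \<open>p\<close>.\<close>

definition D1 :: "('a \<Rightarrow> 'a) \<Rightarrow> 'a chart \<Rightarrow> 'a chart \<Rightarrow> 'a \<Rightarrow> 2 \<Rightarrow> 2 \<Rightarrow> real" where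
  "D1 \<phi> c d p a i = pd c i (\<lambda>q. snd d (\<phi> q) $ a) p"

definition D2 :: "('a \<Rightarrow> 'a) \<Rightarrow> 'a chart \<Rightarrow> 'a chart \<Rightarrow> 'a \<Rightarrow> 2 \<Rightarrow> 2 \<Rightarrow> 2 \<Rightarrow> real" where
  "D2 \<phi> c d p a i j = pd c i (\<lambda>q. D1 \<phi> c d q a j) p"

text \<open>The components at \<open>p\<close> in the chart \<open>c\<close> of the pullback of a field along \<open>\<phi>\<close>, computed from
  its components at \<open>\<phi> p\<close> in the chart \<open>d\<close>. For \<open>\<phi> = id\<close> these are the rules for the
  change of coordinates. In \<open>tr_conn\<close> the map \<open>\<psi>\<close> is the inverse of \<open>\<phi>\<close>.\<close>

definition tr1 :: "('a \<Rightarrow> 'a) \<Rightarrow> 'a chart \<Rightarrow> 'a chart \<Rightarrow> 'a field1 \<Rightarrow> 'a \<Rightarrow> 2 \<Rightarrow> real" where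
  "tr1 \<phi> c d T p i = (\<Sum>a\<in>UNIV. D1 \<phi> c d p a i * T d (\<phi> p) a)"

definition tr2 :: "('a \<Rightarrow> 'a) \<Rightarrow> 'a chart \<Rightarrow> 'a chart \<Rightarrow> 'a field2 \<Rightarrow> 'a \<Rightarrow> 2 \<Rightarrow> 2 \<Rightarrow> real" where
  "tr2 \<phi> c d T p i j =
     (\<Sum>a\<in>UNIV. \<Sum>b\<in>UNIV. D1 \<phi> c d p a i * D1 \<phi> c d p b j * T d (\<phi> p) a b)"

definition tr3 :: "('a \<Rightarrow> 'a) \<Rightarrow> 'a chart \<Rightarrow> 'a chart \<Rightarrow> 'a field3 \<Rightarrow> 'a \<Rightarrow> 2 \<Rightarrow> 2 \<Rightarrow> 2 \<Rightarrow> real" where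
  "tr3 \<phi> c d T p i j k =
     (\<Sum>a\<in>UNIV. \<Sum>b\<in>UNIV. \<Sum>e\<in>UNIV.
        D1 \<phi> c d p a i * D1 \<phi> c d p b j * D1 \<phi> c d p e k * T d (\<phi> p) a b e)"

definition tr_conn ::
  "('a \<Rightarrow> 'a) \<Rightarrow> ('a \<Rightarrow> 'a) \<Rightarrow> 'a chart \<Rightarrow> 'a chart \<Rightarrow> 'a field3 \<Rightarrow> 'a \<Rightarrow> 2 \<Rightarrow> 2 \<Rightarrow> 2 \<Rightarrow> real" where
  "tr_conn \<phi> \<psi> c d \<Gamma> p i j k =
     (\<Sum>m\<in>UNIV. D1 \<psi> d c (\<phi> p) k m *
        (D2 \<phi> c d p m i j +
         (\<Sum>a\<in>UNIV. \<Sum>b\<in>UNIV. D1 \<phi> c d p a i * D1 \<phi> c d p b j * \<Gamma> d (\<phi> p) a b m)))"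


section \<open>Covariant derivatives and curvature\<close>

text \<open>\<open>\<nabla>\<^sub>m X\<^sup>k\<close>\<close>
definition cov_vec :: "'a field3 \<Rightarrow> 'a field1 \<Rightarrow> 'a field2" where
  "cov_vec \<Gamma> X c p m k = pd c m (\<lambda>q. X c q k) p + (\<Sum>a\<in>UNIV. \<Gamma> c p m a k * X c p a)"

text \<open>\<open>\<nabla>\<^sub>m T\<^sub>j\<^sup>k\<close>\<close>
definition cov_mixed :: "'a field3 \<Rightarrow> 'a field2 \<Rightarrow> 'a field3" where
  "cov_mixed \<Gamma> T c p m j k = pd c m (\<lambda>q. T c q j k) p
     - (\<Sum>a\<in>UNIV. \<Gamma> c p m j a * T c p a k) + (\<Sum>a\<in>UNIV. \<Gamma> c p m a k * T c p j a)"

text \<open>\<open>\<nabla>\<^sub>m T\<^sub>i\<^sub>j\<close>\<close>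
definition cov_tensor2 :: "'a field3 \<Rightarrow> 'a field2 \<Rightarrow> 'a field3" where
  "cov_tensor2 \<Gamma> T c p m i j = pd c m (\<lambda>q. T c q i j) p
     - (\<Sum>a\<in>UNIV. \<Gamma> c p m i a * T c p a j) - (\<Sum>a\<in>UNIV. \<Gamma> c p m j a * T c p i a)"

text \<open>\<open>\<nabla>\<^sub>i \<nabla>\<^sub>j X\<^sup>k\<close>\<close>
definition hess_vec :: "'a field3 \<Rightarrow> 'a field1 \<Rightarrow> 'a field3" where
  "hess_vec \<Gamma> X = cov_mixed \<Gamma> (cov_vec \<Gamma> X)"

text \<open>The local coordinate vector field \<open>\<partial>\<^sub>a\<close>; only its components in the chart at hand are used.\<close>
definition frame :: "2 \<Rightarrow> 'a field1" where
  "frame a c p k = (if k = a then 1 else 0)"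

text \<open>\<open>R\<^sub>i\<^sub>j\<^sub>a\<^sup>k\<close>, from the Ricci identity
  \<open>\<nabla>\<^sub>i \<nabla>\<^sub>j X\<^sup>k - \<nabla>\<^sub>j \<nabla>\<^sub>i X\<^sup>k = R\<^sub>i\<^sub>j\<^sub>p\<^sup>k X\<^sup>p\<close>
  applied to \<open>X = \<partial>\<^sub>a\<close>.\<close>
definition curv :: "'a field3 \<Rightarrow> 'a field4" where
  "curv \<Gamma> c p i j a k = hess_vec \<Gamma> (frame a) c p i j k - hess_vec \<Gamma> (frame a) c p j i k"

definition ricci :: "'a field3 \<Rightarrow> 'a field2" where
  "ricci \<Gamma> c p i j = (\<Sum>m\<in>UNIV. curv \<Gamma> c p m i j m)"

text \<open>\<open>(\<LL>\<^sub>X \<nabla>)\<^sub>i\<^sub>j\<^sup>k\<close>\<close>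
definition lie_conn :: "'a field1 \<Rightarrow> 'a field3 \<Rightarrow> 'a field3" where
  "lie_conn X \<Gamma> c p i j k =
     hess_vec \<Gamma> X c p i j k + (\<Sum>m\<in>UNIV. X c p m * curv \<Gamma> c p m i j k)"


section \<open>Smooth surfaces\<close>

locale smooth_surface =
  fixes M :: "'a topology" and A :: "'a chart set"
  assumes hausdorff: "Hausdorff_space M"
    and second_countable: "second_countable M"
    and covers: "(\<Union>c\<in>A. fst c) = topspace M"
    and chart_open: "\<And>c. c \<in> A \<Longrightarrow> openin M (fst c) \<and> open (snd c ` fst c)"
    and chart_homeo: "\<And>c. c \<in> A \<Longrightarrow>
          homeomorphic_map (subtopology M (fst c)) (top_of_set (snd c ` fst c)) (snd c)"
    and transition: "\<And>c d k. c \<in> A \<Longrightarrow> d \<in> A \<Longrightarrow>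
          smooth_on (snd c ` (fst c \<inter> fst d)) (\<lambda>x. snd d (inv_chart c x) $ k)"
begin

definition chart_at :: "'a \<Rightarrow> 'a chart" where
  "chart_at p = (SOME c. c \<in> A \<and> p \<in> fst c)"

text \<open>Component families are normalised to be zero where they carry no information, so that equality
  of fields is equality of functions.\<close>

definition on_charts :: "('a chart \<Rightarrow> 'a \<Rightarrow> 'b::zero) \<Rightarrow> 'a chart \<Rightarrow> 'a \<Rightarrow> 'b" where
  "on_charts T c p = (if c \<in> A \<and> p \<in> fst c then T c p else 0)"

definition vector_fields :: "'a field1 set" where
  "vector_fields = {X. on_charts X = X \<and> (\<forall>c\<in>A. \<forall>k. smooth_comp c (\<lambda>q. X c q k)) \<and>
     (\<forall>c\<in>A. \<forall>d\<in>A. \<forall>p\<in>fst c \<inter> fst d. \<forall>k. X c p k = (\<Sum>m\<in>UNIV. D1 id d c p k m * X d p m))}"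

definition one_forms :: "'a field1 set" where
  "one_forms = {T. on_charts T = T \<and> (\<forall>c\<in>A. \<forall>i. smooth_comp c (\<lambda>q. T c q i)) \<and>
     (\<forall>c\<in>A. \<forall>d\<in>A. \<forall>p\<in>fst c \<inter> fst d. T c p = tr1 id c d T p)}"

definition two_forms :: "'a field2 set" where
  "two_forms = {T. on_charts T = T \<and> (\<forall>c\<in>A. \<forall>i j. smooth_comp c (\<lambda>q. T c q i j)) \<and>
     (\<forall>c\<in>A. \<forall>d\<in>A. \<forall>p\<in>fst c \<inter> fst d. T c p = tr2 id c d T p) \<and>
     (\<forall>c p i j. T c p i j = - T c p j i)}"

definition sym3_tensors :: "'a field3 set" where
  "sym3_tensors = {T. on_charts T = T \<and> (\<forall>c\<in>A. \<forall>i j k. smooth_comp c (\<lambda>q. T c q i j k)) \<and>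
     (\<forall>c\<in>A. \<forall>d\<in>A. \<forall>p\<in>fst c \<inter> fst d. T c p = tr3 id c d T p) \<and>
     (\<forall>c p i j k. T c p i j k = T c p j i k \<and> T c p i j k = T c p i k j)}"

definition affine_connections :: "'a field3 set" where
  "affine_connections = {\<Gamma>. on_charts \<Gamma> = \<Gamma> \<and>
     (\<forall>c\<in>A. \<forall>i j k. smooth_comp c (\<lambda>q. \<Gamma> c q i j k)) \<and>
     (\<forall>c\<in>A. \<forall>d\<in>A. \<forall>p\<in>fst c \<inter> fst d. \<Gamma> c p = tr_conn id id c d \<Gamma> p)}"

definition smooth_map :: "('a \<Rightarrow> 'a) \<Rightarrow> bool" where
  "smooth_map \<phi> \<longleftrightarrow> continuous_map M M \<phi> \<and>
     (\<forall>c\<in>A. \<forall>d\<in>A. \<forall>k. smooth_on (snd c ` {p \<in> fst c. \<phi> p \<in> fst d})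
                                  (\<lambda>x. snd d (\<phi> (inv_chart c x)) $ k))"

abbreviation inv_map :: "('a \<Rightarrow> 'a) \<Rightarrow> 'a \<Rightarrow> 'a" where
  "inv_map \<phi> \<equiv> inv_into (topspace M) \<phi>"

definition diffeo :: "('a \<Rightarrow> 'a) \<Rightarrow> bool" where
  "diffeo \<phi> \<longleftrightarrow> bij_betw \<phi> (topspace M) (topspace M) \<and> smooth_map \<phi> \<and> smooth_map (inv_map \<phi>)"

definition pull1 :: "('a \<Rightarrow> 'a) \<Rightarrow> 'a field1 \<Rightarrow> 'a field1" where
  "pull1 \<phi> T = on_charts (\<lambda>c p. tr1 \<phi> c (chart_at (\<phi> p)) T p)"

definition pull2 :: "('a \<Rightarrow> 'a) \<Rightarrow> 'a field2 \<Rightarrow> 'a field2" where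
  "pull2 \<phi> T = on_charts (\<lambda>c p. tr2 \<phi> c (chart_at (\<phi> p)) T p)"

definition pull_conn :: "('a \<Rightarrow> 'a) \<Rightarrow> 'a field3 \<Rightarrow> 'a field3" where
  "pull_conn \<phi> \<Gamma> = on_charts (\<lambda>c p. tr_conn \<phi> (inv_map \<phi>) c (chart_at (\<phi> p)) \<Gamma> p)"

definition support :: "('a \<Rightarrow> real) \<Rightarrow> 'a set" where
  "support f = M closure_of {p \<in> topspace M. f p \<noteq> 0}"

text \<open>A finite smooth partition of unity on the set \<open>K\<close>, with compact supports contained in the
  domains of the charts \<open>C 0, \<dots>, C (n-1)\<close>.\<close>

definition partition_of_unity :: "'a set \<Rightarrow> nat \<Rightarrow> (nat \<Rightarrow> 'a chart) \<Rightarrow> (nat \<Rightarrow> 'a \<Rightarrow> real) \<Rightarrow> bool" where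
  "partition_of_unity K n C u \<longleftrightarrow>
     (\<forall>j<n. C j \<in> A \<and> (\<forall>c\<in>A. smooth_comp c (u j)) \<and> (\<forall>p. 0 \<le> u j p) \<and>
            compactin M (support (u j)) \<and> support (u j) \<subseteq> fst (C j)) \<and>
     (\<forall>p\<in>K. (\<Sum>j<n. u j p) = 1)"

end


section \<open>Symplectic surfaces\<close>

text \<open>In dimension two the closedness assumption is automatic.\<close>

locale symplectic_surface = smooth_surface M A
  for M :: "'a topology" and A :: "'a chart set" +
  fixes \<Omega> :: "'a field2"
  assumes form: "\<Omega> \<in> two_forms"
    and nondegenerate: "\<And>c p. c \<in> A \<Longrightarrow> p \<in> fst c \<Longrightarrow> invertible ((\<chi> i j. \<Omega> c p i j) :: real^2^2)"
    and closed_form: "\<And>c p i j k. c \<in> A \<Longrightarrow> p \<in> fst c \<Longrightarrow>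
          pd c i (\<lambda>q. \<Omega> c q j k) p + pd c j (\<lambda>q. \<Omega> c q k i) p + pd c k (\<lambda>q. \<Omega> c q i j) p = 0"
begin

text \<open>\<open>\<Omega>\<^sup>i\<^sup>j\<close>, with the sign convention \<open>\<Omega>\<^sup>i\<^sup>p \<Omega>\<^sub>p\<^sub>j = - \<delta>\<^sub>j\<^sup>i\<close>.\<close>
definition \<Omega>up :: "'a field2" where
  "\<Omega>up c p i j = - matrix_inv ((\<chi> a b. \<Omega> c p a b) :: real^2^2) $ i $ j"

text \<open>\<open>X\<^sub>i = X\<^sup>m \<Omega>\<^sub>m\<^sub>i\<close>\<close>
definition flat :: "'a field1 \<Rightarrow> 'a field1" where
  "flat X = on_charts (\<lambda>c p i. \<Sum>m\<in>UNIV. X c p m * \<Omega> c p m i)"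

text \<open>\<open>\<beta>\<^sup>i\<close> and \<open>\<beta>\<^sup>i\<^sup>j\<^sup>k\<close>\<close>
definition raise1 :: "'a field1 \<Rightarrow> 'a field1" where
  "raise1 \<beta> c p i = (\<Sum>a\<in>UNIV. \<Omega>up c p i a * \<beta> c p a)"

definition raise3 :: "'a field3 \<Rightarrow> 'a field3" where
  "raise3 \<beta> c p i j k =
     (\<Sum>a\<in>UNIV. \<Sum>b\<in>UNIV. \<Sum>e\<in>UNIV. \<Omega>up c p i a * \<Omega>up c p j b * \<Omega>up c p k e * \<beta> c p a b e)"

text \<open>The integral of \<open>f \<Omega>\<close> over the surface oriented by \<open>\<Omega>\<close>. A chart need not be positively
  oriented, whence the absolute value. The result does not depend on the partition of unity if \<open>f\<close>
  is continuous with compact support.\<close>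

definition chart_integral :: "'a chart \<Rightarrow> ('a \<Rightarrow> real) \<Rightarrow> real" where
  "chart_integral c f =
     integral (snd c ` fst c) (\<lambda>x. f (inv_chart c x) * \<bar>\<Omega> c (inv_chart c x) 1 2\<bar>)"

definition surface_integral :: "('a \<Rightarrow> real) \<Rightarrow> real" where
  "surface_integral f = (THE r. \<exists>n C u. partition_of_unity (support f) n C u \<and>
     r = (\<Sum>j<n. chart_integral (C j) (\<lambda>p. u j p * f p)))"

text \<open>The integrands are scalars, so they may be computed in any chart around the point.\<close>

definition pairing1 :: "'a field1 \<Rightarrow> 'a field1 \<Rightarrow> real" where
  "pairing1 \<alpha> \<beta> = surface_integral (\<lambda>p. let c = chart_at p in
     \<Sum>i\<in>UNIV. \<alpha> c p i * raise1 \<beta> c p i)"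

definition pairing3 :: "'a field3 \<Rightarrow> 'a field3 \<Rightarrow> real" where
  "pairing3 \<alpha> \<beta> = surface_integral (\<lambda>p. let c = chart_at p in
     \<Sum>i\<in>UNIV. \<Sum>j\<in>UNIV. \<Sum>k\<in>UNIV. \<alpha> c p i j k * raise3 \<beta> c p i j k)"

definition symplectic_connections :: "'a field3 set" where
  "symplectic_connections = {\<Gamma> \<in> affine_connections.
     (\<forall>c\<in>A. \<forall>p\<in>fst c. \<forall>i j k. \<Gamma> c p i j k = \<Gamma> c p j i k) \<and>
     (\<forall>c\<in>A. \<forall>p\<in>fst c. \<forall>m i j. cov_tensor2 \<Gamma> \<Omega> c p m i j = 0)}"

text \<open>\<open>\<nabla> + t\<Pi>\<close>, whose difference tensor with \<open>\<nabla>\<close> is \<open>t \<Pi>\<^sub>i\<^sub>j\<^sup>k = t \<Omega>\<^sup>k\<^sup>m \<Pi>\<^sub>i\<^sub>j\<^sub>m\<close>\<close>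
definition translate :: "'a field3 \<Rightarrow> real \<Rightarrow> 'a field3 \<Rightarrow> 'a field3" where
  "translate \<Gamma> t P = on_charts (\<lambda>c p i j k.
     \<Gamma> c p i j k + t * (\<Sum>m\<in>UNIV. \<Omega>up c p k m * P c p i j m))"

text \<open>The curvature one-form \<open>\<rho>\<^sub>i = 2 \<nabla>\<^sup>a R\<^sub>i\<^sub>a = 2 \<Omega>\<^sup>a\<^sup>b \<nabla>\<^sub>b R\<^sub>i\<^sub>a\<close>\<close>
definition curvature_one_form :: "'a field3 \<Rightarrow> 'a field1" where
  "curvature_one_form \<Gamma> = on_charts (\<lambda>c p i.
     2 * (\<Sum>a\<in>UNIV. \<Sum>b\<in>UNIV. \<Omega>up c p a b * cov_tensor2 \<Gamma> (ricci \<Gamma>) c p b i a))"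

text \<open>\<open>(d'\<alpha>)\<^sub>i = - \<nabla>\<^sup>a \<alpha>\<^sub>a\<^sub>i = - \<Omega>\<^sup>a\<^sup>b \<nabla>\<^sub>b \<alpha>\<^sub>a\<^sub>i\<close>, which does not depend on the
  symplectic connection used.\<close>
definition codiff_wrt :: "'a field3 \<Rightarrow> 'a field2 \<Rightarrow> 'a field1" where
  "codiff_wrt \<Gamma> \<alpha> = on_charts (\<lambda>c p i.
     - (\<Sum>a\<in>UNIV. \<Sum>b\<in>UNIV. \<Omega>up c p a b * cov_tensor2 \<Gamma> \<alpha> c p b a i))"

definition codiff :: "'a field2 \<Rightarrow> 'a field1" where
  "codiff = codiff_wrt (SOME \<Gamma>. \<Gamma> \<in> symplectic_connections)"

definition form_class :: "'a field1 \<Rightarrow> 'a field1 set" where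
  "form_class \<alpha> = {\<alpha> + codiff \<beta> | \<beta>. \<beta> \<in> two_forms}"

definition form_quotient :: "'a field1 set set" where
  "form_quotient = form_class ` one_forms"

definition pull_class :: "('a \<Rightarrow> 'a) \<Rightarrow> 'a field1 set \<Rightarrow> 'a field1 set" where
  "pull_class \<phi> K = pull1 \<phi> ` K"

definition Symp :: "('a \<Rightarrow> 'a) set" where
  "Symp = {\<phi>. diffeo \<phi> \<and> pull2 \<phi> \<Omega> = \<Omega> \<and>
     compactin M (M closure_of {p \<in> topspace M. \<phi> p \<noteq> p})}"

definition symp_fields :: "'a field1 set" where
  "symp_fields = {X \<in> vector_fields.
     compactin M (M closure_of {p \<in> topspace M. \<exists>c\<in>A. p \<in> fst c \<and> (\<exists>k. X c p k \<noteq> 0)}) \<and>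
     (\<forall>c\<in>A. \<forall>p\<in>fst c. \<forall>i j. pd c i (\<lambda>q. flat X c q j) p = pd c j (\<lambda>q. flat X c q i) p)}"

text \<open>The functional on \<^const>\<open>symp_fields\<close> given by a class of one-forms.\<close>
definition class_pairing :: "'a field1 \<Rightarrow> 'a field1 set \<Rightarrow> real" where
  "class_pairing X K = (THE r. \<forall>\<mu>\<in>K. pairing1 (flat X) \<mu> = r)"

text \<open>The tangent vector \<open>(\<LL>\<^sub>X \<nabla>)\<^sub>i\<^sub>j\<^sub>k\<close> of the space of symplectic connections.\<close>
definition inf_action :: "'a field1 \<Rightarrow> 'a field3 \<Rightarrow> 'a field3" where
  "inf_action X \<Gamma> = on_charts (\<lambda>c p i j k. \<Sum>m\<in>UNIV. lie_conn X \<Gamma> c p i j m * \<Omega> c p m k)"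

definition conn_form :: "'a field3 \<Rightarrow> 'a field3 \<Rightarrow> 'a field3 \<Rightarrow> real" where
  "conn_form \<Gamma> \<alpha> \<beta> = pairing3 \<alpha> \<beta>"

definition equivariant_moment_map :: "('a field3 \<Rightarrow> 'a field1 set) \<Rightarrow> bool" where
  "equivariant_moment_map \<mu> \<longleftrightarrow>
     (\<forall>\<Gamma>\<in>symplectic_connections. \<mu> \<Gamma> \<in> form_quotient) \<and>
     (\<forall>\<phi>\<in>Symp. \<forall>\<Gamma>\<in>symplectic_connections.
        pull_conn \<phi> \<Gamma> \<in> symplectic_connections \<and> \<mu> (pull_conn \<phi> \<Gamma>) = pull_class \<phi> (\<mu> \<Gamma>)) \<and>
     (\<forall>\<Gamma>\<in>symplectic_connections. \<forall>X\<in>symp_fields. \<forall>P\<in>sym3_tensors.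
        ((\<lambda>t. class_pairing X (\<mu> (translate \<Gamma> t P)))
           has_real_derivative conn_form \<Gamma> (inf_action X \<Gamma>) P) (at 0))"

text \<open>The map \<open>\<nabla> \<mapsto> - 1/2 [\<rho>(\<nabla>)]\<close>\<close>
definition curvature_moment :: "'a field3 \<Rightarrow> 'a field1 set" where
  "curvature_moment \<Gamma> = form_class (\<lambda>c p i. - (1/2) * curvature_one_form \<Gamma> c p i)"

end

end

theory Submission
  imports Defs "HOL-Computational_Algebra.Polynomial"
begin

text \<open>
  In dimension two a two-form is \<open>f \<Omega>\<close> for a function \<open>f\<close>, and \<open>d'(f \<Omega>) = - d f\<close>; hence the class of a
  one-form is its class modulo exact forms, and equivariance is the naturality of the curvature
  one-form. The functional of a class is \<open>X \<mapsto> - \<integral> X\<^sup>i \<mu>\<^sub>i \<Omega>\<close>. It vanishes on exact forms because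
  a closed \<open>X\<^sup>\<flat>\<close> means \<open>div X = 0\<close>.

  Along \<open>\<nabla> + t \<Pi>\<close> the integrand \<open>X\<^sup>i \<rho>\<^sub>i\<close> is a cubic polynomial in \<open>t\<close> whose linear coefficient is
  \<open>2 X\<^sup>i \<Omega>\<^sup>a\<^sup>b (\<nabla>\<^sub>b \<nabla>\<^sub>m \<Pi>\<^sub>i\<^sub>a\<^sup>m - \<Pi>\<^sub>b\<^sub>i\<^sup>m R\<^sub>m\<^sub>a)\<close>. Since \<open>R\<^sub>p\<^sub>i\<^sub>j\<^sup>m = \<delta>\<^sub>p\<^sup>m R\<^sub>i\<^sub>j - \<delta>\<^sub>i\<^sup>m R\<^sub>p\<^sub>j\<close> on a surface,
  half of it differs from \<open>(\<LL>\<^sub>X \<nabla>)\<^sub>i\<^sub>j\<^sub>k \<Pi>\<^sup>i\<^sup>j\<^sup>k\<close> by a divergence. Both sides are linear in \<open>X\<close>, so a partition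
  of unity reduces the vanishing of the integral of this divergence to fields \<open>X\<close> supported in a
  single chart, where only the coordinate expression of the divergence is needed.
\<close>

section \<open>Partial derivatives and germs of smooth functions\<close>

text \<open>Two cut-offs go in opposite directions. The moment identity is proved for arbitrary
  vector fields, since a field multiplied by a cut-off function is no longer closed. Vanishing on
  exact forms needs the closedness of X, so there the potential is cut off and X is kept.

  Linearity of the integral is available only for smooth, compactly supported scalars. The
  coefficients of the cubic in t are therefore interpolated from its values at t = 0, 1, -1, 2, -2,
  each of which is the contraction of X with the curvature one-form of a genuine symplectic
  connection. The cubic is then integrated coefficient by coefficient, with no differentiation under
  the integral over the surface.

  Independence of the chart and naturality under symplectomorphisms are one statement, because a
  change of chart is the pullback by the identity. Components are compared after multiplication by
  Jacobians, without inverses, so that the connection law composes by the chain rule.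

  The factor -1/2 cancels the 2 in \<rho> and the sign produced by interchanging the levels of a
  contracted index pair.\<close>

definition partial :: "2 \<Rightarrow> (real^2 \<Rightarrow> real) \<Rightarrow> real^2 \<Rightarrow> real" where
  "partial i f x = frechet_derivative f (at x) (axis i 1)"

text \<open>Smoothness of the germ at x: every operation may shrink the open set, so no domains have
  to be carried along.\<close>

definition smooth_near :: "real^2 \<Rightarrow> (real^2 \<Rightarrow> real) \<Rightarrow> bool" where
  "smooth_near x f \<longleftrightarrow> (\<exists>T. open T \<and> x \<in> T \<and> smooth_on T f)"

lemma partial_eq:
  assumes "(f has_derivative D) (at x)"
  shows "partial i f x = D (axis i 1)"
  using frechet_derivative_at[OF assms] by (simp add: partial_def)

lemma has_derivative_partial:
  assumes "f differentiable (at x)"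
  shows "(f has_derivative (\<lambda>h. \<Sum>i\<in>UNIV. h $ i * partial i f x)) (at x)"
proof -
  have d: "(f has_derivative frechet_derivative f (at x)) (at x)"
    using assms frechet_derivative_works by blast
  then have lin: "linear (frechet_derivative f (at x))"
    by (rule has_derivative_linear)
  have "frechet_derivative f (at x) h = (\<Sum>i\<in>UNIV. h $ i * partial i f x)" for h
  proof -
    have "h = (\<Sum>i\<in>UNIV. h $ i *\<^sub>R axis i 1)"
      by (simp add: vec_eq_iff axis_def if_distrib cong: if_cong)
    then have "frechet_derivative f (at x) h = frechet_derivative f (at x) (\<Sum>i\<in>UNIV. h $ i *\<^sub>R axis i 1)"
      by simp
    also have "\<dots> = (\<Sum>i\<in>UNIV. h $ i * partial i f x)"
      by (simp add: linear_sum[OF lin] linear_scale[OF lin] partial_def)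
    finally show ?thesis .
  qed
  then show ?thesis
    using d by presburger
qed

lemma partial_cong_open:
  assumes "open S" "x \<in> S" "\<And>y. y \<in> S \<Longrightarrow> f y = g y"
  shows "partial i f x = partial i g x"
proof (cases "f differentiable (at x)")
  case True
  then obtain D where D: "(f has_derivative D) (at x)"
    using differentiable_def by blast
  have "(g has_derivative D) (at x)"
    by (rule has_derivative_transform_within_open[OF D assms(1,2)]) (simp add: assms(3))
  then show ?thesis
    using D by (simp add: partial_eq)
next
  case False
  \<comment> \<open>Without differentiability \<open>frechet_derivative\<close> is an arbitrary
    choice; functions that agree near x have the same derivatives at x, hence the same
    choice.\<close>
  have "(f has_derivative D) (at x) \<longleftrightarrow> (g has_derivative D) (at x)" for D
    using has_derivative_transform_within_open[of f D x UNIV S g]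
      has_derivative_transform_within_open[of g D x UNIV S f] assms by auto
  then show ?thesis
    by (simp add: partial_def frechet_derivative_def)
qed

lemma differentiable_cong_open:
  assumes "open S" "x \<in> S" "\<And>y. y \<in> S \<Longrightarrow> f y = g y" "f differentiable (at x)"
  shows "g differentiable (at x)"
  using assms has_derivative_transform_within_open[of f _ x UNIV S g]
  unfolding differentiable_def by blast

lemma Ck_on_Suc_partial:
  "Ck_on (Suc k) S f \<longleftrightarrow> (\<forall>x\<in>S. f differentiable (at x)) \<and> (\<forall>i. Ck_on k S (partial i f))"
proof -
  have "partial i f = (\<lambda>x. frechet_derivative f (at x) (axis i 1))" for i
    by (simp add: fun_eq_iff partial_def)
  then show ?thesis by simp
qed

declare Ck_on.simps(2)[simp del]

lemma Ck_on_subset: "Ck_on k S f \<Longrightarrow> T \<subseteq> S \<Longrightarrow> Ck_on k T f"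
  by (induction k arbitrary: f) (auto simp: Ck_on_Suc_partial intro: continuous_on_subset)

lemma Ck_on_Suc_imp: "Ck_on (Suc k) S f \<Longrightarrow> Ck_on k S f"
proof (induction k arbitrary: f)
  case 0
  then show ?case
    by (auto simp: Ck_on_Suc_partial intro!: continuous_at_imp_continuous_on differentiable_imp_continuous_within)
next
  case (Suc k)
  then have "Ck_on (Suc k) S (partial i f)" for i
    by (simp add: Ck_on_Suc_partial[of "Suc k"])
  then have "Ck_on k S (partial i f)" for i
    using Suc.IH by blast
  then show ?case
    using Suc.prems by (simp add: Ck_on_Suc_partial)
qed

lemma Ck_on_cong:
  assumes "open S"
  shows "(\<And>x. x \<in> S \<Longrightarrow> f x = g x) \<Longrightarrow> Ck_on k S f \<Longrightarrow> Ck_on k S g"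
proof (induction k arbitrary: f g)
  case 0
  then show ?case by (simp cong: continuous_on_cong)
next
  case (Suc k)
  have "Ck_on k S (partial i g)" for i
    using Suc.IH[of "partial i f" "partial i g"] partial_cong_open[OF assms _ Suc.prems(1)] Suc.prems(2)
    by (simp add: Ck_on_Suc_partial)
  moreover have "\<forall>x\<in>S. g differentiable (at x)"
    using differentiable_cong_open[OF assms _ Suc.prems(1)] Suc.prems(2)
    by (simp add: Ck_on_Suc_partial)
  ultimately show ?case by (simp add: Ck_on_Suc_partial)
qed

lemma Ck_on_local:
  assumes "\<And>x. x \<in> S \<Longrightarrow> \<exists>T. open T \<and> x \<in> T \<and> Ck_on k T f"
  shows "Ck_on k S f"
  using assms
proof (induction k arbitrary: f)
  case 0
  show ?case unfolding Ck_on.simps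
  proof (rule continuous_at_imp_continuous_on, rule ballI)
    fix x assume "x \<in> S"
    then show "isCont f x"
      using 0 continuous_on_interior[of _ f x] by (fastforce simp: interior_open)
  qed
next
  case (Suc k)
  have "Ck_on k S (partial i f)" for i
    by (rule Suc.IH) (use Suc.prems in \<open>meson Ck_on_Suc_partial\<close>)
  moreover have "\<forall>x\<in>S. f differentiable (at x)"
    using Suc.prems by (auto simp: Ck_on_Suc_partial)
  ultimately show ?case by (simp add: Ck_on_Suc_partial)
qed

lemma smooth_on_iff_near:
  assumes "open S"
  shows "smooth_on S f \<longleftrightarrow> (\<forall>x\<in>S. smooth_near x f)"
proof
  show "smooth_on S f \<Longrightarrow> \<forall>x\<in>S. smooth_near x f"
    using assms smooth_near_def by blast
  assume "\<forall>x\<in>S. smooth_near x f"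
  then show "smooth_on S f"
    unfolding smooth_near_def smooth_on_def using Ck_on_local by metis
qed

lemma smooth_near_cong:
  assumes "open S" "x \<in> S" "\<And>y. y \<in> S \<Longrightarrow> f y = g y" "smooth_near x f"
  shows "smooth_near x g"
proof -
  obtain T where T: "open T" "x \<in> T" "smooth_on T f"
    using assms(4) smooth_near_def by blast
  have "Ck_on k (S \<inter> T) g" for k
    by (rule Ck_on_cong[of _ f])
      (use T assms in \<open>auto simp: smooth_on_def intro: Ck_on_subset\<close>)
  then have "smooth_on (S \<inter> T) g" by (simp add: smooth_on_def)
  then show ?thesis
    unfolding smooth_near_def using T assms by (intro exI[of _ "S \<inter> T"]) auto
qed

lemma smooth_near_differentiable: "smooth_near x f \<Longrightarrow> f differentiable (at x)"
  unfolding smooth_near_def smooth_on_def by (metis Ck_on_Suc_partial)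

lemma smooth_near_isCont: "smooth_near x f \<Longrightarrow> isCont f x"
  by (simp add: differentiable_imp_continuous_within smooth_near_differentiable)

lemma smooth_near_partial: "smooth_near x f \<Longrightarrow> smooth_near x (partial i f)"
  unfolding smooth_near_def smooth_on_def by (metis Ck_on_Suc_partial)

lemma partial_const [simp]: "partial i (\<lambda>x. c) x = 0"
  by (simp add: partial_def)

lemma partial_component: "partial i (\<lambda>x. x $ j) x = (if i = j then 1 else 0)"
  using partial_eq[OF bounded_linear_imp_has_derivative[OF bounded_linear_vec_nth[of j]]]
  by (simp add: axis_def)

lemma partial_add:
  assumes "f differentiable (at x)" "g differentiable (at x)"
  shows "partial i (\<lambda>x. f x + g x) x = partial i f x + partial i g x"
  using partial_eq[OF has_derivative_add[OF assms(1)[unfolded frechet_derivative_works]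
      assms(2)[unfolded frechet_derivative_works]], of i]
  by (simp add: partial_def)

lemma partial_mult:
  assumes "f differentiable (at x)" "g differentiable (at x)"
  shows "partial i (\<lambda>x. f x * g x) x = f x * partial i g x + partial i f x * g x"
  using partial_eq[OF has_derivative_mult[OF assms(1)[unfolded frechet_derivative_works]
      assms(2)[unfolded frechet_derivative_works]], of i]
  by (simp add: partial_def)

lemma partial_inverse:
  assumes "f differentiable (at x)" "f x \<noteq> 0"
  shows "partial i (\<lambda>x. inverse (f x)) x = - (partial i f x * (inverse (f x) * inverse (f x)))"
  using partial_eq[OF Deriv.has_derivative_inverse[OF assms(2) assms(1)[unfolded frechet_derivative_works]], of i]
  by (simp add: partial_def mult_ac)

lemma has_derivative_vec2:
  fixes F :: "real^2 \<Rightarrow> real^2"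
  assumes "\<And>a. (\<lambda>y. F y $ a) differentiable (at x)"
  shows "(F has_derivative (\<lambda>h. \<chi> a. \<Sum>i\<in>UNIV. h $ i * partial i (\<lambda>y. F y $ a) x)) (at x)"
proof -
  have "((\<lambda>y. F y \<bullet> b) has_derivative (\<lambda>h. (\<chi> a. \<Sum>i\<in>UNIV. h $ i * partial i (\<lambda>y. F y $ a) x) \<bullet> b)) (at x)"
    if "b \<in> Basis" for b
  proof -
    obtain a where "b = axis a 1"
      using \<open>b \<in> Basis\<close> by (auto simp: Basis_vec_def)
    then show ?thesis
      using has_derivative_partial[OF assms[of a]] by (simp add: inner_axis)
  qed
  then show ?thesis
    by (subst has_derivative_componentwise_within) blast
qed

lemma partial_compose:
  assumes "f differentiable (at (F x))" "\<And>a. (\<lambda>y. F y $ a) differentiable (at x)"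
  shows "partial i (\<lambda>y. f (F y)) x = (\<Sum>a\<in>UNIV. partial i (\<lambda>y. F y $ a) x * partial a f (F x))"
    and "(\<lambda>y. f (F y)) differentiable (at x)"
proof -
  have *: "((\<lambda>y. f (F y)) has_derivative (\<lambda>h. \<Sum>a\<in>UNIV. (\<Sum>i\<in>UNIV. h $ i * partial i (\<lambda>y. F y $ a) x) * partial a f (F x))) (at x)"
    using diff_chain_at[OF has_derivative_vec2[OF assms(2)] has_derivative_partial[OF assms(1)]]
    by (simp add: o_def)
  then show "(\<lambda>y. f (F y)) differentiable (at x)"
    using differentiable_def by blast
  show "partial i (\<lambda>y. f (F y)) x = (\<Sum>a\<in>UNIV. partial i (\<lambda>y. F y $ a) x * partial a f (F x))"
    unfolding partial_eq[OF *]
    by (simp add: axis_def if_distrib[of "\<lambda>x. x * _"] cong: if_cong)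
qed

section \<open>Closure of the C^k functions under sums, products, reciprocals and
  composition\<close>

lemma Ck_on_const: "Ck_on k S (\<lambda>x. c)"
proof (induction k arbitrary: c)
  case (Suc k)
  have "partial i (\<lambda>x. c) = (\<lambda>x. 0)" for i by (simp add: fun_eq_iff)
  then show ?case using Suc by (simp add: Ck_on_Suc_partial)
qed simp

lemma Ck_on_component: "Ck_on k S (\<lambda>x. x $ j)"
proof (cases k)
  case (Suc l)
  have "partial i (\<lambda>x. x $ j) = (\<lambda>x. if i = j then 1 else 0)" for i
    by (simp add: fun_eq_iff partial_component)
  moreover have "(\<lambda>x. x $ j) differentiable (at x)" for x :: "real^2"
    by (simp add: bounded_linear_imp_differentiable bounded_linear_vec_nth)
  ultimately show ?thesis using Suc by (simp add: Ck_on_Suc_partial Ck_on_const)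
qed (auto intro: continuous_intros)

lemma Ck_on_add:
  assumes "open S"
  shows "Ck_on k S f \<Longrightarrow> Ck_on k S g \<Longrightarrow> Ck_on k S (\<lambda>x. f x + g x)"
proof (induction k arbitrary: f g)
  case (Suc k)
  have "Ck_on k S (\<lambda>x. partial i f x + partial i g x)" for i
    using Suc by (simp add: Ck_on_Suc_partial)
  then have "Ck_on k S (partial i (\<lambda>x. f x + g x))" for i
    by (rule Ck_on_cong[OF assms, rotated]) (use Suc.prems in \<open>simp add: Ck_on_Suc_partial partial_add\<close>)
  then show ?case using Suc.prems by (simp add: Ck_on_Suc_partial)
qed (auto intro: continuous_intros)

lemma Ck_on_mult:
  assumes "open S"
  shows "Ck_on k S f \<Longrightarrow> Ck_on k S g \<Longrightarrow> Ck_on k S (\<lambda>x. f x * g x)"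
proof (induction k arbitrary: f g)
  case (Suc k)
  have "Ck_on k S (\<lambda>x. f x * partial i g x + partial i f x * g x)" for i
    using Suc Ck_on_Suc_imp[OF Suc.prems(1)] Ck_on_Suc_imp[OF Suc.prems(2)]
    by (simp add: Ck_on_Suc_partial Ck_on_add[OF assms])
  then have "Ck_on k S (partial i (\<lambda>x. f x * g x))" for i
    by (rule Ck_on_cong[OF assms, rotated]) (use Suc.prems in \<open>simp add: Ck_on_Suc_partial partial_mult\<close>)
  then show ?case using Suc.prems by (simp add: Ck_on_Suc_partial)
qed (auto intro: continuous_intros)

text \<open>The derivative of 1/f is a product of a partial derivative of f with two copies of 1/f,
  so induction on k with f fixed gains one order.\<close>

lemma Ck_on_inverse:
  assumes "open S" "\<And>x. x \<in> S \<Longrightarrow> f x \<noteq> 0"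
  shows "Ck_on k S f \<Longrightarrow> Ck_on k S (\<lambda>x. inverse (f x))"
proof (induction k)
  case 0
  then show ?case using assms by (auto intro: continuous_intros)
next
  case (Suc k)
  have i: "Ck_on k S (\<lambda>x. inverse (f x))"
    using Suc Ck_on_Suc_imp by blast
  have "Ck_on k S (\<lambda>x. (- 1) * (partial i f x * (inverse (f x) * inverse (f x))))" for i
    using Suc.prems i by (intro Ck_on_mult[OF assms(1)] Ck_on_const) (auto simp: Ck_on_Suc_partial)
  then have "Ck_on k S (partial i (\<lambda>x. inverse (f x)))" for i
    by (rule Ck_on_cong[OF assms(1), rotated])
      (use Suc.prems assms in \<open>simp add: Ck_on_Suc_partial partial_inverse\<close>)
  moreover have "\<forall>x\<in>S. (\<lambda>x. inverse (f x)) differentiable (at x)"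
    using Suc.prems assms by (simp add: Ck_on_Suc_partial)
  ultimately show ?case by (simp add: Ck_on_Suc_partial)
qed

lemma Ck_on_sum:
  assumes "open S" "finite I" "\<And>i. i \<in> I \<Longrightarrow> Ck_on k S (f i)"
  shows "Ck_on k S (\<lambda>x. \<Sum>i\<in>I. f i x)"
  using assms(2,3) by (induction I rule: finite_induct) (auto intro: Ck_on_add[OF assms(1)] Ck_on_const)

text \<open>The chain rule replaces f by its partial derivatives and keeps F, so the induction
  generalises over f only.\<close>

lemma Ck_on_compose:
  assumes "open S" "F ` S \<subseteq> T"
  shows "Ck_on k T f \<Longrightarrow> (\<And>a. Ck_on k S (\<lambda>x. F x $ a)) \<Longrightarrow> Ck_on k S (\<lambda>x. f (F x))"
proof (induction k arbitrary: f)
  case 0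
  have "continuous_on S F"
    using continuous_on_vec_lambda[of S "\<lambda>a x. F x $ a"] 0(2) by simp
  then show ?case
    using 0 assms(2) by (auto intro: continuous_on_compose2)
next
  case (Suc k)
  have d: "f differentiable (at (F x))" "(\<lambda>y. F y $ a) differentiable (at x)" if "x \<in> S" for x a
    using Suc.prems assms(2) that by (auto simp: Ck_on_Suc_partial)
  have "Ck_on k S (\<lambda>x. \<Sum>a\<in>UNIV. partial i (\<lambda>y. F y $ a) x * partial a f (F x))" for i
  proof (rule Ck_on_sum[OF assms(1)])
    fix a :: 2
    have "Ck_on k S (\<lambda>x. partial a f (F x))"
      using Suc.prems Ck_on_Suc_imp[OF Suc.prems(2)]
      by (intro Suc.IH[of "partial a f"]) (simp_all add: Ck_on_Suc_partial)
    moreover have "Ck_on k S (partial i (\<lambda>y. F y $ a))"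
      using Suc.prems by (simp add: Ck_on_Suc_partial)
    ultimately show "Ck_on k S (\<lambda>x. partial i (\<lambda>y. F y $ a) x * partial a f (F x))"
      by (intro Ck_on_mult[OF assms(1)])
  qed simp
  then have "Ck_on k S (partial i (\<lambda>y. f (F y)))" for i
    by (rule Ck_on_cong[OF assms(1), rotated]) (simp add: partial_compose(1) d)
  then show ?case
    using partial_compose(2)[of f F] d by (simp add: Ck_on_Suc_partial)
qed

lemma smooth_near_const: "smooth_near x (\<lambda>x. c)"
  unfolding smooth_near_def smooth_on_def using Ck_on_const by blast

lemma smooth_near_common:
  assumes "smooth_near x f" "smooth_near x g"
  obtains T where "open T" "x \<in> T" "smooth_on T f" "smooth_on T g"
proof -
  obtain U V where "open U" "x \<in> U" "smooth_on U f" "open V" "x \<in> V" "smooth_on V g"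
    using assms unfolding smooth_near_def by blast
  then show thesis
    by (intro that[of "U \<inter> V"]) (auto simp: smooth_on_def intro: Ck_on_subset)
qed

lemma smooth_near_add: "smooth_near x f \<Longrightarrow> smooth_near x g \<Longrightarrow> smooth_near x (\<lambda>x. f x + g x)"
  by (erule smooth_near_common, assumption) (auto simp: smooth_near_def smooth_on_def intro: Ck_on_add)

lemma smooth_near_mult: "smooth_near x f \<Longrightarrow> smooth_near x g \<Longrightarrow> smooth_near x (\<lambda>x. f x * g x)"
  by (erule smooth_near_common, assumption) (auto simp: smooth_near_def smooth_on_def intro: Ck_on_mult)

lemma smooth_near_inverse:
  assumes "smooth_near x f" "f x \<noteq> 0"
  shows "smooth_near x (\<lambda>x. inverse (f x))"
proof -
  obtain U where U: "open U" "x \<in> U" "smooth_on U f"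
    using assms unfolding smooth_near_def by blast
  then have "continuous_on U f"
    by (metis smooth_on_def Ck_on.simps(1))
  then have "open (U \<inter> f -` (- {0}))"
    using U continuous_open_preimage by blast
  then show ?thesis
    unfolding smooth_near_def smooth_on_def using U assms
    by (intro exI[of _ "U \<inter> f -` (- {0})"]) (auto simp: smooth_on_def intro!: Ck_on_inverse intro: Ck_on_subset)
qed

lemma smooth_near_compose:
  assumes "smooth_near (F x) f" "\<And>a. smooth_near x (\<lambda>y. F y $ a)"
  shows "smooth_near x (\<lambda>y. f (F y))"
proof -
  obtain U where U: "open U" "F x \<in> U" "smooth_on U f"
    using assms unfolding smooth_near_def by blast
  obtain V where V: "open V" "x \<in> V" "smooth_on V (\<lambda>y. F y $ 1)" "smooth_on V (\<lambda>y. F y $ 2)"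
    using smooth_near_common[OF assms(2)[of 1] assms(2)[of 2]] .
  have sV: "Ck_on k V (\<lambda>y. F y $ a)" for a k
    using V exhaust_2[of a] by (auto simp: smooth_on_def)
  have "continuous_on V (\<lambda>x. F x $ a)" for a
    using sV[of 0 a] by simp
  then have "continuous_on V F"
    using continuous_on_vec_lambda[of V "\<lambda>a x. F x $ a"] by simp
  then have o: "open (V \<inter> F -` U)"
    using U V continuous_open_preimage by blast
  have "Ck_on k (V \<inter> F -` U) (\<lambda>y. f (F y))" for k
    by (rule Ck_on_compose[where T=U]) (use o U sV in \<open>auto simp: smooth_on_def intro: Ck_on_subset\<close>)
  then show ?thesis
    unfolding smooth_near_def smooth_on_def using U V o by blast
qed

lemma smooth_near_minus: "smooth_near x f \<Longrightarrow> smooth_near x (\<lambda>x. - f x)"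
  using smooth_near_mult[OF smooth_near_const[of x "- 1"]] by simp

lemma smooth_near_diff: "smooth_near x f \<Longrightarrow> smooth_near x g \<Longrightarrow> smooth_near x (\<lambda>x. f x - g x)"
  using smooth_near_add[OF _ smooth_near_minus, of x f g] by simp

section \<open>Symmetry of second partial derivatives\<close>

lemma mixed_difference_mean_value:
  fixes f :: "real^2 \<Rightarrow> real"
  assumes S: "\<And>s t. 0 \<le> s \<Longrightarrow> s \<le> h \<Longrightarrow> 0 \<le> t \<Longrightarrow> t \<le> h \<Longrightarrow> x + s *\<^sub>R axis i 1 + t *\<^sub>R axis j 1 \<in> S"
    and h: "h > 0" and f: "Ck_on 2 S f"
  shows "\<exists>s t. 0 \<le> s \<and> s \<le> h \<and> 0 \<le> t \<and> t \<le> h \<and>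
     f (x + h *\<^sub>R axis i 1 + h *\<^sub>R axis j 1) - f (x + h *\<^sub>R axis i 1) - f (x + h *\<^sub>R axis j 1) + f x
       = h * h * partial j (partial i f) (x + s *\<^sub>R axis i 1 + t *\<^sub>R axis j 1)"
proof -
  have line: "((\<lambda>s. g (y + s *\<^sub>R axis k 1)) has_real_derivative partial k g (y + s *\<^sub>R axis k 1)) (at s)"
    if "g differentiable (at (y + s *\<^sub>R axis k 1))" for g :: "real^2 \<Rightarrow> real" and y s k
  proof -
    have c: "((\<lambda>s. y + s *\<^sub>R axis k 1) has_derivative (\<lambda>h. h *\<^sub>R axis k (1::real))) (at s)"
      by (auto intro!: derivative_eq_intros)
    have "((\<lambda>s. g (y + s *\<^sub>R axis k 1)) has_derivative
        (\<lambda>h. \<Sum>i\<in>UNIV. (h *\<^sub>R axis k (1::real)) $ i * partial i g (y + s *\<^sub>R axis k 1))) (at s)"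
      by (rule has_derivative_compose[where g = g, OF c has_derivative_partial[OF that]])
    moreover have "(\<lambda>h. \<Sum>i\<in>UNIV. (h *\<^sub>R axis k (1::real)) $ i * partial i g (y + s *\<^sub>R axis k 1))
        = (\<lambda>h. partial k g (y + s *\<^sub>R axis k 1) * h)"
    proof
      fix h
      have "(h *\<^sub>R axis k (1::real)) $ i * partial i g (y + s *\<^sub>R axis k 1)
          = (if i = k then partial k g (y + s *\<^sub>R axis k 1) * h else 0)" for i
        by (simp add: axis_def)
      then show "(\<Sum>i\<in>UNIV. (h *\<^sub>R axis k (1::real)) $ i * partial i g (y + s *\<^sub>R axis k 1))
        = partial k g (y + s *\<^sub>R axis k 1) * h"
        by simp
    qed
    ultimately show ?thesis
      by (simp add: has_field_derivative_def)
  qed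
  have d1: "f differentiable (at y)" "partial k f differentiable (at y)" if "y \<in> S" for y k
    using f that by (simp_all add: numeral_2_eq_2 Ck_on_Suc_partial)
  have "\<exists>s>0. s < h \<and> (f (x + h *\<^sub>R axis i 1 + h *\<^sub>R axis j 1) - f (x + h *\<^sub>R axis i 1)) -
       (f (x + 0 *\<^sub>R axis i 1 + h *\<^sub>R axis j 1) - f (x + 0 *\<^sub>R axis i 1)) = (h - 0) *
       (partial i f (x + s *\<^sub>R axis i 1 + h *\<^sub>R axis j 1) - partial i f (x + s *\<^sub>R axis i 1))"
  proof (rule MVT2[OF h])
    fix s assume s: "0 \<le> s" "s \<le> h"
    have "((\<lambda>s. f ((x + h *\<^sub>R axis j 1) + s *\<^sub>R axis i 1)) has_real_derivative partial i f ((x + h *\<^sub>R axis j 1) + s *\<^sub>R axis i 1)) (at s)"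
      by (rule line) (use d1 S[of s h] s h in \<open>simp add: algebra_simps\<close>)
    moreover have "((\<lambda>s. f (x + s *\<^sub>R axis i 1)) has_real_derivative partial i f (x + s *\<^sub>R axis i 1)) (at s)"
      by (rule line) (use d1 S[of s 0] s h in \<open>simp add: algebra_simps\<close>)
    ultimately show "((\<lambda>s. f (x + s *\<^sub>R axis i 1 + h *\<^sub>R axis j 1) - f (x + s *\<^sub>R axis i 1)) has_real_derivative
       partial i f (x + s *\<^sub>R axis i 1 + h *\<^sub>R axis j 1) - partial i f (x + s *\<^sub>R axis i 1)) (at s)"
      by (simp add: add.assoc add.commute add.left_commute DERIV_diff)
  qed
  then obtain s where s: "0 < s" "s < h" and e1:
    "f (x + h *\<^sub>R axis i 1 + h *\<^sub>R axis j 1) - f (x + h *\<^sub>R axis i 1) - f (x + h *\<^sub>R axis j 1) + f x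
      = h * (partial i f (x + s *\<^sub>R axis i 1 + h *\<^sub>R axis j 1) - partial i f (x + s *\<^sub>R axis i 1))"
    by auto
  have "\<exists>t>0. t < h \<and> partial i f (x + s *\<^sub>R axis i 1 + h *\<^sub>R axis j 1) - partial i f (x + s *\<^sub>R axis i 1 + 0 *\<^sub>R axis j 1)
      = (h - 0) * partial j (partial i f) (x + s *\<^sub>R axis i 1 + t *\<^sub>R axis j 1)"
  proof (rule MVT2[OF h])
    fix t assume t: "0 \<le> t" "t \<le> h"
    show "((\<lambda>t. partial i f (x + s *\<^sub>R axis i 1 + t *\<^sub>R axis j 1)) has_real_derivative
        partial j (partial i f) (x + s *\<^sub>R axis i 1 + t *\<^sub>R axis j 1)) (at t)"
      by (rule line) (use d1 S[of s t] s t in simp)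
  qed
  then obtain t where "0 < t" "t < h" "partial i f (x + s *\<^sub>R axis i 1 + h *\<^sub>R axis j 1) - partial i f (x + s *\<^sub>R axis i 1)
      = h * partial j (partial i f) (x + s *\<^sub>R axis i 1 + t *\<^sub>R axis j 1)"
    by auto
  with e1 s show ?thesis
    by (intro exI[of _ s] exI[of _ t]) auto
qed

text \<open>The second difference of f over a square of side h is symmetric in the two directions.
  Two mean value steps, in either order, express it as h * h times one or the other mixed derivative
  at some point of the square. If the values at x differed by 2 e, continuity would keep the two
  mixed derivatives apart on a small square.\<close>

lemma partial_commute:
  assumes "smooth_near x f"
  shows "partial i (partial j f) x = partial j (partial i f) x"
proof (rule ccontr)
  assume ne: "partial i (partial j f) x \<noteq> partial j (partial i f) x"
  define e where "e = \<bar>partial i (partial j f) x - partial j (partial i f) x\<bar> / 2"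
  have e: "e > 0" using ne by (simp add: e_def)
  obtain S where S: "open S" "x \<in> S" "smooth_on S f"
    using assms smooth_near_def by blast
  obtain d0 where d0: "d0 > 0" "ball x d0 \<subseteq> S" using S open_contains_ball by blast
  have c: "isCont (partial a (partial b f)) x" for a b
    by (simp add: assms smooth_near_isCont smooth_near_partial)
  obtain d1 where d1: "d1 > 0" "\<And>y. dist y x < d1 \<Longrightarrow> dist (partial i (partial j f) y) (partial i (partial j f) x) < e"
    using c e unfolding continuous_at_eps_delta by blast
  obtain d2 where d2: "d2 > 0" "\<And>y. dist y x < d2 \<Longrightarrow> dist (partial j (partial i f) y) (partial j (partial i f) x) < e"
    using c e unfolding continuous_at_eps_delta by blast
  define d where "d = min d0 (min d1 d2)"
  \<comment> \<open>Points of the square have distance at most 2 h from x, which is less than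
    d.\<close>
  define h where "h = d / 3"
  have h: "h > 0" using d0 d1 d2 by (simp add: h_def d_def)
  have near: "dist (x + s *\<^sub>R axis a 1 + t *\<^sub>R axis b 1) x < d" if "0 \<le> s" "s \<le> h" "0 \<le> t" "t \<le> h" for s t a b
  proof -
    have "dist (x + s *\<^sub>R axis a 1 + t *\<^sub>R axis b 1) x \<le> norm (s *\<^sub>R axis a (1::real)) + norm (t *\<^sub>R axis b (1::real))"
      using norm_triangle_ineq[of "s *\<^sub>R axis a (1::real)" "t *\<^sub>R axis b (1::real)"]
      by (simp add: dist_norm del: norm_scaleR)
    also have "\<dots> \<le> h + h" using that by (simp add: norm_axis_1)
    also have "\<dots> < d" using h by (simp add: h_def)
    finally show ?thesis .
  qed
  have in_S: "x + s *\<^sub>R axis a 1 + t *\<^sub>R axis b 1 \<in> S" if "0 \<le> s" "s \<le> h" "0 \<le> t" "t \<le> h" for s t a b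
    using near[OF that, of a b] d0 by (auto simp: d_def dist_commute)
  have f2: "Ck_on 2 S f" using S smooth_on_def by blast
  obtain s t where st: "0 \<le> s" "s \<le> h" "0 \<le> t" "t \<le> h" and e1:
    "f (x + h *\<^sub>R axis i 1 + h *\<^sub>R axis j 1) - f (x + h *\<^sub>R axis i 1) - f (x + h *\<^sub>R axis j 1) + f x
       = h * h * partial j (partial i f) (x + s *\<^sub>R axis i 1 + t *\<^sub>R axis j 1)"
    using mixed_difference_mean_value[OF in_S h f2, of i j] by auto
  obtain s' t' where st': "0 \<le> s'" "s' \<le> h" "0 \<le> t'" "t' \<le> h" and e2:
    "f (x + h *\<^sub>R axis j 1 + h *\<^sub>R axis i 1) - f (x + h *\<^sub>R axis j 1) - f (x + h *\<^sub>R axis i 1) + f x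
       = h * h * partial i (partial j f) (x + s' *\<^sub>R axis j 1 + t' *\<^sub>R axis i 1)"
    using mixed_difference_mean_value[OF in_S h f2, of j i] by auto
  have "h * h * partial j (partial i f) (x + s *\<^sub>R axis i 1 + t *\<^sub>R axis j 1)
    = h * h * partial i (partial j f) (x + s' *\<^sub>R axis j 1 + t' *\<^sub>R axis i 1)"
    using e1 e2 by (simp add: algebra_simps)
  then have "partial j (partial i f) (x + s *\<^sub>R axis i 1 + t *\<^sub>R axis j 1)
    = partial i (partial j f) (x + s' *\<^sub>R axis j 1 + t' *\<^sub>R axis i 1)"
    using h by simp
  moreover have "dist (partial j (partial i f) (x + s *\<^sub>R axis i 1 + t *\<^sub>R axis j 1)) (partial j (partial i f) x) < e"
    using d2(2) near[OF st, of i j] by (simp add: d_def)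
  moreover have "dist (partial i (partial j f) (x + s' *\<^sub>R axis j 1 + t' *\<^sub>R axis i 1)) (partial i (partial j f) x) < e"
    using d1(2) near[OF st', of j i] by (simp add: d_def)
  moreover have "2 * e = \<bar>partial i (partial j f) x - partial j (partial i f) x\<bar>"
    by (simp add: e_def)
  ultimately show False
    unfolding dist_real_def by linarith
qed

section \<open>Bump functions\<close>

text \<open>A polynomial in u = 1/t is carried along because the family is then closed under
  differentiation: p becomes u^2 (p - p'). Smoothness at 0 thus reduces to one limit for all
  p.\<close>

definition flat_exp :: "real poly \<Rightarrow> real \<Rightarrow> real" where
  "flat_exp p t = (if t > 0 then poly p (1 / t) * exp (- (1 / t)) else 0)"

lemma poly_times_exp_minus_tendsto_0:
  "((\<lambda>u::real. poly p u * exp (- u)) \<longlongrightarrow> 0) at_top"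
proof -
  have "((\<lambda>u. \<Sum>k\<le>degree p. coeff p k * (u ^ k / exp u)) \<longlongrightarrow> (\<Sum>k\<le>degree p. coeff p k * 0)) at_top"
    by (intro tendsto_intros tendsto_power_div_exp_0)
  then show ?thesis
    by (simp add: poly_altdef sum_distrib_left exp_minus divide_inverse mult_ac)
qed

lemma flat_exp_over_t_tendsto_0: "((\<lambda>t. flat_exp p t / t) \<longlongrightarrow> 0) (at 0)"
proof -
  \<comment> \<open>Substitution u = 1/t: \<open>pCons 0 p\<close> is u * p(u), whose extra factor u
    accounts for the division by t.\<close>
  have "((\<lambda>t. poly (pCons 0 p) (inverse t) * exp (- inverse t)) \<longlongrightarrow> 0) (at_right 0)"
    using filterlim_compose[OF poly_times_exp_minus_tendsto_0 filterlim_inverse_at_top_right] .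
  then have "((\<lambda>t. flat_exp p t / t) \<longlongrightarrow> 0) (at_right 0)"
    by (rule tendsto_cong[THEN iffD1, rotated])
      (auto simp: eventually_at_filter flat_exp_def divide_inverse mult_ac intro!: always_eventually)
  moreover have "((\<lambda>t. flat_exp p t / t) \<longlongrightarrow> 0) (at_left 0)"
    by (rule tendsto_eventually) (auto simp: eventually_at_filter flat_exp_def intro!: always_eventually)
  ultimately show ?thesis
    by (simp add: filterlim_split_at)
qed

lemma has_derivative_flat_exp:
  "(flat_exp p has_real_derivative flat_exp ([:0, 0, 1:] * (p - pderiv p)) t) (at t)"
proof -
  consider "t > 0" | "t < 0" | "t = 0" by linarith
  then show ?thesis
  proof cases
    case 1
    have "((\<lambda>t. poly p (1 / t) * exp (- (1 / t))) has_real_derivative flat_exp ([:0, 0, 1:] * (p - pderiv p)) t) (at t)"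
      using 1 by (auto intro!: derivative_eq_intros simp: flat_exp_def field_simps power2_eq_square)
    then show ?thesis
      by (rule has_field_derivative_transform_within_open[where S = "{0<..}"])
        (use 1 in \<open>auto simp: flat_exp_def\<close>)
  next
    case 2
    have "((\<lambda>t. 0) has_real_derivative flat_exp ([:0, 0, 1:] * (p - pderiv p)) t) (at t)"
      using 2 by (simp add: flat_exp_def)
    then show ?thesis
      by (rule has_field_derivative_transform_within_open[where S = "{..<0}"])
        (use 2 in \<open>auto simp: flat_exp_def\<close>)
  next
    case 3
    then show ?thesis
      using flat_exp_over_t_tendsto_0[of p] by (simp add: has_field_derivative_iff flat_exp_def)
  qed
qed

lemma partial_real_compose:
  assumes "(f has_real_derivative d) (at (u x))" "u differentiable (at x)"
  shows "partial i (\<lambda>x. f (u x)) x = d * partial i u x"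
    and "(\<lambda>x. f (u x)) differentiable (at x)"
proof -
  have *: "((\<lambda>x. f (u x)) has_derivative (\<lambda>h. d * frechet_derivative u (at x) h)) (at x)"
    using has_derivative_compose[OF assms(2)[unfolded frechet_derivative_works]
        assms(1)[unfolded has_field_derivative_def]] by simp
  show "partial i (\<lambda>x. f (u x)) x = d * partial i u x"
    using partial_eq[OF *] by (simp add: partial_def)
  show "(\<lambda>x. f (u x)) differentiable (at x)"
    using * differentiable_def by blast
qed

lemma Ck_on_flat_exp:
  assumes "\<And>k. Ck_on k UNIV u"
  shows "Ck_on k UNIV (\<lambda>x. flat_exp p (u x))"
proof (induction k arbitrary: p)
  case 0
  have "continuous_on UNIV (flat_exp p)"
    using has_derivative_flat_exp DERIV_isCont continuous_at_imp_continuous_on by blast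
  then show ?case
    using assms[of 0] continuous_on_compose2[of UNIV "flat_exp p" UNIV u] by simp
next
  case (Suc k)
  have u: "u differentiable (at x)" for x
    using assms[of "Suc 0"] by (simp add: Ck_on_Suc_partial)
  have "Ck_on k UNIV (\<lambda>x. flat_exp ([:0, 0, 1:] * (p - pderiv p)) (u x) * partial i u x)" for i
    using assms[of "Suc k"] by (intro Ck_on_mult Suc) (auto simp: Ck_on_Suc_partial)
  from Ck_on_cong[OF open_UNIV _ this] have "Ck_on k UNIV (partial i (\<lambda>x. flat_exp p (u x)))" for i
    by (simp only: partial_real_compose(1)[OF has_derivative_flat_exp u])
  then show ?case
    using partial_real_compose(2)[OF has_derivative_flat_exp u] by (simp add: Ck_on_Suc_partial)
qed

definition smooth_step :: "real \<Rightarrow> real" where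
  "smooth_step t = flat_exp 1 t / (flat_exp 1 t + flat_exp 1 (1 - t))"

lemma smooth_step_denominator: "flat_exp 1 t + flat_exp 1 (1 - t) > 0"
  by (cases "t > 0") (auto simp: flat_exp_def add_pos_nonneg)

lemma smooth_step_properties:
  shows "0 \<le> smooth_step t" "smooth_step t \<le> 1" "t \<le> 0 \<Longrightarrow> smooth_step t = 0" "t \<ge> 1 \<Longrightarrow> smooth_step t = 1"
proof -
  have "flat_exp 1 s \<ge> 0" for s by (simp add: flat_exp_def)
  note this[of t] this[of "1 - t"] smooth_step_denominator[of t]
  then show "0 \<le> smooth_step t" "smooth_step t \<le> 1"
    by (auto simp: smooth_step_def)
  show "t \<le> 0 \<Longrightarrow> smooth_step t = 0" "t \<ge> 1 \<Longrightarrow> smooth_step t = 1"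
    by (auto simp: smooth_step_def flat_exp_def)
qed

lemma bump_function:
  fixes a :: "real^2"
  assumes "r > 0"
  obtains b where "\<And>x. smooth_near x b" "\<And>x. 0 \<le> b x" "\<And>x. b x \<le> 1"
    "\<And>x. x \<in> cball a r \<Longrightarrow> b x = 1" "\<And>x. x \<notin> ball a (2 * r) \<Longrightarrow> b x = 0"
proof -
  \<comment> \<open>Subtraction is written as \<open>+ (- 1) *\<close> to match the closure rules
    for sums and products.\<close>
  define q where "q x = (\<Sum>i\<in>UNIV. (x $ i + (- 1) * a $ i) * (x $ i + (- 1) * a $ i))" for x :: "real^2"
  \<comment> \<open>u = 2 - dist^2 / r^2 is at least 1 up to radius r and at most 0 from radius 2 r
    on, the two regions where \<open>smooth_step\<close> is constant; being a polynomial, it is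
    smooth also at the centre.\<close>
  define u where "u x = 2 + (- 1 / r\<^sup>2) * q x" for x :: "real^2"
  have q: "q x = (dist a x)\<^sup>2" for x
    by (simp add: q_def dist_norm power2_norm_eq_inner inner_vec_def algebra_simps)
  have Cu: "Ck_on k UNIV u" for k
    unfolding u_def q_def
    by (intro Ck_on_add Ck_on_mult Ck_on_sum Ck_on_const Ck_on_component) auto
  have Cv: "Ck_on k UNIV (\<lambda>x. 1 + (- 1) * u x)" for k
    by (intro Ck_on_add Ck_on_mult Ck_on_const Cu) auto
  have "Ck_on k UNIV (\<lambda>x. flat_exp 1 (u x) * inverse (flat_exp 1 (u x) + flat_exp 1 (1 + (- 1) * u x)))" for k
    using smooth_step_denominator
    by (intro Ck_on_mult Ck_on_inverse Ck_on_add Ck_on_flat_exp Cu Cv) (auto simp: less_imp_neq[symmetric])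
  then have C: "smooth_on UNIV (\<lambda>x. smooth_step (u x))"
    by (simp add: smooth_on_def smooth_step_def divide_inverse)
  show thesis
  proof
    show "smooth_near x (\<lambda>x. smooth_step (u x))" for x
      using C smooth_near_def by blast
    show "smooth_step (u x) = 1" if "x \<in> cball a r" for x
    proof -
      have "(dist a x)\<^sup>2 \<le> r\<^sup>2" using that assms by (simp add: power_mono)
      then have "u x \<ge> 1" using assms by (simp add: u_def q field_simps)
      then show ?thesis by (rule smooth_step_properties)
    qed
    show "smooth_step (u x) = 0" if "x \<notin> ball a (2 * r)" for x
    proof -
      have "(2 * r)\<^sup>2 \<le> (dist a x)\<^sup>2" using that assms by (intro power_mono) auto
      then have "4 * r\<^sup>2 \<le> (dist a x)\<^sup>2" by (simp add: power_mult_distrib)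
      moreover have "r\<^sup>2 > 0" using assms by simp
      ultimately have "2 * r\<^sup>2 \<le> (dist a x)\<^sup>2" by linarith
      then have "u x \<le> 0" using assms by (simp add: u_def q field_simps)
      then show ?thesis by (rule smooth_step_properties)
    qed
  qed (auto simp: smooth_step_properties)
qed

section \<open>Integration of compactly supported functions on the plane\<close>

lemma integral_superset:
  fixes f :: "'n::euclidean_space \<Rightarrow> 'b::banach"
  assumes "S \<subseteq> T" "\<And>x. x \<in> T - S \<Longrightarrow> f x = 0"
  shows "integral S f = integral T f"
proof -
  have "(\<lambda>x. if x \<in> S then f x else 0) = (\<lambda>x. if x \<in> T then f x else 0)"
    using assms by (auto simp: fun_eq_iff)
  then show ?thesis
    using Henstock_Kurzweil_Integration.integral_restrict_UNIV by metis
qed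

lemma extend_by_zero_continuous:
  fixes f :: "'n::euclidean_space \<Rightarrow> real"
  assumes "open S" "closed K" "K \<subseteq> S" "continuous_on S f" "\<And>x. x \<in> S - K \<Longrightarrow> f x = 0"
  shows "continuous_on UNIV (\<lambda>x. if x \<in> S then f x else 0)"
proof -
  have "continuous_on (S \<union> - K) (\<lambda>x. if x \<in> S then f x else 0)"
  proof (rule continuous_on_open_Un)
    show "continuous_on S (\<lambda>x. if x \<in> S then f x else 0)"
      using assms(4) by (simp cong: continuous_on_cong)
    have "continuous_on (- K) (\<lambda>x. 0::real)" by simp
    then show "continuous_on (- K) (\<lambda>x. if x \<in> S then f x else 0)"
      by (rule continuous_on_eq) (use assms(5) in auto)
  qed (use assms in auto)
  moreover have "S \<union> - K = UNIV" using assms(3) by blast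
  ultimately show ?thesis by simp
qed

lemma integrable_compact_support:
  fixes f :: "'n::euclidean_space \<Rightarrow> real"
  assumes "open S" "compact K" "K \<subseteq> S" "continuous_on S f" "\<And>x. x \<in> S - K \<Longrightarrow> f x = 0"
  shows "f absolutely_integrable_on S"
proof -
  have int: "f integrable_on S" if "continuous_on S f" "\<And>x. x \<in> S - K \<Longrightarrow> f x = 0" for f :: "'n \<Rightarrow> real"
  proof -
    let ?g = "\<lambda>x. if x \<in> S then f x else 0"
    obtain a b where "K \<subseteq> cbox a b"
      using assms(2) bounded_subset_cbox_symmetric compact_imp_bounded by metis
    have "continuous_on UNIV ?g"
      by (rule extend_by_zero_continuous[OF assms(1) compact_imp_closed[OF assms(2)] assms(3)])
        (use that in auto)
    then have "?g integrable_on cbox a b"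
      by (intro integrable_continuous) (rule continuous_on_subset, auto)
    then have "?g integrable_on UNIV"
      by (rule integrable_on_superset) (use that \<open>K \<subseteq> cbox a b\<close> in auto)
    then show ?thesis
      using integrable_restrict_UNIV by blast
  qed
  show ?thesis
    unfolding absolutely_integrable_on_def
    using assms(4,5) by (auto intro!: int continuous_intros)
qed

text \<open>Translation invariance makes the integral of \<open>V (x + t e\<^sub>i)\<close> constant in \<open>t\<close>; differentiating
  under the integral sign replaces the use of Fubini's theorem.\<close>

lemma integral_partial_UNIV:
  fixes V :: "real^2 \<Rightarrow> real"
  assumes V: "\<And>x. smooth_near x V" and K: "compact K" "\<And>x. x \<notin> K \<Longrightarrow> V x = 0"
  shows "integral UNIV (partial i V) = 0"
proof -
  define e :: "real^2" where "e = axis i 1"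
  obtain R where R: "R > 0" "K \<subseteq> cball 0 R"
    using compact_imp_bounded[OF K(1)] by (auto simp: bounded_pos subset_iff)
  \<comment> \<open>The margin 1 keeps the support of every translate with |t| < 1 inside the box,
    so the box integral does not change near t = 0.\<close>
  obtain a where a: "cball (0::real^2) (R + 1) \<subseteq> cbox (- a) a"
    using bounded_subset_cbox_symmetric bounded_cball by blast
  let ?B = "cbox (- a) a"
  have contV: "continuous_on UNIV V"
    using V smooth_near_isCont continuous_at_imp_continuous_on by blast
  have contP: "continuous_on UNIV (partial i V)"
    by (intro continuous_at_imp_continuous_on ballI smooth_near_isCont smooth_near_partial V)
  have V0: "V x = 0" if "norm x > R" for x
    using K(2) R(2) that by (metis mem_cball_0 not_le subsetD)
  have P0: "partial i V x = 0" if "norm x > R" for x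
  proof -
    have "open {x::real^2. norm x > R}"
      by (intro open_Collect_less continuous_intros)
    then have "partial i V x = partial i (\<lambda>x. 0) x"
      by (rule partial_cong_open) (use that V0 in auto)
    then show ?thesis by simp
  qed
  define H where "H t = integral ?B (\<lambda>x. V (x + t *\<^sub>R e))" for t :: real
  have Hconst: "H t = integral ?B V" if t: "\<bar>t\<bar> < 1" for t
  proof -
    have "(V has_integral integral ?B V) ?B"
      by (intro integrable_integral integrable_continuous continuous_on_subset[OF contV]) auto
    from has_integral_affinity[OF this, of 1 "t *\<^sub>R e"]
    have "((\<lambda>x. V (x + t *\<^sub>R e)) has_integral integral ?B V) ((\<lambda>x. x - t *\<^sub>R e) ` ?B)"
      by simp
    then have "((\<lambda>x. V (x + t *\<^sub>R e)) has_integral integral ?B V) UNIV"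
    proof (rule has_integral_on_superset)
      fix x assume x: "x \<notin> (\<lambda>x. x - t *\<^sub>R e) ` ?B"
      have "x + t *\<^sub>R e \<notin> ?B"
        using x by (metis add_diff_cancel_right' image_eqI)
      then have "x + t *\<^sub>R e \<notin> cball 0 (R + 1)" using a by blast
      then show "V (x + t *\<^sub>R e) = 0" by (intro V0) simp
    qed simp
    moreover have "V (x + t *\<^sub>R e) = 0" if "x \<notin> ?B" for x
    proof (rule V0)
      have "norm x > R + 1" using a that by force
      moreover have "norm x \<le> norm (x + t *\<^sub>R e) + norm (t *\<^sub>R e)"
        by (metis add_diff_cancel_right' norm_triangle_ineq4)
      ultimately show "norm (x + t *\<^sub>R e) > R" using t by (simp add: e_def norm_axis_1)
    qed
    ultimately show ?thesis
      unfolding H_def using integral_superset[of ?B UNIV "\<lambda>x. V (x + t *\<^sub>R e)"] by auto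
  qed
  have "(H has_field_derivative integral ?B (\<lambda>x. partial i V (x + 0 *\<^sub>R e))) (at 0 within UNIV)"
    unfolding H_def
  proof (rule leibniz_rule_field_derivative)
    fix t x
    have "((\<lambda>t. x + t *\<^sub>R e) has_derivative (\<lambda>h. h *\<^sub>R e)) (at t)"
      by (auto intro!: derivative_eq_intros)
    from has_derivative_compose[where g = V, OF this has_derivative_partial[OF smooth_near_differentiable[OF V]]]
    have "((\<lambda>t. V (x + t *\<^sub>R e)) has_derivative (\<lambda>h. \<Sum>j\<in>UNIV. (h *\<^sub>R e) $ j * partial j V (x + t *\<^sub>R e))) (at t)" .
    moreover have "(\<lambda>h. \<Sum>j\<in>UNIV. (h *\<^sub>R e) $ j * partial j V (x + t *\<^sub>R e)) = (\<lambda>h. partial i V (x + t *\<^sub>R e) * h)"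
    proof
      fix h
      have "(h *\<^sub>R e) $ j * partial j V (x + t *\<^sub>R e) = (if j = i then partial i V (x + t *\<^sub>R e) * h else 0)" for j
        by (simp add: e_def axis_def)
      then show "(\<Sum>j\<in>UNIV. (h *\<^sub>R e) $ j * partial j V (x + t *\<^sub>R e)) = partial i V (x + t *\<^sub>R e) * h"
        by simp
    qed
    ultimately show "((\<lambda>t. V (x + t *\<^sub>R e)) has_field_derivative partial i V (x + t *\<^sub>R e)) (at t within UNIV)"
      by (simp add: has_field_derivative_def)
  next
    fix t :: real
    have "continuous_on ?B (\<lambda>x. V (x + t *\<^sub>R e))"
      by (rule continuous_on_compose2[OF contV]) (auto intro: continuous_intros)
    then show "(\<lambda>x. V (x + t *\<^sub>R e)) integrable_on ?B"
      by (rule integrable_continuous)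
  next
    show "continuous_on (UNIV \<times> ?B) (\<lambda>(t, x). partial i V (x + t *\<^sub>R e))"
      unfolding split_beta
      by (rule continuous_on_compose2[OF contP]) (auto intro!: continuous_intros)
  qed auto
  then have "(H has_real_derivative integral ?B (partial i V)) (at 0)" by simp
  moreover have "(H has_real_derivative 0) (at 0)"
    by (rule has_field_derivative_transform_within_open[where S = "ball 0 1" and f = "\<lambda>t. integral ?B V"])
      (auto simp: Hconst)
  ultimately have "integral ?B (partial i V) = 0"
    by (rule DERIV_unique)
  moreover have "integral ?B (partial i V) = integral UNIV (partial i V)"
  proof (rule integral_superset)
    fix x assume "x \<in> UNIV - ?B"
    then have "x \<notin> cball 0 (R + 1)" using a by blast
    then show "partial i V x = 0" by (intro P0) simp
  qed simp
  ultimately show ?thesis by simp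
qed

text \<open>Extension by zero is smooth: a point outside S lies in the open complement of K, where
  the extension vanishes identically. This reduces the claim to the whole plane.\<close>

lemma integral_partial_compact_support:
  assumes "open S" "compact K" "K \<subseteq> S" "\<And>x. x \<in> S \<Longrightarrow> smooth_near x W"
    "\<And>x. x \<in> S - K \<Longrightarrow> W x = 0"
  shows "partial i W absolutely_integrable_on S" "integral S (partial i W) = 0"
proof -
  let ?V = "\<lambda>x. if x \<in> S then W x else 0"
  have o: "open (- K)" using assms(2) compact_imp_closed by blast
  have z: "?V x = 0" if "x \<notin> K" for x using assms(5) that by auto
  have V: "smooth_near x ?V" for x
  proof (cases "x \<in> S")
    case True
    show ?thesis
      by (rule smooth_near_cong[OF assms(1) True _ assms(4)[OF True]]) simp
  next
    case False
    show ?thesis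
      by (rule smooth_near_cong[OF o _ _ smooth_near_const[of x 0]]) (use False assms(3) z in auto)
  qed
  have p1: "partial i ?V x = partial i W x" if "x \<in> S" for x
    by (rule partial_cong_open[OF assms(1) that]) simp
  have p2: "partial i ?V x = 0" if "x \<notin> K" for x
    using partial_cong_open[OF o, of x ?V "\<lambda>x. 0" i] z that by auto
  have "continuous_on S (partial i W)"
    by (intro continuous_at_imp_continuous_on ballI smooth_near_isCont smooth_near_partial assms(4))
  then show "partial i W absolutely_integrable_on S"
    by (rule integrable_compact_support[OF assms(1-3)]) (metis DiffD1 DiffD2 p1 p2)
  have "integral S (partial i W) = integral S (partial i ?V)"
    by (rule integral_cong) (simp add: p1)
  also have "\<dots> = integral UNIV (partial i ?V)"
    by (rule integral_superset) (use p2 assms(3) in auto)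
  also have "\<dots> = 0"
    by (rule integral_partial_UNIV[OF V assms(2)]) (use z in auto)
  finally show "integral S (partial i W) = 0" .
qed

lemma integral_change_of_coordinates:
  fixes g :: "real^2 \<Rightarrow> real^2"
  assumes "open S" "inj_on g S" "\<And>x a. x \<in> S \<Longrightarrow> (\<lambda>y. g y $ a) differentiable (at x)"
    "f absolutely_integrable_on (g ` S)"
  shows "integral (g ` S) f = integral S (\<lambda>x.
     \<bar>partial 1 (\<lambda>y. g y $ 1) x * partial 2 (\<lambda>y. g y $ 2) x
        - partial 1 (\<lambda>y. g y $ 2) x * partial 2 (\<lambda>y. g y $ 1) x\<bar> * f (g x))"
proof -
  let ?g' = "\<lambda>x h. \<chi> a. \<Sum>i\<in>UNIV. h $ i * partial i (\<lambda>y. g y $ a) x"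
  have det: "det (matrix (?g' x)) = partial 1 (\<lambda>y. g y $ 1) x * partial 2 (\<lambda>y. g y $ 2) x
        - partial 1 (\<lambda>y. g y $ 2) x * partial 2 (\<lambda>y. g y $ 1) x" for x
    by (simp add: det_2 matrix_def sum_2 axis_def)
  \<comment> \<open>Scalars are viewed as vectors in \<open>real^1\<close>, the shape in which the
    change of variables theorem takes its integrand.\<close>
  have "integral (g ` S) (\<lambda>x. vec (f x) :: real^1)
      = integral S (\<lambda>x. \<bar>det (matrix (?g' x))\<bar> *\<^sub>R vec (f (g x)))"
  proof (rule integral_change_of_variables)
    show "S \<in> sets lebesgue" using assms(1) by simp
    show "(g has_derivative ?g' x) (at x within S)" if "x \<in> S" for x
      using has_derivative_vec2[of g x] assms(3)[OF that] has_derivative_at_withinI by blast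
    show "inj_on g S" by fact
    show "(\<lambda>x. vec (f x) :: real^1) absolutely_integrable_on (g ` S) \<or>
        (\<lambda>x. \<bar>det (matrix (?g' x))\<bar> *\<^sub>R (vec (f (g x)) :: real^1)) absolutely_integrable_on S"
      using assms(4) by (simp add: absolutely_integrable_on_1_iff)
  qed
  then show ?thesis
    unfolding det by (simp add: integral_on_1_eq vec_eq_iff)
qed

section \<open>Calculus in charts\<close>

context smooth_surface
begin

text \<open>Membership of p in the chart is built in, so that the product and sum rules for
  \<open>pd\<close> carry no separate chart hypotheses.\<close>

definition smooth_at :: "'a chart \<Rightarrow> 'a \<Rightarrow> ('a \<Rightarrow> real) \<Rightarrow> bool" where
  "smooth_at c p f \<longleftrightarrow> c \<in> A \<and> p \<in> fst c \<and> smooth_near (snd c p) (\<lambda>x. f (inv_chart c x))"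

lemma pd_eq_partial: "pd c i f p = partial i (\<lambda>x. f (inv_chart c x)) (snd c p)"
  by (simp add: pd_def partial_def)

lemma chart_subset: "c \<in> A \<Longrightarrow> fst c \<subseteq> topspace M"
  using chart_open openin_subset by blast

lemma chart_inj: "c \<in> A \<Longrightarrow> inj_on (snd c) (fst c)"
  using homeomorphic_imp_injective_map[OF chart_homeo[of c]] chart_subset[of c]
  by (simp add: Int_absorb1)

lemma inv_chart_snd [simp]: "c \<in> A \<Longrightarrow> p \<in> fst c \<Longrightarrow> inv_chart c (snd c p) = p"
  by (simp add: inv_chart_def chart_inj)

lemma snd_inv_chart [simp]: "x \<in> snd c ` fst c \<Longrightarrow> snd c (inv_chart c x) = x"
  by (simp add: inv_chart_def f_inv_into_f)

lemma inv_chart_in [simp]: "x \<in> snd c ` fst c \<Longrightarrow> inv_chart c x \<in> fst c"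
  by (simp add: inv_chart_def inv_into_into)

lemma open_chart_image:
  assumes "c \<in> A" "openin M W" "W \<subseteq> fst c"
  shows "open (snd c ` W)"
proof -
  have "openin (top_of_set (snd c ` fst c)) (snd c ` W) \<longleftrightarrow> openin (subtopology M (fst c)) W"
    by (rule homeomorphic_map_openness[OF chart_homeo[OF assms(1)]])
      (use assms chart_subset[OF assms(1)] in auto)
  moreover have "openin (subtopology M (fst c)) W"
    using assms openin_subset_topspace_eq openin_open_subtopology[of M "fst c" W] chart_open by blast
  ultimately show ?thesis
    using chart_open[OF assms(1)] openin_open_trans by blast
qed

lemma open_chart_image_Int: "c \<in> A \<Longrightarrow> openin M W \<Longrightarrow> open (snd c ` (W \<inter> fst c))"
  by (rule open_chart_image) (auto intro: openin_Int chart_open[THEN conjunct1])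

lemma inv_chart_image [simp]:
  "c \<in> A \<Longrightarrow> x \<in> snd c ` W \<Longrightarrow> W \<subseteq> fst c \<Longrightarrow> inv_chart c x \<in> W"
  by auto

lemma smooth_comp_iff:
  assumes "c \<in> A"
  shows "smooth_comp c f \<longleftrightarrow> (\<forall>p\<in>fst c. smooth_at c p f)"
  using smooth_on_iff_near[of "snd c ` fst c"] chart_open[OF assms] assms
  by (simp add: smooth_comp_def smooth_at_def)

lemma pd_cong:
  assumes "c \<in> A" "p \<in> fst c" "openin M W" "p \<in> W" "\<And>q. q \<in> W \<Longrightarrow> q \<in> fst c \<Longrightarrow> f q = g q"
  shows "pd c i f p = pd c i g p"
  unfolding pd_eq_partial
proof (rule partial_cong_open[OF open_chart_image_Int[OF assms(1,3)]])
  show "snd c p \<in> snd c ` (W \<inter> fst c)" using assms by blast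
  fix x assume "x \<in> snd c ` (W \<inter> fst c)"
  then have "inv_chart c x \<in> W \<inter> fst c" by (rule inv_chart_image[OF assms(1)]) simp
  then show "f (inv_chart c x) = g (inv_chart c x)" using assms(5) by blast
qed

lemma smooth_at_cong:
  assumes "smooth_at c p f" "openin M W" "p \<in> W" "\<And>q. q \<in> W \<Longrightarrow> q \<in> fst c \<Longrightarrow> f q = g q"
  shows "smooth_at c p g"
proof -
  have cp: "c \<in> A" "p \<in> fst c" using assms(1) by (auto simp: smooth_at_def)
  have "smooth_near (snd c p) (\<lambda>x. g (inv_chart c x))"
  proof (rule smooth_near_cong[OF open_chart_image_Int[OF cp(1) assms(2)]])
    show "snd c p \<in> snd c ` (W \<inter> fst c)" using assms cp by blast
    fix x assume "x \<in> snd c ` (W \<inter> fst c)"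
    then have "inv_chart c x \<in> W \<inter> fst c" by (rule inv_chart_image[OF cp(1)]) simp
    then show "f (inv_chart c x) = g (inv_chart c x)" using assms(4) by blast
  next
    show "smooth_near (snd c p) (\<lambda>x. f (inv_chart c x))" using assms(1) by (simp add: smooth_at_def)
  qed
  then show ?thesis using cp by (simp add: smooth_at_def)
qed

lemma smooth_at_const: "c \<in> A \<Longrightarrow> p \<in> fst c \<Longrightarrow> smooth_at c p (\<lambda>q. k)"
  by (simp add: smooth_at_def smooth_near_const)

lemma smooth_at_add: "smooth_at c p f \<Longrightarrow> smooth_at c p g \<Longrightarrow> smooth_at c p (\<lambda>q. f q + g q)"
  by (simp add: smooth_at_def smooth_near_add)

lemma smooth_at_diff: "smooth_at c p f \<Longrightarrow> smooth_at c p g \<Longrightarrow> smooth_at c p (\<lambda>q. f q - g q)"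
  by (simp add: smooth_at_def smooth_near_diff)

lemma smooth_at_minus: "smooth_at c p f \<Longrightarrow> smooth_at c p (\<lambda>q. - f q)"
  by (simp add: smooth_at_def smooth_near_minus)

lemma smooth_at_mult: "smooth_at c p f \<Longrightarrow> smooth_at c p g \<Longrightarrow> smooth_at c p (\<lambda>q. f q * g q)"
  by (simp add: smooth_at_def smooth_near_mult)

lemma smooth_at_cmult: "smooth_at c p f \<Longrightarrow> smooth_at c p (\<lambda>q. k * f q)"
  by (simp add: smooth_at_def smooth_near_mult smooth_near_const)

lemma smooth_at_inverse: "smooth_at c p f \<Longrightarrow> f p \<noteq> 0 \<Longrightarrow> smooth_at c p (\<lambda>q. inverse (f q))"
  by (simp add: smooth_at_def smooth_near_inverse)

lemma smooth_at_sum: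
  assumes "c \<in> A" "p \<in> fst c" "finite I" "\<And>i. i \<in> I \<Longrightarrow> smooth_at c p (f i)"
  shows "smooth_at c p (\<lambda>q. \<Sum>i\<in>I. f i q)"
  using assms(3,4) by (induction I rule: finite_induct) (auto intro: smooth_at_add smooth_at_const assms)

lemma smooth_at_prod:
  assumes "c \<in> A" "p \<in> fst c" "finite I" "\<And>i. i \<in> I \<Longrightarrow> smooth_at c p (f i)"
  shows "smooth_at c p (\<lambda>q. \<Prod>i\<in>I. f i q)"
  using assms(3,4) by (induction I rule: finite_induct) (auto intro: smooth_at_mult smooth_at_const assms)

lemma smooth_at_pd:
  assumes "smooth_at c p f"
  shows "smooth_at c p (pd c i f)"
proof -
  have cp: "c \<in> A" "p \<in> fst c" using assms by (auto simp: smooth_at_def)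
  have "smooth_near (snd c p) (\<lambda>x. pd c i f (inv_chart c x))"
    by (rule smooth_near_cong[of "snd c ` fst c" _ "partial i (\<lambda>x. f (inv_chart c x))"])
      (use assms cp chart_open in \<open>auto simp: smooth_at_def pd_eq_partial intro: smooth_near_partial\<close>)
  then show ?thesis using cp by (simp add: smooth_at_def)
qed

lemma smooth_at_differentiable:
  "smooth_at c p f \<Longrightarrow> (\<lambda>x. f (inv_chart c x)) differentiable (at (snd c p))"
  by (simp add: smooth_at_def smooth_near_differentiable)

lemma pd_const [simp]: "pd c i (\<lambda>q. k) p = 0"
  by (simp add: pd_eq_partial)

lemma pd_add:
  "smooth_at c p f \<Longrightarrow> smooth_at c p g \<Longrightarrow> pd c i (\<lambda>q. f q + g q) p = pd c i f p + pd c i g p"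
  by (simp add: pd_eq_partial partial_add smooth_at_differentiable)

lemma pd_mult:
  "smooth_at c p f \<Longrightarrow> smooth_at c p g \<Longrightarrow> pd c i (\<lambda>q. f q * g q) p = f p * pd c i g p + pd c i f p * g p"
  by (simp add: pd_eq_partial partial_mult smooth_at_differentiable) (simp add: smooth_at_def)

lemma pd_cmult: "smooth_at c p f \<Longrightarrow> pd c i (\<lambda>q. k * f q) p = k * pd c i f p"
  using pd_mult[of c p "\<lambda>q. k" f i] smooth_at_const by (simp add: smooth_at_def)

lemma pd_minus: "smooth_at c p f \<Longrightarrow> pd c i (\<lambda>q. - f q) p = - pd c i f p"
  using pd_cmult[of c p f i "- 1"] by simp

lemma pd_diff:
  "smooth_at c p f \<Longrightarrow> smooth_at c p g \<Longrightarrow> pd c i (\<lambda>q. f q - g q) p = pd c i f p - pd c i g p"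
  using pd_add[OF _ smooth_at_minus, of c p f g i] by (simp add: pd_minus)

lemma pd_inverse:
  assumes "smooth_at c p f" "f p \<noteq> 0"
  shows "pd c i (\<lambda>q. inverse (f q)) p = - (pd c i f p * (inverse (f p) * inverse (f p)))"
proof -
  have "inv_chart c (snd c p) = p" using assms by (simp add: smooth_at_def)
  then show ?thesis
    using partial_inverse[OF smooth_at_differentiable[OF assms(1)]] assms(2)
    by (simp add: pd_eq_partial)
qed

lemma pd_sum:
  assumes "c \<in> A" "p \<in> fst c" "finite I" "\<And>i. i \<in> I \<Longrightarrow> smooth_at c p (f i)"
  shows "pd c k (\<lambda>q. \<Sum>i\<in>I. f i q) p = (\<Sum>i\<in>I. pd c k (f i) p)"
  using assms(3,4)
  by (induction I rule: finite_induct) (auto simp: pd_add smooth_at_sum[OF assms(1,2)])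

lemma pd_commute:
  assumes "smooth_at c p f"
  shows "pd c i (pd c j f) p = pd c j (pd c i f) p"
proof -
  have cp: "c \<in> A" "p \<in> fst c" using assms by (auto simp: smooth_at_def)
  have "pd c i (pd c j f) p = partial i (partial j (\<lambda>x. f (inv_chart c x))) (snd c p)" for i j
    unfolding pd_eq_partial[of c i]
    by (rule partial_cong_open[of "snd c ` fst c"]) (use cp chart_open in \<open>auto simp: pd_eq_partial\<close>)
  then show ?thesis
    using assms partial_commute by (simp add: smooth_at_def)
qed

section \<open>Smooth maps in charts and their first and second derivatives\<close>

lemma openin_chart_preimage:
  assumes "c \<in> A" "open S"
  shows "openin M {q \<in> fst c. snd c q \<in> S}"
proof -
  have "continuous_map (subtopology M (fst c)) euclidean (snd c)"
    using homeomorphic_imp_continuous_map[OF chart_homeo[OF assms(1)]] continuous_map_in_subtopology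
    by blast
  then have "openin (subtopology M (fst c)) {q \<in> topspace (subtopology M (fst c)). snd c q \<in> S}"
    using assms(2) by (simp add: continuous_map_def)
  moreover have "{q \<in> topspace (subtopology M (fst c)). snd c q \<in> S} = {q \<in> fst c. snd c q \<in> S}"
    using chart_subset[OF assms(1)] by auto
  ultimately show ?thesis
    using openin_trans_full chart_open[OF assms(1)] by metis
qed

lemma openin_preimage:
  assumes "continuous_map M M \<phi>" "c \<in> A" "d \<in> A"
  shows "openin M {q \<in> fst c. \<phi> q \<in> fst d}"
proof -
  have "openin M {q \<in> topspace M. \<phi> q \<in> fst d}"
    using assms chart_open openin_continuous_map_preimage by blast
  then have "openin M ({q \<in> topspace M. \<phi> q \<in> fst d} \<inter> fst c)"
    using assms chart_open by blast
  moreover have "{q \<in> topspace M. \<phi> q \<in> fst d} \<inter> fst c = {q \<in> fst c. \<phi> q \<in> fst d}"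
    using chart_subset[OF assms(2)] by auto
  ultimately show ?thesis by simp
qed

lemma smooth_map_continuous: "smooth_map \<phi> \<Longrightarrow> continuous_map M M \<phi>"
  by (simp add: smooth_map_def)

lemma smooth_at_map:
  assumes "smooth_map \<phi>" "c \<in> A" "d \<in> A" "p \<in> fst c" "\<phi> p \<in> fst d"
  shows "smooth_at c p (\<lambda>q. snd d (\<phi> q) $ k)"
proof -
  have "open (snd c ` {q \<in> fst c. \<phi> q \<in> fst d})"
    by (rule open_chart_image[OF assms(2) openin_preimage]) (use assms smooth_map_def in auto)
  then show ?thesis
    using assms smooth_on_iff_near unfolding smooth_map_def smooth_at_def by blast
qed

lemma smooth_at_compose:
  assumes "smooth_map \<phi>" "c \<in> A" "p \<in> fst c" "smooth_at d (\<phi> p) f"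
  shows "smooth_at c p (\<lambda>q. f (\<phi> q))"
    and "pd c i (\<lambda>q. f (\<phi> q)) p = (\<Sum>a\<in>UNIV. D1 \<phi> c d p a i * pd d a f (\<phi> p))"
proof -
  have d: "d \<in> A" "\<phi> p \<in> fst d" using assms(4) by (auto simp: smooth_at_def)
  let ?F = "\<lambda>x. snd d (\<phi> (inv_chart c x))"
  have F: "smooth_near (snd c p) (\<lambda>x. ?F x $ a)" for a
    using smooth_at_map[OF assms(1,2) d(1) assms(3) d(2), of a] by (simp add: smooth_at_def)
  have f: "smooth_near (?F (snd c p)) (\<lambda>y. f (inv_chart d y))"
    using assms by (simp add: smooth_at_def)
  \<comment> \<open>Where \<phi> stays inside the domain of d, the function f after \<phi> factors
    through the coordinates of d, which is what the chain rule in the plane requires.\<close>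
  have eq: "f (\<phi> (inv_chart c x)) = f (inv_chart d (?F x))" if "x \<in> snd c ` {q \<in> fst c. \<phi> q \<in> fst d}" for x
  proof -
    have "inv_chart c x \<in> {q \<in> fst c. \<phi> q \<in> fst d}"
      by (rule inv_chart_image[OF assms(2) that]) auto
    then show ?thesis using d(1) by simp
  qed
  have o: "open (snd c ` {q \<in> fst c. \<phi> q \<in> fst d})"
    by (rule open_chart_image[OF assms(2) openin_preimage]) (use assms d smooth_map_def in auto)
  have p: "snd c p \<in> snd c ` {q \<in> fst c. \<phi> q \<in> fst d}" using assms(3) d by blast
  have "smooth_near (snd c p) (\<lambda>x. f (\<phi> (inv_chart c x)))"
    by (rule smooth_near_cong[OF o p _ smooth_near_compose[where f = "\<lambda>y. f (inv_chart d y)", OF f F]])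
      (simp add: eq)
  then show "smooth_at c p (\<lambda>q. f (\<phi> q))"
    using assms by (simp add: smooth_at_def)
  have "pd c i (\<lambda>q. f (\<phi> q)) p = partial i (\<lambda>x. f (inv_chart d (?F x))) (snd c p)"
    unfolding pd_eq_partial by (rule partial_cong_open[OF o p]) (rule eq)
  also have "\<dots> = (\<Sum>a\<in>UNIV. partial i (\<lambda>x. ?F x $ a) (snd c p) * partial a (\<lambda>y. f (inv_chart d y)) (?F (snd c p)))"
    by (rule partial_compose(1)[where f = "\<lambda>y. f (inv_chart d y)"])
      (use F f smooth_near_differentiable in auto)
  finally show "pd c i (\<lambda>q. f (\<phi> q)) p = (\<Sum>a\<in>UNIV. D1 \<phi> c d p a i * pd d a f (\<phi> p))"
    using assms(2,3) by (simp add: D1_def pd_eq_partial)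
qed

text \<open>Transition functions are the coordinate expressions of the identity; every later change
  of chart is the case \<phi> = id of a statement about maps.\<close>

lemma smooth_map_id: "smooth_map id"
proof -
  have "{p \<in> fst c. id p \<in> fst d} = fst c \<inter> fst d" for c d :: "'a chart" by auto
  then show ?thesis
    using transition by (simp add: smooth_map_def)
qed

lemma smooth_at_D1:
  assumes "smooth_map \<phi>" "c \<in> A" "d \<in> A" "p \<in> fst c" "\<phi> p \<in> fst d"
  shows "smooth_at c p (\<lambda>q. D1 \<phi> c d q a i)"
  unfolding D1_def using smooth_at_pd[OF smooth_at_map[OF assms]] .

lemma D2_sym:
  assumes "smooth_map \<phi>" "c \<in> A" "d \<in> A" "p \<in> fst c" "\<phi> p \<in> fst d"
  shows "D2 \<phi> c d p a i j = D2 \<phi> c d p a j i"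
  using pd_commute[OF smooth_at_map[OF assms]] unfolding D2_def D1_def .

lemma smooth_at_D2:
  assumes "smooth_map \<phi>" "c \<in> A" "d \<in> A" "p \<in> fst c" "\<phi> p \<in> fst d"
  shows "smooth_at c p (\<lambda>q. D2 \<phi> c d q a i j)"
  unfolding D2_def using smooth_at_pd[OF smooth_at_D1[OF assms]] .

lemma D1_chain:
  assumes "smooth_map \<phi>" "smooth_map \<theta>" "c \<in> A" "d \<in> A" "e \<in> A"
    "p \<in> fst c" "\<phi> p \<in> fst d" "\<theta> (\<phi> p) \<in> fst e"
  shows "D1 (\<lambda>q. \<theta> (\<phi> q)) c e p a i = (\<Sum>b\<in>UNIV. D1 \<theta> d e (\<phi> p) a b * D1 \<phi> c d p b i)"
  using smooth_at_compose(2)[OF assms(1,3,6) smooth_at_map[OF assms(2,4,5,7,8), of a], of i]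
  by (simp add: D1_def mult.commute)

lemma D2_chain:
  assumes "smooth_map \<phi>" "smooth_map \<theta>" "c \<in> A" "d \<in> A" "e \<in> A"
    "p \<in> fst c" "\<phi> p \<in> fst d" "\<theta> (\<phi> p) \<in> fst e"
  shows "D2 (\<lambda>q. \<theta> (\<phi> q)) c e p a i j =
    (\<Sum>b\<in>UNIV. D1 \<theta> d e (\<phi> p) a b * D2 \<phi> c d p b i j +
       (\<Sum>f\<in>UNIV. D1 \<phi> c d p f i * D2 \<theta> d e (\<phi> p) a f b) * D1 \<phi> c d p b j)"
proof -
  have cont: "continuous_map M M \<phi>" "continuous_map M M (\<lambda>q. \<theta> (\<phi> q))"
    using assms(1,2) continuous_map_compose[of M M \<phi> M \<theta>] by (auto simp: smooth_map_def o_def)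
  let ?W = "{q \<in> fst c. \<phi> q \<in> fst d} \<inter> {q \<in> fst c. \<theta> (\<phi> q) \<in> fst e}"
  have W: "openin M ?W"
    using openin_preimage cont assms by blast
  have s: "smooth_at c p (\<lambda>q. D1 \<theta> d e (\<phi> q) a b)" "smooth_at c p (\<lambda>q. D1 \<phi> c d q b j)" for b
    using smooth_at_compose(1)[OF assms(1,3,6) smooth_at_D1[OF assms(2,4,5,7,8)]]
      smooth_at_D1[OF assms(1,3,4,6,7)] .
  have "D2 (\<lambda>q. \<theta> (\<phi> q)) c e p a i j = pd c i (\<lambda>q. \<Sum>b\<in>UNIV. D1 \<theta> d e (\<phi> q) a b * D1 \<phi> c d q b j) p"
    unfolding D2_def
    by (rule pd_cong[OF assms(3,6) W]) (use assms in \<open>auto intro: D1_chain\<close>)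
  also have "\<dots> = (\<Sum>b\<in>UNIV. D1 \<theta> d e (\<phi> p) a b * D2 \<phi> c d p b i j +
       pd c i (\<lambda>q. D1 \<theta> d e (\<phi> q) a b) p * D1 \<phi> c d p b j)"
    using s assms(3,6) by (simp add: pd_sum pd_mult smooth_at_mult D2_def)
  also have "\<dots> = (\<Sum>b\<in>UNIV. D1 \<theta> d e (\<phi> p) a b * D2 \<phi> c d p b i j +
       (\<Sum>f\<in>UNIV. D1 \<phi> c d p f i * D2 \<theta> d e (\<phi> p) a f b) * D1 \<phi> c d p b j)"
    by (simp add: smooth_at_compose(2)[OF assms(1,3,6) smooth_at_D1[OF assms(2,4,5,7,8)]] D2_def)
  finally show ?thesis .
qed

lemma D1_id_same:
  assumes "c \<in> A" "p \<in> fst c"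
  shows "D1 id c c p a i = (if a = i then 1 else 0)"
proof -
  have "D1 id c c p a i = partial i (\<lambda>x. x $ a) (snd c p)"
    unfolding D1_def pd_eq_partial
    by (rule partial_cong_open[of "snd c ` fst c"]) (use assms chart_open in auto)
  then show ?thesis by (simp add: partial_component)
qed

lemma D1_inverse:
  assumes "smooth_map \<phi>" "smooth_map \<psi>" "c \<in> A" "d \<in> A" "p \<in> fst c" "\<phi> p \<in> fst d"
    "\<And>q. q \<in> topspace M \<Longrightarrow> \<psi> (\<phi> q) = q"
  shows "(\<Sum>m\<in>UNIV. D1 \<psi> d c (\<phi> p) k m * D1 \<phi> c d p m i) = (if k = i then 1 else 0)"
proof -
  have p: "\<psi> (\<phi> p) = p" using assms chart_subset by blast
  have "(\<Sum>m\<in>UNIV. D1 \<psi> d c (\<phi> p) k m * D1 \<phi> c d p m i) = D1 (\<lambda>q. \<psi> (\<phi> q)) c c p k i"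
    by (rule D1_chain[symmetric]) (use assms p in auto)
  also have "\<dots> = D1 id c c p k i"
    unfolding D1_def by (rule pd_cong[OF assms(3,5) openin_topspace]) (use assms chart_subset[OF assms(3)] in auto)
  finally show ?thesis using D1_id_same assms by simp
qed

section \<open>Supports and partitions of unity\<close>

lemma closedin_support: "closedin M (support f)"
  by (simp add: support_def)

lemma notin_support: "p \<in> topspace M \<Longrightarrow> p \<notin> support f \<Longrightarrow> f p = 0"
  using closure_of_subset[of "{p \<in> topspace M. f p \<noteq> 0}" M] by (auto simp: support_def)

lemma support_minimal:
  assumes "closedin M K" "\<And>p. p \<in> topspace M \<Longrightarrow> p \<notin> K \<Longrightarrow> f p = 0"
  shows "support f \<subseteq> K"
  unfolding support_def by (rule closure_of_minimal[OF _ assms(1)]) (use assms(2) in auto)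

lemma closedin_compact: "compactin M K \<Longrightarrow> closedin M K"
  using compactin_imp_closedin hausdorff by blast

lemma compact_support_subset:
  assumes "compactin M K" "\<And>p. p \<in> topspace M \<Longrightarrow> p \<notin> K \<Longrightarrow> f p = 0"
  shows "compactin M (support f)"
  using closed_compactin[OF assms(1) support_minimal[OF closedin_compact[OF assms(1)] assms(2)] closedin_support] .

lemma chart_exists:
  assumes "p \<in> topspace M"
  shows "chart_at p \<in> A" "p \<in> fst (chart_at p)"
proof -
  have "\<exists>c. c \<in> A \<and> p \<in> fst c" using assms covers by blast
  then show "chart_at p \<in> A" "p \<in> fst (chart_at p)"
    unfolding chart_at_def by (metis (mono_tags, lifting) someI_ex)+
qed

lemma smooth_at_zero_off_support:
  assumes "c \<in> A" "p \<in> fst c" "p \<notin> support f"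
  shows "smooth_at c p f"
proof (rule smooth_at_cong[OF smooth_at_const[OF assms(1,2)]])
  show "openin M (topspace M - support f)" using closedin_support by blast
  show "p \<in> topspace M - support f" using assms chart_subset by blast
  show "0 = f q" if "q \<in> topspace M - support f" for q using notin_support[of q f] that by simp
qed

text \<open>A bump function of a chart, extended by zero. The preimage L of the closed ball is
  compact, hence closed in M by the Hausdorff property; therefore the extension is smooth also at
  points on the boundary of the chart domain.\<close>

lemma local_plateau:
  assumes "p \<in> topspace M"
  obtains c B V where "c \<in> A" "openin M V" "p \<in> V" "\<And>q. q \<in> V \<Longrightarrow> B q = (1::real)"
    "\<And>q. 0 \<le> B q" "\<And>q. B q \<le> 1" "\<And>d. d \<in> A \<Longrightarrow> smooth_comp d B"
    "compactin M (support B)" "support B \<subseteq> fst c"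
proof -
  define c where "c = chart_at p"
  have c: "c \<in> A" "p \<in> fst c" using chart_exists assms by (auto simp: c_def)
  have op: "open (snd c ` fst c)" using chart_open c by blast
  then obtain s where s: "s > 0" "cball (snd c p) s \<subseteq> snd c ` fst c"
    using c open_contains_cball by blast
  \<comment> \<open>The bump lives on the ball of radius 2 r, whose closure must lie in the image of
    the chart.\<close>
  define r where "r = s / 2"
  have r: "r > 0" "cball (snd c p) (2 * r) \<subseteq> snd c ` fst c" using s by (auto simp: r_def)
  obtain b where b: "\<And>x. smooth_near x b" "\<And>x. 0 \<le> b x" "\<And>x. b x \<le> 1"
    "\<And>x. x \<in> cball (snd c p) r \<Longrightarrow> b x = 1" "\<And>x. x \<notin> ball (snd c p) (2 * r) \<Longrightarrow> b x = 0"
    using bump_function[OF r(1)] by blast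
  define B where "B q = (if q \<in> fst c then b (snd c q) else 0)" for q
  define L where "L = {q \<in> fst c. snd c q \<in> cball (snd c p) (2 * r)}"
  have im: "snd c ` L = cball (snd c p) (2 * r)" using r(2) by (auto simp: L_def)
  have "compactin (top_of_set (snd c ` fst c)) (snd c ` L)"
    unfolding im using r(2) by (simp add: compactin_subtopology)
  then have "compactin (subtopology M (fst c)) L"
    using homeomorphic_map_compactness[OF chart_homeo[OF c(1)], of L] chart_subset[OF c(1)]
    by (auto simp: L_def)
  then have L: "compactin M L" by (simp add: compactin_subtopology)
  have B0: "B q = 0" if "q \<notin> L" for q
    using that b(5) by (auto simp: B_def L_def)
  have sup: "support B \<subseteq> L"
    by (rule support_minimal[OF closedin_compact[OF L]]) (rule B0)
  show thesis
  proof (rule that[of c])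
    define V where "V = {q \<in> fst c. snd c q \<in> ball (snd c p) r}"
    show "openin M V"
      unfolding V_def by (rule openin_chart_preimage[OF c(1)]) simp
    show "p \<in> V" using c r by (simp add: V_def)
    show "B q = 1" if "q \<in> V" for q
      using that b(4) by (auto simp: V_def B_def)
    show "0 \<le> B q" "B q \<le> 1" for q using b by (auto simp: B_def)
    show "compactin M (support B)"
      by (rule compact_support_subset[OF L]) (rule B0)
    show "support B \<subseteq> fst c" using sup by (auto simp: L_def)
    show "smooth_comp d B" if d: "d \<in> A" for d
    proof (subst smooth_comp_iff[OF d], rule ballI)
      fix q assume q: "q \<in> fst d"
      show "smooth_at d q B"
      proof (cases "q \<in> fst c")
        case True
        have "smooth_near (snd c q) (\<lambda>x. b (snd c (inv_chart c x)))"
          by (rule smooth_near_cong[OF op _ _ b(1)]) (use True in auto)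
        then have "smooth_at c (id q) (\<lambda>q. b (snd c q))"
          using c True by (simp add: smooth_at_def)
        from smooth_at_compose(1)[OF smooth_map_id d q this]
        have "smooth_at d q (\<lambda>q. b (snd c q))" by simp
        then show ?thesis
          by (rule smooth_at_cong[of _ _ _ "fst c"]) (use c chart_open True in \<open>auto simp: B_def\<close>)
      next
        case False
        then show ?thesis
          using smooth_at_zero_off_support[OF d q] sup by (auto simp: L_def)
      qed
    qed
  qed (use c in auto)
qed

text \<open>Each term is the difference of consecutive products of the factors 1 - B i. In the
  partition of unity some B j equals 1 at a given point of K, so the last product vanishes there and
  the sum is 1 without any division.\<close>

lemma sum_telescoping_products:
  fixes B :: "nat \<Rightarrow> real"
  shows "(\<Sum>j<n. B j * (\<Prod>i<j. 1 - B i)) = 1 - (\<Prod>j<n. 1 - B j)"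
  by (induction n) (auto simp: algebra_simps)

lemma partition_of_unity_exists:
  assumes "compactin M K"
  obtains n C u where "partition_of_unity K n C u"
proof -
  have "\<exists>c B V. c \<in> A \<and> openin M V \<and> p \<in> V \<and> (\<forall>q\<in>V. B q = (1::real)) \<and>
    (\<forall>q. 0 \<le> B q \<and> B q \<le> 1) \<and> (\<forall>d\<in>A. smooth_comp d B) \<and>
    compactin M (support B) \<and> support B \<subseteq> fst c" if "p \<in> topspace M" for p
    using local_plateau[OF that] by metis
  then obtain cc BB VV where *: "\<And>p. p \<in> topspace M \<Longrightarrow> cc p \<in> A \<and> openin M (VV p) \<and> p \<in> VV p \<and>
    (\<forall>q\<in>VV p. BB p q = (1::real)) \<and> (\<forall>q. 0 \<le> BB p q \<and> BB p q \<le> 1) \<and> (\<forall>d\<in>A. smooth_comp d (BB p)) \<and>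
    compactin M (support (BB p)) \<and> support (BB p) \<subseteq> fst (cc p)"
    by metis
  have Ks: "K \<subseteq> topspace M" using assms compactin_subset_topspace by blast
  obtain F where F: "finite F" "F \<subseteq> VV ` K" "K \<subseteq> \<Union>F"
  proof -
    have "\<exists>F. finite F \<and> F \<subseteq> VV ` K \<and> K \<subseteq> \<Union>F"
      by (rule compactinD[OF assms]) (use * Ks in blast)+
    then show thesis using that by blast
  qed
  obtain G where G: "finite G" "G \<subseteq> K" "F = VV ` G"
    using finite_subset_image[OF F(1,2)] by blast
  obtain h where h: "bij_betw h {0..<card G} G"
    using ex_bij_betw_nat_finite[OF G(1)] by blast
  let ?n = "card G"
  have hG: "h j \<in> topspace M" if "j < ?n" for j
    using bij_betw_apply[OF h, of j] that G(2) Ks by auto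
  define B where "B j = BB (h j)" for j
  define u where "u j q = (if j < ?n then B j q * (\<Prod>i<j. 1 - B i q) else 0)" for j q
  have u0: "u j q = 0" if "q \<in> topspace M" "q \<notin> support (B j)" for j q
    using notin_support[OF that] by (simp add: u_def)
  have "partition_of_unity K ?n (\<lambda>j. cc (h j)) u"
    unfolding partition_of_unity_def
  proof (intro conjI allI impI ballI)
    fix j assume j: "j < ?n"
    note B = *[OF hG[OF j], folded B_def]
    show "cc (h j) \<in> A" using B by blast
    show "0 \<le> u j p" for p
      using * hG j by (auto simp: u_def B_def intro!: mult_nonneg_nonneg prod_nonneg)
    show "compactin M (support (u j))"
      using compact_support_subset[of "support (B j)"] u0 B by blast
    have "support (u j) \<subseteq> support (B j)"
      by (rule support_minimal[OF closedin_support]) (rule u0)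
    then show "support (u j) \<subseteq> fst (cc (h j))" using B by blast
    fix c assume c: "c \<in> A"
    show "smooth_comp c (u j)"
    proof (subst smooth_comp_iff[OF c], rule ballI)
      fix p assume p: "p \<in> fst c"
      have "smooth_at c p (B i)" if "i < ?n" for i
        using *[OF hG[OF that], folded B_def] c p smooth_comp_iff by blast
      then show "smooth_at c p (u j)"
        unfolding u_def using j c p
        by (auto intro!: smooth_at_mult smooth_at_prod smooth_at_diff smooth_at_const)
    qed
  next
    fix p assume p: "p \<in> K"
    obtain g where g: "g \<in> G" "p \<in> VV g" using F(3) G(3) p by blast
    then obtain j where j: "j < ?n" "h j = g"
      using h by (metis atLeastLessThan_iff bij_betw_iff_bijections)
    have "B j p = 1" using *[OF hG[OF j(1)]] g j by (simp add: B_def)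
    then have "(\<Prod>j<?n. 1 - B j p) = 0"
      using j(1) by (intro prod_zero) (auto intro!: bexI[of _ j])
    moreover have "(\<Sum>j<?n. u j p) = (\<Sum>j<?n. B j p * (\<Prod>i<j. 1 - B i p))"
      by (rule sum.cong) (auto simp: u_def)
    ultimately show "(\<Sum>j<?n. u j p) = 1"
      by (simp add: sum_telescoping_products)
  qed
  then show thesis using that by blast
qed

end

section \<open>The integral over a symplectic surface\<close>

context smooth_surface
begin

definition test_function :: "('a \<Rightarrow> real) \<Rightarrow> bool" where
  "test_function f \<longleftrightarrow> (\<forall>c\<in>A. smooth_comp c f) \<and> compactin M (support f)"

lemma test_function_smooth: "test_function f \<Longrightarrow> c \<in> A \<Longrightarrow> p \<in> fst c \<Longrightarrow> smooth_at c p f"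
  by (simp add: test_function_def smooth_comp_iff)

lemma test_functionI:
  assumes "\<And>c p. c \<in> A \<Longrightarrow> p \<in> fst c \<Longrightarrow> smooth_at c p f" "compactin M K"
    "\<And>p. p \<in> topspace M \<Longrightarrow> p \<notin> K \<Longrightarrow> f p = 0"
  shows "test_function f"
  unfolding test_function_def
  using assms(1) compact_support_subset[OF assms(2,3)] by (auto simp: smooth_comp_iff)

lemma test_function_compact: "test_function f \<Longrightarrow> compactin M (support f)"
  by (simp add: test_function_def)

lemma test_function_mult:
  assumes "test_function f" "\<And>c p. c \<in> A \<Longrightarrow> p \<in> fst c \<Longrightarrow> smooth_at c p g"
  shows "test_function (\<lambda>p. g p * f p)"
  by (rule test_functionI[OF _ test_function_compact[OF assms(1)]])
    (use assms in \<open>auto intro: smooth_at_mult test_function_smooth simp: notin_support\<close>)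

lemma test_function_cmult: "test_function f \<Longrightarrow> test_function (\<lambda>p. k * f p)"
  using test_function_mult[of f "\<lambda>p. k"] smooth_at_const by blast

lemma test_function_add:
  assumes "test_function f" "test_function g"
  shows "test_function (\<lambda>p. f p + g p)"
  by (rule test_functionI[OF _ compactin_Un[OF test_function_compact[OF assms(1)] test_function_compact[OF assms(2)]]])
    (use assms in \<open>auto intro: smooth_at_add test_function_smooth simp: notin_support\<close>)

lemma support_mult: "support (\<lambda>p. u p * f p) \<subseteq> support u" "support (\<lambda>p. u p * f p) \<subseteq> support f"
  by (rule support_minimal[OF closedin_support], simp add: notin_support)+

lemma compact_chart_image:
  assumes "c \<in> A" "compactin M K" "K \<subseteq> fst c"
  shows "compact (snd c ` K)"
proof -
  have "compactin (subtopology M (fst c)) K"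
    using assms by (simp add: compactin_subtopology)
  then have "compactin (top_of_set (snd c ` fst c)) (snd c ` K)"
    using homeomorphic_map_compactness[OF chart_homeo[OF assms(1)], of K] chart_subset[OF assms(1)] assms(3)
    by auto
  then show ?thesis by (simp add: compactin_subtopology)
qed

lemma smooth_at_isCont: "smooth_at c p f \<Longrightarrow> isCont (\<lambda>x. f (inv_chart c x)) (snd c p)"
  by (simp add: smooth_at_def smooth_near_isCont)

lemma smooth_at_pos_nbhd:
  assumes "smooth_at c p f" "f p > 0"
  shows "\<exists>W. openin M W \<and> p \<in> W \<and> (\<forall>q\<in>W. f q > 0)"
proof -
  have cp: "c \<in> A" "p \<in> fst c" using assms by (auto simp: smooth_at_def)
  have "((\<lambda>x. f (inv_chart c x)) \<longlongrightarrow> f (inv_chart c (snd c p))) (nhds (snd c p))"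
    using smooth_at_isCont[OF assms(1)] tendsto_at_iff_tendsto_nhds isCont_def by blast
  then have "eventually (\<lambda>x. f (inv_chart c x) > 0) (nhds (snd c p))"
    using assms(2) cp by (intro order_tendstoD(1)) auto
  then obtain S where S: "open S" "snd c p \<in> S" "\<And>x. x \<in> S \<Longrightarrow> f (inv_chart c x) > 0"
    unfolding eventually_nhds by blast
  have "f q > 0" if "q \<in> fst c" "snd c q \<in> S" for q
    using S(3)[OF that(2)] that cp by simp
  then show ?thesis
    using openin_chart_preimage[OF cp(1) S(1)] S cp by (intro exI[of _ "{q \<in> fst c. snd c q \<in> S}"]) auto
qed

text \<open>The volume density contains an absolute value. Writing it as sign times \<Omega> and
  passing the sign through derivatives makes charts of either orientation behave alike.\<close>

lemma smooth_at_sgn: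
  assumes "smooth_at c p f" "f p \<noteq> 0"
  shows "smooth_at c p (\<lambda>q. sgn (f q))" "pd c i (\<lambda>q. sgn (f q)) p = 0"
proof -
  have cp: "c \<in> A" "p \<in> fst c" using assms by (auto simp: smooth_at_def)
  have "\<exists>W. openin M W \<and> p \<in> W \<and> (\<forall>q\<in>W. sgn (f q) = sgn (f p))"
  proof (cases "f p > 0")
    case True
    then show ?thesis
      using smooth_at_pos_nbhd[OF assms(1)] by auto
  next
    case False
    then have "- f p > 0" using assms(2) by simp
    then show ?thesis
      using smooth_at_pos_nbhd[OF smooth_at_minus[OF assms(1)]] by auto
  qed
  then obtain W where W: "openin M W" "p \<in> W" "\<And>q. q \<in> W \<Longrightarrow> sgn (f q) = sgn (f p)"
    by blast
  show "smooth_at c p (\<lambda>q. sgn (f q))"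
    by (rule smooth_at_cong[OF smooth_at_const[OF cp, of "sgn (f p)"] W(1,2)]) (simp add: W(3))
  show "pd c i (\<lambda>q. sgn (f q)) p = 0"
    using pd_cong[OF cp W(1,2), of "\<lambda>q. sgn (f q)" "\<lambda>q. sgn (f p)"] W(3) by simp
qed

end

context symplectic_surface
begin

section \<open>Components of the symplectic form and of its inverse\<close>

lemma Omega_smooth: "c \<in> A \<Longrightarrow> p \<in> fst c \<Longrightarrow> smooth_at c p (\<lambda>q. \<Omega> c q i j)"
  using form by (simp add: two_forms_def smooth_comp_iff)

lemma Omega_components:
  "\<Omega> c p 1 1 = 0" "\<Omega> c p 2 2 = 0" "\<Omega> c p 2 1 = - \<Omega> c p 1 2"
proof -
  have "\<Omega> c p i j = - \<Omega> c p j i" for i j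
    using form unfolding two_forms_def by blast
  from this[of 1 1] this[of 2 2] this[of 2 1]
  show "\<Omega> c p 1 1 = 0" "\<Omega> c p 2 2 = 0" "\<Omega> c p 2 1 = - \<Omega> c p 1 2" by auto
qed

lemma Omega_nonzero: "c \<in> A \<Longrightarrow> p \<in> fst c \<Longrightarrow> \<Omega> c p 1 2 \<noteq> 0"
  using nondegenerate[of c p] unfolding invertible_det_nz
  by (simp add: det_2 Omega_components)

lemma Omega_up_components:
  assumes "c \<in> A" "p \<in> fst c"
  shows "\<Omega>up c p 1 1 = 0" "\<Omega>up c p 2 2 = 0" "\<Omega>up c p 1 2 = 1 / \<Omega> c p 1 2" "\<Omega>up c p 2 1 = - 1 / \<Omega> c p 1 2"
proof -
  let ?w = "\<Omega> c p 1 2"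
  \<comment> \<open>The inverse of the antisymmetric matrix with upper right entry \<open>?w\<close>
    has upper right entry -1 / \<open>?w\<close>; the sign in \<open>\<Omega>up\<close> makes it
    positive.\<close>
  let ?B = "(\<chi> i j. if i = j then 0 else if i = 1 then - 1 / ?w else 1 / ?w) :: real^2^2"
  let ?O = "(\<chi> a b. \<Omega> c p a b) :: real^2^2"
  have w: "?w \<noteq> 0" by (rule Omega_nonzero[OF assms])
  have B: "?O ** ?B = mat 1"
    using w by (simp add: vec_eq_iff forall_2 matrix_matrix_mult_def sum_2 mat_def Omega_components)
  have "matrix_inv ?O ** ?O = mat 1"
    using someI_ex[OF nondegenerate[OF assms, unfolded invertible_def]]
    unfolding matrix_inv_def by blast
  then have "matrix_inv ?O ** (?O ** ?B) = mat 1 ** ?B"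
    unfolding matrix_mul_assoc by (rule arg_cong)
  then have "matrix_inv ?O = ?B"
    unfolding B matrix_mul_lid matrix_mul_rid .
  then show "\<Omega>up c p 1 1 = 0" "\<Omega>up c p 2 2 = 0" "\<Omega>up c p 1 2 = 1 / \<Omega> c p 1 2" "\<Omega>up c p 2 1 = - 1 / \<Omega> c p 1 2"
    by (simp_all add: \<Omega>up_def)
qed

text \<open>In dimension two pulling back a two-form is multiplication by the Jacobian determinant,
  exactly the factor that a change of variables produces.\<close>

lemma Omega_change_chart:
  assumes "c \<in> A" "d \<in> A" "p \<in> fst c" "p \<in> fst d"
  shows "\<Omega> c p 1 2 = (D1 id c d p 1 1 * D1 id c d p 2 2 - D1 id c d p 2 1 * D1 id c d p 1 2) * \<Omega> d p 1 2"
proof -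
  have "\<Omega> c p = tr2 id c d \<Omega> p"
    using form assms unfolding two_forms_def by blast
  then show ?thesis
    by (simp add: tr2_def sum_2 Omega_components algebra_simps)
qed

section \<open>Integrals of smooth densities and their independence of choices\<close>

lemma density_continuous:
  assumes "c \<in> A" "\<And>p. p \<in> fst c \<Longrightarrow> smooth_at c p f"
  shows "continuous_on (snd c ` fst c) (\<lambda>x. f (inv_chart c x) * \<bar>\<Omega> c (inv_chart c x) 1 2\<bar>)"
proof (rule continuous_at_imp_continuous_on, rule ballI)
  fix x assume "x \<in> snd c ` fst c"
  then obtain p where "p \<in> fst c" "x = snd c p" by blast
  then show "isCont (\<lambda>x. f (inv_chart c x) * \<bar>\<Omega> c (inv_chart c x) 1 2\<bar>) x"
    using smooth_at_isCont[OF assms(2)] smooth_at_isCont[OF Omega_smooth[OF assms(1)]]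
    by (intro continuous_intros) auto
qed

lemma density_integrable:
  assumes "c \<in> A" "test_function f" "support f \<subseteq> fst c" "support f \<subseteq> W" "W \<subseteq> fst c" "openin M W"
  shows "(\<lambda>x. f (inv_chart c x) * \<bar>\<Omega> c (inv_chart c x) 1 2\<bar>) absolutely_integrable_on (snd c ` W)"
proof (rule integrable_compact_support)
  show "open (snd c ` W)" by (rule open_chart_image) (use assms in auto)
  show "compact (snd c ` support f)"
    using compact_chart_image assms test_function_compact by blast
  show "snd c ` support f \<subseteq> snd c ` W" using assms by blast
  show "continuous_on (snd c ` W) (\<lambda>x. f (inv_chart c x) * \<bar>\<Omega> c (inv_chart c x) 1 2\<bar>)"
    by (rule continuous_on_subset[OF density_continuous])
      (use assms test_function_smooth in auto)
  fix x assume "x \<in> snd c ` W - snd c ` support f"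
  then obtain p where "p \<in> W" "x = snd c p" "p \<notin> support f" by blast
  then show "f (inv_chart c x) * \<bar>\<Omega> c (inv_chart c x) 1 2\<bar> = 0"
    using assms(1,5) subsetD[OF chart_subset[OF assms(1)], of p] notin_support[of p f]
    by (simp add: subset_iff)
qed

lemma chart_integral_add:
  assumes "c \<in> A" "test_function f" "test_function g" "support f \<subseteq> fst c" "support g \<subseteq> fst c"
  shows "chart_integral c (\<lambda>p. f p + g p) = chart_integral c f + chart_integral c g"
  unfolding chart_integral_def distrib_right
  using density_integrable[OF assms(1,2,4,4)] density_integrable[OF assms(1,3,5,5)] chart_open[OF assms(1)]
  by (intro integral_add) (auto simp: absolutely_integrable_on_def)

lemma chart_integral_cmult: "chart_integral c (\<lambda>p. k * f p) = k * chart_integral c f"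
  unfolding chart_integral_def by (simp add: mult.assoc)

lemma chart_integral_sum:
  assumes "c \<in> A" "finite I" "\<And>j. j \<in> I \<Longrightarrow> test_function (f j)" "\<And>j. j \<in> I \<Longrightarrow> support (f j) \<subseteq> fst c"
  shows "chart_integral c (\<lambda>p. \<Sum>j\<in>I. f j p) = (\<Sum>j\<in>I. chart_integral c (f j))"
  unfolding chart_integral_def sum_distrib_right
  by (rule integral_sum[OF assms(2)])
    (use density_integrable[OF assms(1,3,4,4)] chart_open[OF assms(1)] in \<open>auto simp: absolutely_integrable_on_def\<close>)

lemma chart_integral_cong:
  assumes "\<And>p. p \<in> fst c \<Longrightarrow> f p = g p"
  shows "chart_integral c f = chart_integral c g"
  unfolding chart_integral_def by (rule integral_cong) (simp add: assms)

text \<open>Both integrals are cut down to the overlap, outside of which the integrand vanishes.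
  There the Jacobian of the transition map turns the density of d into that of c.\<close>

lemma chart_integral_change_chart:
  assumes "c \<in> A" "d \<in> A" "test_function f" "support f \<subseteq> fst c" "support f \<subseteq> fst d"
  shows "chart_integral c f = chart_integral d f"
proof -
  let ?W = "fst c \<inter> fst d"
  let ?S = "snd c ` ?W"
  let ?g = "\<lambda>x. snd d (inv_chart c x)"
  let ?F = "\<lambda>c x. f (inv_chart c x) * \<bar>\<Omega> c (inv_chart c x) 1 2\<bar>"
  have W: "openin M ?W" using chart_open assms by blast
  have gS: "?g ` ?S = snd d ` ?W"
    using assms(1) by (force simp: image_iff)
  have restrict: "integral (snd b ` ?W) (?F b) = chart_integral b f" if "b \<in> A" "?W \<subseteq> fst b" for b
    unfolding chart_integral_def
  proof (rule integral_superset)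
    show "snd b ` ?W \<subseteq> snd b ` fst b" using that by blast
    fix x assume "x \<in> snd b ` fst b - snd b ` ?W"
    then obtain p where "p \<in> fst b" "x = snd b p" "p \<notin> ?W" by blast
    then show "?F b x = 0"
      using notin_support[of p f] chart_subset[OF that(1)] that assms by auto
  qed
  have "integral (?g ` ?S) (?F d) = integral ?S (\<lambda>x.
     \<bar>partial 1 (\<lambda>y. ?g y $ 1) x * partial 2 (\<lambda>y. ?g y $ 2) x
        - partial 1 (\<lambda>y. ?g y $ 2) x * partial 2 (\<lambda>y. ?g y $ 1) x\<bar> * ?F d (?g x))"
  proof (rule integral_change_of_coordinates)
    show "open ?S" by (rule open_chart_image) (use assms W in auto)
    show "inj_on ?g ?S"
    proof (rule inj_onI)
      fix x y assume "x \<in> ?S" "y \<in> ?S" and eq: "?g x = ?g y"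
      then obtain p q where "p \<in> ?W" "x = snd c p" "q \<in> ?W" "y = snd c q" by blast
      then show "x = y"
        using eq assms(1,2) inj_onD[OF chart_inj[OF assms(2)]] by auto
    qed
    show "(\<lambda>y. ?g y $ a) differentiable (at x)" if "x \<in> ?S" for x a
    proof -
      obtain p where p: "p \<in> ?W" "x = snd c p" using \<open>x \<in> ?S\<close> by blast
      then have "smooth_at c p (\<lambda>q. snd d (id q) $ a)"
        by (intro smooth_at_map smooth_map_id) (use assms in auto)
      then show ?thesis using smooth_at_differentiable p by fastforce
    qed
    show "?F d absolutely_integrable_on (?g ` ?S)"
      unfolding gS by (rule density_integrable) (use assms W in auto)
  qed
  also have "\<dots> = integral ?S (?F c)"
  proof (rule integral_cong)
    fix x assume "x \<in> ?S"
    then obtain p where p: "p \<in> ?W" "x = snd c p" by blast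
    have "partial i (\<lambda>y. ?g y $ a) x = D1 id c d p a i" for a i
      using p by (simp add: D1_def pd_eq_partial)
    then have "\<bar>partial 1 (\<lambda>y. ?g y $ 1) x * partial 2 (\<lambda>y. ?g y $ 2) x
        - partial 1 (\<lambda>y. ?g y $ 2) x * partial 2 (\<lambda>y. ?g y $ 1) x\<bar> * \<bar>\<Omega> d p 1 2\<bar> = \<bar>\<Omega> c p 1 2\<bar>"
      using Omega_change_chart[OF assms(1,2), of p] p by (simp add: abs_mult)
    then show "\<bar>partial 1 (\<lambda>y. ?g y $ 1) x * partial 2 (\<lambda>y. ?g y $ 2) x
        - partial 1 (\<lambda>y. ?g y $ 2) x * partial 2 (\<lambda>y. ?g y $ 1) x\<bar> * ?F d (?g x) = ?F c x"
      using p assms(1,2) by simp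
  qed
  finally show ?thesis
    unfolding gS using restrict assms by simp
qed

text \<open>This makes the \<open>THE\<close> in \<open>surface_integral\<close> denote. Inserting
  the other partition on each side gives a double sum of functions supported in two charts at once,
  which may be integrated in either chart. K and L may exceed the support, so that several functions
  can share one partition.\<close>

lemma partition_sum_unique:
  assumes "test_function f" "partition_of_unity K n C u" "support f \<subseteq> K"
    "partition_of_unity L m E v" "support f \<subseteq> L"
  shows "(\<Sum>j<n. chart_integral (C j) (\<lambda>p. u j p * f p)) = (\<Sum>k<m. chart_integral (E k) (\<lambda>p. v k p * f p))"
proof -
  have C: "C j \<in> A" "\<And>c p. c \<in> A \<Longrightarrow> p \<in> fst c \<Longrightarrow> smooth_at c p (u j)" "support (u j) \<subseteq> fst (C j)" if "j < n" for j
    using assms(2) that by (auto simp: partition_of_unity_def smooth_comp_iff)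
  have E: "E j \<in> A" "\<And>c p. c \<in> A \<Longrightarrow> p \<in> fst c \<Longrightarrow> smooth_at c p (v j)" "support (v j) \<subseteq> fst (E j)" if "j < m" for j
    using assms(4) that by (auto simp: partition_of_unity_def smooth_comp_iff)
  have uf: "test_function (\<lambda>p. u j p * f p)" if "j < n" for j
    using test_function_mult[OF assms(1)] C(2)[OF that] by blast
  have vf: "test_function (\<lambda>p. v j p * f p)" if "j < m" for j
    using test_function_mult[OF assms(1)] E(2)[OF that] by blast
  have uvf: "test_function (\<lambda>p. v k p * (u j p * f p))" if "j < n" "k < m" for j k
    using test_function_mult[OF uf[OF that(1)]] E(2)[OF that(2)] by blast
  have sup1: "support (\<lambda>p. v k p * (u j p * f p)) \<subseteq> fst (C j)" if "j < n" for j k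
    using support_mult(2)[of "v k" "\<lambda>p. u j p * f p"] support_mult(1)[of "u j" f] C(3)[OF that] by blast
  have sup2: "support (\<lambda>p. v k p * (u j p * f p)) \<subseteq> fst (E k)" if "k < m" for j k
    using support_mult(1)[of "v k" "\<lambda>p. u j p * f p"] E(3)[OF that] by blast
  have "(\<Sum>j<n. chart_integral (C j) (\<lambda>p. u j p * f p))
      = (\<Sum>j<n. \<Sum>k<m. chart_integral (C j) (\<lambda>p. v k p * (u j p * f p)))"
  proof (rule sum.cong[OF refl])
    fix j assume j: "j \<in> {..<n}"
    have "chart_integral (C j) (\<lambda>p. u j p * f p) = chart_integral (C j) (\<lambda>p. \<Sum>k<m. v k p * (u j p * f p))"
    proof (rule chart_integral_cong)
      fix p assume p: "p \<in> fst (C j)"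
      then have t: "p \<in> topspace M" using C(1) j chart_subset by blast
      show "u j p * f p = (\<Sum>k<m. v k p * (u j p * f p))"
      proof (cases "p \<in> support f")
        case True
        then have "(\<Sum>k<m. v k p) = 1" using assms(4,5) by (auto simp: partition_of_unity_def)
        then show ?thesis by (simp flip: sum_distrib_right)
      qed (simp add: notin_support t)
    qed
    also have "\<dots> = (\<Sum>k<m. chart_integral (C j) (\<lambda>p. v k p * (u j p * f p)))"
      by (rule chart_integral_sum) (use C uvf sup1 j in auto)
    finally show "chart_integral (C j) (\<lambda>p. u j p * f p)
        = (\<Sum>k<m. chart_integral (C j) (\<lambda>p. v k p * (u j p * f p)))" .
  qed
  also have "\<dots> = (\<Sum>j<n. \<Sum>k<m. chart_integral (E k) (\<lambda>p. v k p * (u j p * f p)))"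
    by (intro sum.cong refl chart_integral_change_chart) (use C E uvf sup1 sup2 in auto)
  also have "\<dots> = (\<Sum>k<m. \<Sum>j<n. chart_integral (E k) (\<lambda>p. v k p * (u j p * f p)))"
    by (rule sum.swap)
  also have "\<dots> = (\<Sum>k<m. chart_integral (E k) (\<lambda>p. v k p * f p))"
  proof (rule sum.cong[OF refl])
    fix k assume k: "k \<in> {..<m}"
    have "chart_integral (E k) (\<lambda>p. v k p * f p) = chart_integral (E k) (\<lambda>p. \<Sum>j<n. v k p * (u j p * f p))"
    proof (rule chart_integral_cong)
      fix p assume p: "p \<in> fst (E k)"
      then have t: "p \<in> topspace M" using E(1) k chart_subset by blast
      show "v k p * f p = (\<Sum>j<n. v k p * (u j p * f p))"
      proof (cases "p \<in> support f")
        case True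
        then have "(\<Sum>j<n. u j p) = 1" using assms(2,3) by (auto simp: partition_of_unity_def)
        then show ?thesis by (simp flip: sum_distrib_right sum_distrib_left)
      qed (simp add: notin_support t)
    qed
    also have "\<dots> = (\<Sum>j<n. chart_integral (E k) (\<lambda>p. v k p * (u j p * f p)))"
      by (rule chart_integral_sum) (use E uvf sup2 k in auto)
    finally show "(\<Sum>j<n. chart_integral (E k) (\<lambda>p. v k p * (u j p * f p)))
        = chart_integral (E k) (\<lambda>p. v k p * f p)" by simp
  qed
  finally show ?thesis .
qed

lemma surface_integral_eq:
  assumes "test_function f" "partition_of_unity K n C u" "support f \<subseteq> K"
  shows "surface_integral f = (\<Sum>j<n. chart_integral (C j) (\<lambda>p. u j p * f p))"
  unfolding surface_integral_def
proof (rule the_equality)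
  have "partition_of_unity (support f) n C u"
    using assms(2,3) by (auto simp: partition_of_unity_def)
  then show "\<exists>n' C' u'. partition_of_unity (support f) n' C' u' \<and>
      (\<Sum>j<n. chart_integral (C j) (\<lambda>p. u j p * f p)) = (\<Sum>j<n'. chart_integral (C' j) (\<lambda>p. u' j p * f p))"
    by blast
next
  fix r assume "\<exists>n' C' u'. partition_of_unity (support f) n' C' u' \<and>
      r = (\<Sum>j<n'. chart_integral (C' j) (\<lambda>p. u' j p * f p))"
  then show "r = (\<Sum>j<n. chart_integral (C j) (\<lambda>p. u j p * f p))"
    using partition_sum_unique[OF assms(1) _ _ assms(2,3)] by blast
qed

lemma partition_mult:
  assumes "test_function f" "partition_of_unity K n C u" "j < n"
  shows "C j \<in> A" "test_function (\<lambda>p. u j p * f p)" "support (\<lambda>p. u j p * f p) \<subseteq> fst (C j)"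
proof -
  have "C j \<in> A" "\<And>c p. c \<in> A \<Longrightarrow> p \<in> fst c \<Longrightarrow> smooth_at c p (u j)" "support (u j) \<subseteq> fst (C j)"
    using assms(2,3) by (auto simp: partition_of_unity_def smooth_comp_iff)
  then show "C j \<in> A" "test_function (\<lambda>p. u j p * f p)" "support (\<lambda>p. u j p * f p) \<subseteq> fst (C j)"
    using test_function_mult[OF assms(1)] support_mult(1)[of "u j" f] by blast+
qed

lemma surface_integral_add:
  assumes "test_function f" "test_function g"
  shows "surface_integral (\<lambda>p. f p + g p) = surface_integral f + surface_integral g"
proof -
  have c: "compactin M (support f \<union> support g)"
    using assms by (simp add: compactin_Un test_function_compact)
  obtain n C u where u: "partition_of_unity (support f \<union> support g) n C u"
    using partition_of_unity_exists[OF c] .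
  have s: "support (\<lambda>p. f p + g p) \<subseteq> support f \<union> support g"
    by (rule support_minimal) (simp_all add: closedin_Un closedin_support notin_support)
  have "chart_integral (C j) (\<lambda>p. u j p * (f p + g p))
      = chart_integral (C j) (\<lambda>p. u j p * f p) + chart_integral (C j) (\<lambda>p. u j p * g p)" if "j < n" for j
    unfolding distrib_left
    by (rule chart_integral_add) (use partition_mult[OF _ u that] assms in auto)
  then show ?thesis
    using surface_integral_eq[OF test_function_add[OF assms] u s]
      surface_integral_eq[OF assms(1) u] surface_integral_eq[OF assms(2) u]
    by (simp add: sum.distrib)
qed

lemma surface_integral_cmult:
  assumes "test_function f"
  shows "surface_integral (\<lambda>p. k * f p) = k * surface_integral f"
proof -
  obtain n C u where u: "partition_of_unity (support f) n C u"
    using partition_of_unity_exists[OF test_function_compact[OF assms]] .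
  have "chart_integral (C j) (\<lambda>p. u j p * (k * f p)) = k * chart_integral (C j) (\<lambda>p. u j p * f p)" for j
    by (simp add: mult.left_commute[of _ k] chart_integral_cmult)
  then show ?thesis
    using surface_integral_eq[OF test_function_cmult[OF assms] u support_mult(2)] surface_integral_eq[OF assms u]
    by (simp add: sum_distrib_left)
qed

lemma surface_integral_in_chart:
  assumes "test_function f" "c \<in> A" "support f \<subseteq> fst c"
  shows "surface_integral f = chart_integral c f"
proof -
  obtain n C u where u: "partition_of_unity (support f) n C u"
    using partition_of_unity_exists[OF test_function_compact[OF assms(1)]] .
  have "surface_integral f = (\<Sum>j<n. chart_integral (C j) (\<lambda>p. u j p * f p))"
    by (rule surface_integral_eq[OF assms(1) u]) simp
  also have "\<dots> = (\<Sum>j<n. chart_integral c (\<lambda>p. u j p * f p))"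
    by (intro sum.cong refl chart_integral_change_chart)
      (use partition_mult[OF assms(1) u] order_trans[OF support_mult(2) assms(3)] assms in auto)
  also have "\<dots> = chart_integral c (\<lambda>p. \<Sum>j<n. u j p * f p)"
    by (rule chart_integral_sum[symmetric])
      (use partition_mult[OF assms(1) u] order_trans[OF support_mult(2) assms(3)] assms in auto)
  also have "\<dots> = chart_integral c f"
  proof (rule chart_integral_cong)
    fix p assume "p \<in> fst c"
    then have t: "p \<in> topspace M" using assms chart_subset by blast
    show "(\<Sum>j<n. u j p * f p) = f p"
    proof (cases "p \<in> support f")
      case True
      then have "(\<Sum>j<n. u j p) = 1" using u by (auto simp: partition_of_unity_def)
      then show ?thesis by (simp flip: sum_distrib_right)
    qed (simp add: notin_support t)
  qed
  finally show ?thesis .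
qed

text \<open>With s the sign of \<Omega>_12, the integrand f |\<Omega>_12| is the sum of the partial
  derivatives of s Y^i, because s is locally constant; each of them integrates to zero. Y is a
  family of functions in a single chart, with no transformation law attached.\<close>

lemma surface_integral_divergence:
  assumes "c \<in> A" "test_function f" "compactin M K" "K \<subseteq> fst c"
    "\<And>p i. p \<in> fst c \<Longrightarrow> smooth_at c p (Y i)"
    "\<And>p i. p \<in> fst c \<Longrightarrow> p \<notin> K \<Longrightarrow> Y i p = 0"
    "\<And>p. p \<in> topspace M \<Longrightarrow> p \<notin> K \<Longrightarrow> f p = 0"
    "\<And>p. p \<in> fst c \<Longrightarrow> \<Omega> c p 1 2 * f p = (\<Sum>i\<in>UNIV. pd c i (Y i) p)"
  shows "surface_integral f = 0"
proof -
  let ?S = "snd c ` fst c"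
  have "support f \<subseteq> fst c"
    by (rule order_trans[OF support_minimal[OF closedin_compact[OF assms(3)] assms(7)] assms(4)])
  then have "surface_integral f = chart_integral c f"
    by (rule surface_integral_in_chart[OF assms(2,1)])
  also have "\<dots> = 0"
  proof -
    define W where "W i p = sgn (\<Omega> c p 1 2) * Y i p" for i p
    have sg: "smooth_at c p (\<lambda>q. sgn (\<Omega> c q 1 2))" "pd c i (\<lambda>q. sgn (\<Omega> c q 1 2)) p = 0" if "p \<in> fst c" for p i
      using smooth_at_sgn[OF Omega_smooth Omega_nonzero] assms(1) that by auto
    have W: "smooth_at c p (W i)" "pd c i (W i) p = sgn (\<Omega> c p 1 2) * pd c i (Y i) p" if "p \<in> fst c" for p i
      unfolding W_def using sg assms(5) that by (auto intro: smooth_at_mult simp: pd_mult)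
    have P: "partial i (\<lambda>x. W i (inv_chart c x)) absolutely_integrable_on ?S"
      "integral ?S (partial i (\<lambda>x. W i (inv_chart c x))) = 0" for i
    proof -
      have o: "open ?S" using chart_open assms by blast
      have K: "compact (snd c ` K)" "snd c ` K \<subseteq> ?S"
        using compact_chart_image assms by auto
      have s: "smooth_near x (\<lambda>x. W i (inv_chart c x))" if "x \<in> ?S" for x
        using W(1) that by (auto simp: smooth_at_def)
      have z: "W i (inv_chart c x) = 0" if x: "x \<in> ?S - snd c ` K" for x
      proof -
        obtain p where "p \<in> fst c" "x = snd c p" "p \<notin> K" using x by blast
        then show ?thesis using assms(1,6) by (simp add: W_def)
      qed
      show "partial i (\<lambda>x. W i (inv_chart c x)) absolutely_integrable_on ?S"
        "integral ?S (partial i (\<lambda>x. W i (inv_chart c x))) = 0"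
        using integral_partial_compact_support[OF o K s z] by auto
    qed
    have "chart_integral c f = integral ?S (\<lambda>x. \<Sum>i\<in>UNIV. partial i (\<lambda>x. W i (inv_chart c x)) x)"
      unfolding chart_integral_def
    proof (rule integral_cong)
      fix x assume "x \<in> ?S"
      then obtain p where p: "p \<in> fst c" "x = snd c p" by blast
      have "f p * \<bar>\<Omega> c p 1 2\<bar> = sgn (\<Omega> c p 1 2) * (\<Omega> c p 1 2 * f p)"
        by (simp add: abs_sgn)
      also have "\<dots> = (\<Sum>i\<in>UNIV. pd c i (W i) p)"
        using assms(8)[OF p(1)] W(2)[OF p(1)] by (simp add: sum_distrib_left)
      finally show "f (inv_chart c x) * \<bar>\<Omega> c (inv_chart c x) 1 2\<bar>
          = (\<Sum>i\<in>UNIV. partial i (\<lambda>x. W i (inv_chart c x)) x)"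
        using p assms(1) by (simp add: pd_eq_partial)
    qed
    also have "\<dots> = (\<Sum>i\<in>UNIV. integral ?S (partial i (\<lambda>x. W i (inv_chart c x))))"
      by (rule integral_sum) (use P(1) in \<open>auto simp: absolutely_integrable_on_def\<close>)
    finally show ?thesis using P(2) by simp
  qed
  finally show ?thesis .
qed

end

section \<open>Naturality of the tensor calculus\<close>

text \<open>In the following algebraic lemmas \<open>J\<close> and \<open>H\<close> stand for the first and second
  derivatives of a map in charts, \<open>G\<close> and \<open>G'\<close> for Christoffel symbols in the source and the target,
  and \<open>dT\<close> for the partial derivatives of \<open>T\<close>.\<close>

definition conn_related ::
  "(2 \<Rightarrow> 2 \<Rightarrow> real) \<Rightarrow> (2 \<Rightarrow> 2 \<Rightarrow> 2 \<Rightarrow> real) \<Rightarrow> (2 \<Rightarrow> 2 \<Rightarrow> 2 \<Rightarrow> real) \<Rightarrow> (2 \<Rightarrow> 2 \<Rightarrow> 2 \<Rightarrow> real) \<Rightarrow> bool" where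
  "conn_related J H G G' \<longleftrightarrow> (\<forall>i j m. (\<Sum>k\<in>UNIV. J m k * G i j k) =
     H m i j + (\<Sum>a\<in>UNIV. \<Sum>b\<in>UNIV. J a i * J b j * G' a b m))"

lemma conn_relatedD:
  "conn_related J H G G' \<Longrightarrow> (\<Sum>k\<in>UNIV. J m k * G i j k) =
     H m i j + (\<Sum>a\<in>UNIV. \<Sum>b\<in>UNIV. J a i * J b j * G' a b m)"
  by (simp add: conn_related_def)

text \<open>Differentiating the Jacobians in the transformed tensor produces second derivatives H;
  the inhomogeneous terms of the connection law produce the same ones, and they cancel.\<close>

lemma conn_related_cov_tensor2:
  fixes T' :: "2 \<Rightarrow> 2 \<Rightarrow> real"
  assumes "conn_related J H G G'"
  shows "(\<Sum>a\<in>UNIV. \<Sum>b\<in>UNIV. (H a m i * J b j + J a i * H b m j) * T' a b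
        + J a i * J b j * (\<Sum>e\<in>UNIV. J e m * dT' e a b))
      - (\<Sum>k\<in>UNIV. G m i k * (\<Sum>a\<in>UNIV. \<Sum>b\<in>UNIV. J a k * J b j * T' a b))
      - (\<Sum>k\<in>UNIV. G m j k * (\<Sum>a\<in>UNIV. \<Sum>b\<in>UNIV. J a i * J b k * T' a b))
    = (\<Sum>e\<in>UNIV. \<Sum>a\<in>UNIV. \<Sum>b\<in>UNIV. J e m * J a i * J b j *
        (dT' e a b - (\<Sum>f\<in>UNIV. G' e a f * T' f b) - (\<Sum>f\<in>UNIV. G' e b f * T' a f)))"
proof -
  have 1: "(\<Sum>k\<in>UNIV. G m i k * (\<Sum>a\<in>UNIV. \<Sum>b\<in>UNIV. J a k * J b j * T' a b))
      = (\<Sum>a\<in>UNIV. \<Sum>b\<in>UNIV. (\<Sum>k\<in>UNIV. J a k * G m i k) * J b j * T' a b)"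
    by (simp add: sum_2 algebra_simps)
  have 2: "(\<Sum>k\<in>UNIV. G m j k * (\<Sum>a\<in>UNIV. \<Sum>b\<in>UNIV. J a i * J b k * T' a b))
      = (\<Sum>a\<in>UNIV. \<Sum>b\<in>UNIV. (\<Sum>k\<in>UNIV. J b k * G m j k) * J a i * T' a b)"
    by (simp add: sum_2 algebra_simps)
  show ?thesis
    unfolding 1 2 conn_relatedD[OF assms] by (simp add: sum_2 algebra_simps)
qed

lemma conn_related_cov_vec:
  fixes X :: "2 \<Rightarrow> real"
  assumes "conn_related J H G G'"
    and "(\<Sum>e\<in>UNIV. J e m * dX' e a) = (\<Sum>i\<in>UNIV. H a m i * X i + J a i * dX m i)"
  shows "(\<Sum>k\<in>UNIV. J a k * (dX m k + (\<Sum>b\<in>UNIV. G m b k * X b)))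
    = (\<Sum>e\<in>UNIV. J e m * (dX' e a + (\<Sum>b\<in>UNIV. G' e b a * (\<Sum>i\<in>UNIV. J b i * X i))))"
proof -
  have "(\<Sum>k\<in>UNIV. J a k * (dX m k + (\<Sum>b\<in>UNIV. G m b k * X b)))
    = (\<Sum>k\<in>UNIV. J a k * dX m k) + (\<Sum>b\<in>UNIV. (\<Sum>k\<in>UNIV. J a k * G m b k) * X b)"
    by (simp add: sum_2 algebra_simps)
  also have "\<dots> = (\<Sum>i\<in>UNIV. H a m i * X i + J a i * dX m i)
      + (\<Sum>b\<in>UNIV. (\<Sum>e\<in>UNIV. \<Sum>f\<in>UNIV. J e m * J f b * G' e f a) * X b)"
    unfolding conn_relatedD[OF assms(1)] by (simp add: sum_2 algebra_simps)
  finally show ?thesis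
    unfolding assms(2)[symmetric] by (simp add: sum_2 algebra_simps)
qed

text \<open>A tensor with an upper index is compared by pushing that index forward with J and
  pulling the lower one back with J. Hypothesis \<open>dT\<close> is this relation
  differentiated.\<close>

lemma conn_related_cov_mixed:
  fixes T :: "2 \<Rightarrow> 2 \<Rightarrow> real"
  assumes "conn_related J H G G'"
    and T: "\<And>j a. (\<Sum>k\<in>UNIV. J a k * T j k) = (\<Sum>b\<in>UNIV. J b j * T' b a)"
    and dT: "(\<Sum>k\<in>UNIV. H a m k * T j k + J a k * dT m j k)
      = (\<Sum>b\<in>UNIV. H b m j * T' b a + J b j * (\<Sum>e\<in>UNIV. J e m * dT' e b a))"
  shows "(\<Sum>k\<in>UNIV. J a k * (dT m j k - (\<Sum>n\<in>UNIV. G m j n * T n k) + (\<Sum>n\<in>UNIV. G m n k * T j n)))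
    = (\<Sum>e\<in>UNIV. \<Sum>b\<in>UNIV. J e m * J b j *
        (dT' e b a - (\<Sum>n\<in>UNIV. G' e b n * T' n a) + (\<Sum>n\<in>UNIV. G' e n a * T' b n)))"
proof -
  have "(\<Sum>k\<in>UNIV. J a k * (dT m j k - (\<Sum>n\<in>UNIV. G m j n * T n k) + (\<Sum>n\<in>UNIV. G m n k * T j n)))
    = (\<Sum>k\<in>UNIV. J a k * dT m j k) - (\<Sum>n\<in>UNIV. G m j n * (\<Sum>k\<in>UNIV. J a k * T n k))
      + (\<Sum>n\<in>UNIV. (\<Sum>k\<in>UNIV. J a k * G m n k) * T j n)"
    by (simp add: sum_2 algebra_simps)
  also have "\<dots> = (\<Sum>k\<in>UNIV. J a k * dT m j k) - (\<Sum>b\<in>UNIV. (\<Sum>n\<in>UNIV. J b n * G m j n) * T' b a)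
      + (\<Sum>n\<in>UNIV. (\<Sum>k\<in>UNIV. J a k * G m n k) * T j n)"
    unfolding T by (simp add: sum_2 algebra_simps)
  also have "\<dots> = (\<Sum>k\<in>UNIV. H a m k * T j k + J a k * dT m j k)
      - (\<Sum>b\<in>UNIV. (H b m j + (\<Sum>e\<in>UNIV. \<Sum>f\<in>UNIV. J e m * J f j * G' e f b)) * T' b a)
      + (\<Sum>e\<in>UNIV. \<Sum>f\<in>UNIV. J e m * G' e f a * (\<Sum>n\<in>UNIV. J f n * T j n))"
    unfolding conn_relatedD[OF assms(1)]
    by (simp add: sum_2 algebra_simps)
  finally have e: "(\<Sum>k\<in>UNIV. J a k * (dT m j k - (\<Sum>n\<in>UNIV. G m j n * T n k) + (\<Sum>n\<in>UNIV. G m n k * T j n)))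
      = (\<Sum>k\<in>UNIV. H a m k * T j k + J a k * dT m j k)
      - (\<Sum>b\<in>UNIV. (H b m j + (\<Sum>e\<in>UNIV. \<Sum>f\<in>UNIV. J e m * J f j * G' e f b)) * T' b a)
      + (\<Sum>e\<in>UNIV. \<Sum>f\<in>UNIV. J e m * G' e f a * (\<Sum>n\<in>UNIV. J f n * T j n))" .
  show ?thesis
    unfolding e dT T by (simp add: sum_2 algebra_simps)
qed

lemma conn_related_compose:
  assumes "conn_related J H G G'" "conn_related J' H' G' G''"
    and "\<And>a i. J'' a i = (\<Sum>b\<in>UNIV. J' a b * J b i)"
    and "\<And>a i j. H'' a i j = (\<Sum>b\<in>UNIV. J' a b * H b i j + (\<Sum>f\<in>UNIV. J f i * H' a f b) * J b j)"
  shows "conn_related J'' H'' G G''"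
  unfolding conn_related_def
proof (intro allI)
  fix i j m
  have "(\<Sum>k\<in>UNIV. J'' m k * G i j k) = (\<Sum>b\<in>UNIV. J' m b * (\<Sum>k\<in>UNIV. J b k * G i j k))"
    unfolding assms(3) by (simp add: sum_2 algebra_simps)
  also have "\<dots> = (\<Sum>b\<in>UNIV. J' m b * H b i j)
      + (\<Sum>e\<in>UNIV. \<Sum>f\<in>UNIV. J e i * J f j * (\<Sum>b\<in>UNIV. J' m b * G' e f b))"
    unfolding conn_relatedD[OF assms(1)] by (simp add: sum_2 algebra_simps)
  also have "\<dots> = H'' m i j + (\<Sum>a\<in>UNIV. \<Sum>b\<in>UNIV. J'' a i * J'' b j * G'' a b m)"
    unfolding conn_relatedD[OF assms(2)] assms(3,4) by (simp add: sum_2 algebra_simps)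
  finally show "(\<Sum>k\<in>UNIV. J'' m k * G i j k) = H'' m i j + (\<Sum>a\<in>UNIV. \<Sum>b\<in>UNIV. J'' a i * J'' b j * G'' a b m)" .
qed

lemma left_inverse_apply:
  fixes y :: "2 \<Rightarrow> real" and J K :: "2 \<Rightarrow> 2 \<Rightarrow> real"
  assumes "\<And>k i. (\<Sum>m\<in>UNIV. K k m * J m i) = (if k = i then 1 else 0)"
  shows "(\<Sum>m\<in>UNIV. K k m * (\<Sum>i\<in>UNIV. J m i * y i)) = y k"
proof -
  have "(\<Sum>m\<in>UNIV. K k m * (\<Sum>i\<in>UNIV. J m i * y i)) = (\<Sum>i\<in>UNIV. (\<Sum>m\<in>UNIV. K k m * J m i) * y i)"
    by (simp add: sum_2 algebra_simps)
  also have "\<dots> = y k"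
    unfolding assms by (simp add: if_distrib[of "\<lambda>x. x * _"] cong: if_cong)
  finally show ?thesis .
qed

lemma two_by_two_inverse:
  fixes J K :: "2 \<Rightarrow> 2 \<Rightarrow> real"
  assumes "\<And>k i. (\<Sum>m\<in>UNIV. K k m * J m i) = (if k = i then 1 else 0)"
  shows "(\<Sum>m\<in>UNIV. J k m * K m i) = (if k = i then 1 else 0)"
    and "J 1 1 * J 2 2 - J 2 1 * J 1 2 \<noteq> 0"
proof -
  have "((\<chi> i j. K i j) :: real^2^2) ** (\<chi> i j. J i j) = mat 1"
    using assms by (simp add: matrix_matrix_mult_def mat_def vec_eq_iff)
  then have "((\<chi> i j. J i j) :: real^2^2) ** (\<chi> i j. K i j) = mat 1"
    using matrix_left_right_inverse by blast
  then show "(\<Sum>m\<in>UNIV. J k m * K m i) = (if k = i then 1 else 0)"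
    by (simp add: matrix_matrix_mult_def mat_def vec_eq_iff)
  have e: "K 1 1 * J 1 1 + K 1 2 * J 2 1 = 1" "K 1 1 * J 1 2 + K 1 2 * J 2 2 = 0"
    "K 2 1 * J 1 1 + K 2 2 * J 2 1 = 0" "K 2 1 * J 1 2 + K 2 2 * J 2 2 = 1"
    using assms[of 1 1] assms[of 1 2] assms[of 2 1] assms[of 2 2] by (simp_all add: sum_2)
  have "(K 1 1 * K 2 2 - K 2 1 * K 1 2) * (J 1 1 * J 2 2 - J 2 1 * J 1 2)
    = (K 1 1 * J 1 1 + K 1 2 * J 2 1) * (K 2 1 * J 1 2 + K 2 2 * J 2 2)
      - (K 1 1 * J 1 2 + K 1 2 * J 2 2) * (K 2 1 * J 1 1 + K 2 2 * J 2 1)"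
    by (simp add: algebra_simps)
  also have "\<dots> = 1" unfolding e by simp
  finally show "J 1 1 * J 2 2 - J 2 1 * J 1 2 \<noteq> 0" by auto
qed

lemma conn_related_unique:
  assumes "conn_related J H G1 G'" "conn_related J H G2 G'"
    and "\<And>k i. (\<Sum>m\<in>UNIV. K k m * J m i) = (if k = i then 1 else 0)"
  shows "G1 = G2"
proof (intro ext)
  fix i j k
  have "(\<Sum>m\<in>UNIV. K k m * (\<Sum>n\<in>UNIV. J m n * G1 i j n)) = (\<Sum>m\<in>UNIV. K k m * (\<Sum>n\<in>UNIV. J m n * G2 i j n))"
    by (simp add: conn_relatedD[OF assms(1)] conn_relatedD[OF assms(2)])
  then show "G1 i j k = G2 i j k"
    by (simp add: left_inverse_apply[OF assms(3)])
qed

section \<open>Smoothness and coordinate formulas of covariant derivatives and curvature\<close>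

context smooth_surface
begin

lemma smooth_at_cov_vec:
  assumes "c \<in> A" "p \<in> fst c" "\<And>k. smooth_at c p (\<lambda>q. X c q k)" "\<And>i j k. smooth_at c p (\<lambda>q. \<Gamma> c q i j k)"
  shows "smooth_at c p (\<lambda>q. cov_vec \<Gamma> X c q m k)"
  unfolding cov_vec_def using assms
  by (intro smooth_at_add smooth_at_sum smooth_at_mult smooth_at_pd) auto

lemma smooth_at_hess_vec:
  assumes "c \<in> A" "p \<in> fst c" "\<And>k. smooth_at c p (\<lambda>q. X c q k)" "\<And>i j k. smooth_at c p (\<lambda>q. \<Gamma> c q i j k)"
  shows "smooth_at c p (\<lambda>q. hess_vec \<Gamma> X c q i j k)"
  unfolding hess_vec_def cov_mixed_def using assms
  by (intro smooth_at_add smooth_at_diff smooth_at_sum smooth_at_mult smooth_at_pd smooth_at_cov_vec) auto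

lemma smooth_at_frame: "c \<in> A \<Longrightarrow> p \<in> fst c \<Longrightarrow> smooth_at c p (\<lambda>q. frame a c q k)"
  by (simp add: frame_def smooth_at_const)

lemma smooth_at_curv:
  assumes "c \<in> A" "p \<in> fst c" "\<And>i j k. smooth_at c p (\<lambda>q. \<Gamma> c q i j k)"
  shows "smooth_at c p (\<lambda>q. curv \<Gamma> c q i j a k)"
  unfolding curv_def using assms
  by (intro smooth_at_diff smooth_at_hess_vec smooth_at_frame) auto

lemma smooth_at_ricci:
  assumes "c \<in> A" "p \<in> fst c" "\<And>i j k. smooth_at c p (\<lambda>q. \<Gamma> c q i j k)"
  shows "smooth_at c p (\<lambda>q. ricci \<Gamma> c q i j)"
  unfolding ricci_def using assms
  by (intro smooth_at_sum smooth_at_curv) auto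

lemma smooth_at_cov_tensor2:
  assumes "c \<in> A" "p \<in> fst c" "\<And>i j. smooth_at c p (\<lambda>q. T c q i j)" "\<And>i j k. smooth_at c p (\<lambda>q. \<Gamma> c q i j k)"
  shows "smooth_at c p (\<lambda>q. cov_tensor2 \<Gamma> T c q m i j)"
  unfolding cov_tensor2_def using assms
  by (intro smooth_at_diff smooth_at_sum smooth_at_mult smooth_at_pd) auto

lemma smooth_at_lie_conn:
  assumes "c \<in> A" "p \<in> fst c" "\<And>k. smooth_at c p (\<lambda>q. X c q k)" "\<And>i j k. smooth_at c p (\<lambda>q. \<Gamma> c q i j k)"
  shows "smooth_at c p (\<lambda>q. lie_conn X \<Gamma> c q i j k)"
  unfolding lie_conn_def using assms
  by (intro smooth_at_add smooth_at_sum smooth_at_mult smooth_at_hess_vec smooth_at_curv) auto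

lemma pd_cov_vec:
  assumes "c \<in> A" "p \<in> fst c" "\<And>k. smooth_at c p (\<lambda>q. X c q k)" "\<And>i j k. smooth_at c p (\<lambda>q. \<Gamma> c q i j k)"
  shows "pd c i (\<lambda>q. cov_vec \<Gamma> X c q j k) p = pd c i (pd c j (\<lambda>q. X c q k)) p
    + (\<Sum>a\<in>UNIV. \<Gamma> c p j a k * pd c i (\<lambda>q. X c q a) p + pd c i (\<lambda>q. \<Gamma> c q j a k) p * X c p a)"
  unfolding cov_vec_def using assms
  by (simp add: pd_add pd_sum pd_mult smooth_at_pd smooth_at_sum smooth_at_mult)

text \<open>Commuting partial derivatives remove the second derivatives of X and vanishing torsion
  removes the first ones, so what remains is linear in the value of X at p.\<close>

lemma hess_vec_antisym:
  assumes "c \<in> A" "p \<in> fst c" "\<And>k. smooth_at c p (\<lambda>q. X c q k)" "\<And>i j k. smooth_at c p (\<lambda>q. \<Gamma> c q i j k)"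
    "\<And>i j k. \<Gamma> c p i j k = \<Gamma> c p j i k"
  shows "hess_vec \<Gamma> X c p i j k - hess_vec \<Gamma> X c p j i k
    = (\<Sum>a\<in>UNIV. X c p a * (pd c i (\<lambda>q. \<Gamma> c q j a k) p - pd c j (\<lambda>q. \<Gamma> c q i a k) p
        + (\<Sum>n\<in>UNIV. \<Gamma> c p i n k * \<Gamma> c p j a n - \<Gamma> c p j n k * \<Gamma> c p i a n)))"
  unfolding hess_vec_def cov_mixed_def
  using pd_cov_vec[where X = X and \<Gamma> = \<Gamma>, OF assms(1-4)] pd_commute[OF assms(3)[of k], of i j] assms(5)[of i j]
  by (simp add: cov_vec_def sum_2 algebra_simps)

lemma curv_formula:
  assumes "c \<in> A" "p \<in> fst c" "\<And>i j k. smooth_at c p (\<lambda>q. \<Gamma> c q i j k)"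
    "\<And>i j k. \<Gamma> c p i j k = \<Gamma> c p j i k"
  shows "curv \<Gamma> c p i j a k = pd c i (\<lambda>q. \<Gamma> c q j a k) p - pd c j (\<lambda>q. \<Gamma> c q i a k) p
        + (\<Sum>n\<in>UNIV. \<Gamma> c p i n k * \<Gamma> c p j a n - \<Gamma> c p j n k * \<Gamma> c p i a n)"
  unfolding curv_def
  by (subst hess_vec_antisym) (use assms smooth_at_frame in \<open>auto simp: frame_def if_distrib[of "\<lambda>x. x * _"] cong: if_cong\<close>)

text \<open>\<open>curv\<close> is defined through coordinate frames only; the identity for general
  X is what allows frames to be replaced by fields adapted to a map in the proof of
  naturality.\<close>

lemma ricci_identity:
  assumes "c \<in> A" "p \<in> fst c" "\<And>k. smooth_at c p (\<lambda>q. X c q k)" "\<And>i j k. smooth_at c p (\<lambda>q. \<Gamma> c q i j k)"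
    "\<And>i j k. \<Gamma> c p i j k = \<Gamma> c p j i k"
  shows "hess_vec \<Gamma> X c p i j k - hess_vec \<Gamma> X c p j i k = (\<Sum>a\<in>UNIV. X c p a * curv \<Gamma> c p i j a k)"
  using hess_vec_antisym[where X = X and \<Gamma> = \<Gamma>, OF assms] curv_formula[where \<Gamma> = \<Gamma>, OF assms(1,2,4,5)] by simp

end

text \<open>The common setting for a change of chart, where both maps are the identity, and for a
  diffeomorphism with its inverse, each seen through one source chart and one target chart.\<close>

locale chart_map = smooth_surface M A for M :: "'a topology" and A :: "'a chart set" +
  fixes \<phi> \<psi> :: "'a \<Rightarrow> 'a" and c d :: "'a chart"
  assumes smooth_maps: "smooth_map \<phi>" "smooth_map \<psi>"
    and left_inverse: "\<And>q. q \<in> topspace M \<Longrightarrow> \<psi> (\<phi> q) = q"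
    and charts: "c \<in> A" "d \<in> A"
begin

abbreviation "Dom \<equiv> {q \<in> fst c. \<phi> q \<in> fst d}"
abbreviation "J \<equiv> D1 \<phi> c d"
abbreviation "H \<equiv> D2 \<phi> c d"
abbreviation "K q \<equiv> D1 \<psi> d c (\<phi> q)"

lemma openin_Dom: "openin M Dom"
  by (rule openin_preimage[OF smooth_map_continuous[OF smooth_maps(1)] charts])

lemma KJ: "q \<in> Dom \<Longrightarrow> (\<Sum>m\<in>UNIV. K q k m * J q m i) = (if k = i then 1 else 0)"
  by (rule D1_inverse) (use smooth_maps left_inverse charts in auto)

lemma JK: "q \<in> Dom \<Longrightarrow> (\<Sum>m\<in>UNIV. J q k m * K q m i) = (if k = i then 1 else 0)"
  using two_by_two_inverse(1)[OF KJ] by blast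

lemma det_J: "q \<in> Dom \<Longrightarrow> J q 1 1 * J q 2 2 - J q 2 1 * J q 1 2 \<noteq> 0"
  using two_by_two_inverse(2)[OF KJ] by blast

lemma smooth_J: "q \<in> Dom \<Longrightarrow> smooth_at c q (\<lambda>q. J q a i)"
  by (rule smooth_at_D1) (use smooth_maps charts in auto)

lemma pd_J: "pd c i (\<lambda>q. J q a j) q = H q a i j"
  by (simp add: D2_def)

lemma H_sym: "q \<in> Dom \<Longrightarrow> H q a i j = H q a j i"
  by (rule D2_sym) (use smooth_maps charts in auto)

lemma smooth_pull: "q \<in> Dom \<Longrightarrow> smooth_at d (\<phi> q) f \<Longrightarrow> smooth_at c q (\<lambda>q. f (\<phi> q))"
  using smooth_at_compose(1)[OF smooth_maps(1) charts(1)] by blast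

lemma pd_pull:
  "q \<in> Dom \<Longrightarrow> smooth_at d (\<phi> q) f \<Longrightarrow> pd c i (\<lambda>q. f (\<phi> q)) q = (\<Sum>e\<in>UNIV. J q e i * pd d e f (\<phi> q))"
  using smooth_at_compose(2)[OF smooth_maps(1) charts(1)] by blast

lemma smooth_K: "q \<in> Dom \<Longrightarrow> smooth_at c q (\<lambda>q. K q k m)"
  by (rule smooth_pull, assumption, rule smooth_at_D1)
    (use smooth_maps charts left_inverse chart_subset[OF charts(1)] in auto)

lemma smooth_H: "q \<in> Dom \<Longrightarrow> smooth_at c q (\<lambda>q. H q a i j)"
  by (rule smooth_at_D2) (use smooth_maps charts in auto)

text \<open>\<open>conn_related\<close> is the transformation law multiplied by the Jacobian. The
  inverse Jacobian K appears only here, in the passage to the solved form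
  \<open>tr_conn\<close>.\<close>

lemma conn_related_iff_tr_conn:
  assumes "q \<in> Dom"
  shows "conn_related (J q) (H q) (\<Gamma> c q) (\<Gamma>' d (\<phi> q)) \<longleftrightarrow> \<Gamma> c q = tr_conn \<phi> \<psi> c d \<Gamma>' q"
proof
  assume *: "conn_related (J q) (H q) (\<Gamma> c q) (\<Gamma>' d (\<phi> q))"
  show "\<Gamma> c q = tr_conn \<phi> \<psi> c d \<Gamma>' q"
  proof (intro ext)
    fix i j k
    show "\<Gamma> c q i j k = tr_conn \<phi> \<psi> c d \<Gamma>' q i j k"
      unfolding tr_conn_def conn_relatedD[OF *, symmetric]
      by (rule left_inverse_apply[OF KJ[OF assms], symmetric])
  qed
next
  assume *: "\<Gamma> c q = tr_conn \<phi> \<psi> c d \<Gamma>' q"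
  show "conn_related (J q) (H q) (\<Gamma> c q) (\<Gamma>' d (\<phi> q))"
    unfolding conn_related_def * tr_conn_def
    by (simp add: left_inverse_apply[OF JK[OF assms]])
qed

lemma cov_tensor2_natural:
  assumes "p \<in> Dom" "conn_related (J p) (H p) (\<Gamma> c p) (\<Gamma>' d (\<phi> p))"
    and T: "\<And>q i j. q \<in> Dom \<Longrightarrow> T c q i j = (\<Sum>a\<in>UNIV. \<Sum>b\<in>UNIV. J q a i * J q b j * T' d (\<phi> q) a b)"
    and s: "\<And>a b. smooth_at d (\<phi> p) (\<lambda>q. T' d q a b)"
  shows "cov_tensor2 \<Gamma> T c p m i j =
    (\<Sum>e\<in>UNIV. \<Sum>a\<in>UNIV. \<Sum>b\<in>UNIV. J p e m * J p a i * J p b j * cov_tensor2 \<Gamma>' T' d (\<phi> p) e a b)"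
proof -
  have p: "p \<in> fst c" using assms(1) by simp
  have "pd c m (\<lambda>q. T c q i j) p
      = pd c m (\<lambda>q. \<Sum>a\<in>UNIV. \<Sum>b\<in>UNIV. J q a i * J q b j * T' d (\<phi> q) a b) p"
    by (rule pd_cong[OF charts(1) p openin_Dom assms(1)]) (rule T)
  also have "\<dots> = (\<Sum>a\<in>UNIV. \<Sum>b\<in>UNIV. (H p a m i * J p b j + J p a i * H p b m j) * T' d (\<phi> p) a b
        + J p a i * J p b j * (\<Sum>e\<in>UNIV. J p e m * pd d e (\<lambda>q. T' d q a b) (\<phi> p)))"
    using charts(1) p smooth_J[OF assms(1)] smooth_pull[OF assms(1) s] pd_pull[OF assms(1) s]
    by (simp add: pd_sum pd_mult smooth_at_sum smooth_at_mult pd_J add.commute)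
  finally show ?thesis
    unfolding cov_tensor2_def T[OF assms(1)]
    using conn_related_cov_tensor2[OF assms(2)] by simp
qed

lemma cov_vec_natural:
  assumes "p \<in> Dom" "conn_related (J p) (H p) (\<Gamma> c p) (\<Gamma>' d (\<phi> p))"
    and X: "\<And>q a. q \<in> Dom \<Longrightarrow> X' d (\<phi> q) a = (\<Sum>i\<in>UNIV. J q a i * X c q i)"
    and s: "\<And>k. smooth_at c p (\<lambda>q. X c q k)" and s': "\<And>a. smooth_at d (\<phi> p) (\<lambda>q. X' d q a)"
  shows "(\<Sum>k\<in>UNIV. J p a k * cov_vec \<Gamma> X c p m k) = (\<Sum>e\<in>UNIV. J p e m * cov_vec \<Gamma>' X' d (\<phi> p) e a)"
proof -
  have p: "p \<in> fst c" using assms(1) by simp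
  have "(\<Sum>e\<in>UNIV. J p e m * pd d e (\<lambda>q. X' d q a) (\<phi> p)) = pd c m (\<lambda>q. X' d (\<phi> q) a) p"
    using pd_pull[OF assms(1) s'] by simp
  also have "\<dots> = pd c m (\<lambda>q. \<Sum>i\<in>UNIV. J q a i * X c q i) p"
    by (rule pd_cong[OF charts(1) p openin_Dom assms(1)]) (rule X)
  also have "\<dots> = (\<Sum>i\<in>UNIV. H p a m i * X c p i + J p a i * pd c m (\<lambda>q. X c q i) p)"
    using charts(1) p smooth_J[OF assms(1)] s
    by (simp add: pd_sum pd_mult smooth_at_mult pd_J add.commute)
  finally show ?thesis
    unfolding cov_vec_def X[OF assms(1)]
    by (rule conn_related_cov_vec[OF assms(2)])
qed

lemma cov_mixed_natural:
  assumes "p \<in> Dom" "conn_related (J p) (H p) (\<Gamma> c p) (\<Gamma>' d (\<phi> p))"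
    and T: "\<And>q j a. q \<in> Dom \<Longrightarrow> (\<Sum>k\<in>UNIV. J q a k * T c q j k) = (\<Sum>b\<in>UNIV. J q b j * T' d (\<phi> q) b a)"
    and s: "\<And>j k. smooth_at c p (\<lambda>q. T c q j k)" and s': "\<And>a b. smooth_at d (\<phi> p) (\<lambda>q. T' d q a b)"
  shows "(\<Sum>k\<in>UNIV. J p a k * cov_mixed \<Gamma> T c p m j k)
    = (\<Sum>e\<in>UNIV. \<Sum>b\<in>UNIV. J p e m * J p b j * cov_mixed \<Gamma>' T' d (\<phi> p) e b a)"
proof -
  have p: "p \<in> fst c" using assms(1) by simp
  have "(\<Sum>k\<in>UNIV. H p a m k * T c p j k + J p a k * pd c m (\<lambda>q. T c q j k) p)
      = pd c m (\<lambda>q. \<Sum>k\<in>UNIV. J q a k * T c q j k) p"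
    using charts(1) p smooth_J[OF assms(1)] s
    by (simp add: pd_sum pd_mult smooth_at_mult pd_J add.commute)
  also have "\<dots> = pd c m (\<lambda>q. \<Sum>b\<in>UNIV. J q b j * T' d (\<phi> q) b a) p"
    by (rule pd_cong[OF charts(1) p openin_Dom assms(1)]) (rule T)
  also have "\<dots> = (\<Sum>b\<in>UNIV. H p b m j * T' d (\<phi> p) b a
      + J p b j * (\<Sum>e\<in>UNIV. J p e m * pd d e (\<lambda>q. T' d q b a) (\<phi> p)))"
    using charts(1) p smooth_J[OF assms(1)] smooth_pull[OF assms(1) s'] pd_pull[OF assms(1) s']
    by (simp add: pd_sum pd_mult smooth_at_mult pd_J add.commute)
  finally show ?thesis
    unfolding cov_mixed_def
    by (rule conn_related_cov_mixed[OF assms(2) T[OF assms(1)]])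
qed

lemma hess_vec_natural:
  assumes p: "p \<in> Dom" and rel: "\<And>q. q \<in> Dom \<Longrightarrow> conn_related (J q) (H q) (\<Gamma> c q) (\<Gamma>' d (\<phi> q))"
    and X: "\<And>q a. q \<in> Dom \<Longrightarrow> X' d (\<phi> q) a = (\<Sum>i\<in>UNIV. J q a i * X c q i)"
    and s: "\<And>q k. q \<in> Dom \<Longrightarrow> smooth_at c q (\<lambda>q. X c q k)"
    and s': "\<And>q a. q \<in> Dom \<Longrightarrow> smooth_at d (\<phi> q) (\<lambda>q. X' d q a)"
    and g: "\<And>i j k. smooth_at c p (\<lambda>q. \<Gamma> c q i j k)"
    and g': "\<And>i j k. smooth_at d (\<phi> p) (\<lambda>q. \<Gamma>' d q i j k)"
  shows "(\<Sum>k\<in>UNIV. J p a k * hess_vec \<Gamma> X c p i j k)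
    = (\<Sum>e\<in>UNIV. \<Sum>b\<in>UNIV. J p e i * J p b j * hess_vec \<Gamma>' X' d (\<phi> p) e b a)"
  unfolding hess_vec_def
proof (rule cov_mixed_natural[where \<Gamma> = \<Gamma> and \<Gamma>' = \<Gamma>', OF p rel[OF p]])
  show "(\<Sum>k\<in>UNIV. J q a k * cov_vec \<Gamma> X c q j k) = (\<Sum>b\<in>UNIV. J q b j * cov_vec \<Gamma>' X' d (\<phi> q) b a)"
    if "q \<in> Dom" for q j a
    by (rule cov_vec_natural[where \<Gamma> = \<Gamma> and \<Gamma>' = \<Gamma>' and X = X and X' = X', OF that rel[OF that] X s[OF that] s'[OF that]])
  show "smooth_at c p (\<lambda>q. cov_vec \<Gamma> X c q j k)" for j k
    using smooth_at_cov_vec charts(1) p s g by blast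
  show "smooth_at d (\<phi> p) (\<lambda>q. cov_vec \<Gamma>' X' d q a b)" for a b
    using smooth_at_cov_vec charts(2) p s' g' by blast
qed

text \<open>A coordinate frame of one chart is not one of the other. The argument uses a pair of
  \<phi>-related fields that agree with the frame at p, applies the Ricci identity on both sides and
  subtracts the two naturality statements for the Hessian.\<close>

lemma curv_natural:
  assumes p: "p \<in> Dom" and rel: "\<And>q. q \<in> Dom \<Longrightarrow> conn_related (J q) (H q) (\<Gamma> c q) (\<Gamma>' d (\<phi> q))"
    and g: "\<And>i j k. smooth_at c p (\<lambda>q. \<Gamma> c q i j k)"
    and g': "\<And>i j k. smooth_at d (\<phi> p) (\<lambda>q. \<Gamma>' d q i j k)"
    and sym: "\<And>i j k. \<Gamma> c p i j k = \<Gamma> c p j i k" "\<And>i j k. \<Gamma>' d (\<phi> p) i j k = \<Gamma>' d (\<phi> p) j i k"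
  shows "(\<Sum>k\<in>UNIV. J p f k * curv \<Gamma> c p i j n k)
    = (\<Sum>e\<in>UNIV. \<Sum>b\<in>UNIV. \<Sum>g\<in>UNIV. J p e i * J p b j * J p g n * curv \<Gamma>' d (\<phi> p) e b g f)"
proof -
  have pc: "p \<in> fst c" "\<phi> p \<in> fst d" using p by auto
  define X' :: "'a field1" where "X' = (\<lambda>e q a. J p a n)"
  \<comment> \<open>X' has constant components in the target; X is its pullback by the inverse
    Jacobian, related to X' on the whole of \<open>Dom\<close> as the second derivatives require,
    and equal to the frame vector n at p.\<close>
  define X :: "'a field1" where "X = (\<lambda>e q k. \<Sum>m\<in>UNIV. K q k m * J p m n)"
  have sX: "smooth_at c q (\<lambda>q. X c q k)" if "q \<in> Dom" for q k
    unfolding X_def using that smooth_K[OF that] charts(1)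
    by (intro smooth_at_sum smooth_at_mult smooth_at_const) auto
  have sX': "smooth_at d (\<phi> q) (\<lambda>q. X' d q a)" if "q \<in> Dom" for q a
    unfolding X'_def using that charts(2) by (intro smooth_at_const) auto
  have XX: "X' d (\<phi> q) a = (\<Sum>i\<in>UNIV. J q a i * X c q i)" if "q \<in> Dom" for q a
    unfolding X_def X'_def by (rule left_inverse_apply[OF JK[OF that], symmetric])
  have Xp: "X c p k = (if k = n then 1 else 0)" for k
    unfolding X_def by (rule KJ[OF p])
  have h: "(\<Sum>k\<in>UNIV. J p f k * hess_vec \<Gamma> X c p i j k)
    = (\<Sum>e\<in>UNIV. \<Sum>b\<in>UNIV. J p e i * J p b j * hess_vec \<Gamma>' X' d (\<phi> p) e b f)" for i j
    by (rule hess_vec_natural[where \<Gamma> = \<Gamma> and \<Gamma>' = \<Gamma>' and X = X and X' = X', OF p rel XX sX sX' g g'])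
  have r: "hess_vec \<Gamma> X c p i j k - hess_vec \<Gamma> X c p j i k = curv \<Gamma> c p i j n k" for i j k
    using ricci_identity[where X = X and \<Gamma> = \<Gamma>, OF charts(1) pc(1) sX[OF p] g sym(1)]
    by (simp add: Xp if_distrib[of "\<lambda>x. x * _"] cong: if_cong)
  have r': "hess_vec \<Gamma>' X' d (\<phi> p) e b f - hess_vec \<Gamma>' X' d (\<phi> p) b e f
      = (\<Sum>g\<in>UNIV. J p g n * curv \<Gamma>' d (\<phi> p) e b g f)" for e b f
    using ricci_identity[where X = X' and \<Gamma> = \<Gamma>', OF charts(2) pc(2) sX'[OF p] g' sym(2)]
    by (simp add: X'_def)
  have "(\<Sum>k\<in>UNIV. J p f k * curv \<Gamma> c p i j n k)
      = (\<Sum>k\<in>UNIV. J p f k * hess_vec \<Gamma> X c p i j k) - (\<Sum>k\<in>UNIV. J p f k * hess_vec \<Gamma> X c p j i k)"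
    unfolding r[symmetric] by (simp add: sum_2 algebra_simps)
  also have "\<dots> = (\<Sum>e\<in>UNIV. \<Sum>b\<in>UNIV. J p e i * J p b j *
      (hess_vec \<Gamma>' X' d (\<phi> p) e b f - hess_vec \<Gamma>' X' d (\<phi> p) b e f))"
    unfolding h by (simp add: sum_2 algebra_simps)
  also have "\<dots> = (\<Sum>e\<in>UNIV. \<Sum>b\<in>UNIV. \<Sum>g\<in>UNIV. J p e i * J p b j * J p g n * curv \<Gamma>' d (\<phi> p) e b g f)"
    unfolding r' by (simp add: sum_distrib_left mult.assoc)
  finally show ?thesis .
qed

lemma ricci_natural:
  assumes p: "p \<in> Dom" and rel: "\<And>q. q \<in> Dom \<Longrightarrow> conn_related (J q) (H q) (\<Gamma> c q) (\<Gamma>' d (\<phi> q))"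
    and g: "\<And>i j k. smooth_at c p (\<lambda>q. \<Gamma> c q i j k)"
    and g': "\<And>i j k. smooth_at d (\<phi> p) (\<lambda>q. \<Gamma>' d q i j k)"
    and sym: "\<And>i j k. \<Gamma> c p i j k = \<Gamma> c p j i k" "\<And>i j k. \<Gamma>' d (\<phi> p) i j k = \<Gamma>' d (\<phi> p) j i k"
  shows "ricci \<Gamma> c p i j = (\<Sum>a\<in>UNIV. \<Sum>b\<in>UNIV. J p a i * J p b j * ricci \<Gamma>' d (\<phi> p) a b)"
proof -
  have cn: "(\<Sum>k\<in>UNIV. J p f k * curv \<Gamma> c p i j n k)
      = (\<Sum>e\<in>UNIV. \<Sum>b\<in>UNIV. \<Sum>g\<in>UNIV. J p e i * J p b j * J p g n * curv \<Gamma>' d (\<phi> p) e b g f)" for f i j n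
    by (rule curv_natural[where \<Gamma> = \<Gamma> and \<Gamma>' = \<Gamma>', OF p rel g g' sym])
  \<comment> \<open>The identity K J is inserted before the trace so that the upper index of the
    curvature can be pushed forward; afterwards J K collapses in the target.\<close>
  have "ricci \<Gamma> c p i j = (\<Sum>m\<in>UNIV. \<Sum>f\<in>UNIV. K p m f * (\<Sum>k\<in>UNIV. J p f k * curv \<Gamma> c p m i j k))"
    by (simp add: ricci_def left_inverse_apply[OF KJ[OF p]])
  also have "\<dots> = (\<Sum>m\<in>UNIV. \<Sum>f\<in>UNIV. K p m f * (\<Sum>e\<in>UNIV. \<Sum>b\<in>UNIV. \<Sum>g\<in>UNIV.
      J p e m * J p b i * J p g j * curv \<Gamma>' d (\<phi> p) e b g f))"
    unfolding cn ..
  also have "\<dots> = (\<Sum>e\<in>UNIV. \<Sum>f\<in>UNIV. (\<Sum>m\<in>UNIV. J p e m * K p m f) *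
      (\<Sum>b\<in>UNIV. \<Sum>g\<in>UNIV. J p b i * J p g j * curv \<Gamma>' d (\<phi> p) e b g f))"
    by (simp add: sum_2 algebra_simps)
  also have "\<dots> = (\<Sum>e\<in>UNIV. \<Sum>b\<in>UNIV. \<Sum>g\<in>UNIV. J p b i * J p g j * curv \<Gamma>' d (\<phi> p) e b g e)"
    unfolding JK[OF p] by (simp add: if_distrib[of "\<lambda>x. x * _"] cong: if_cong)
  also have "\<dots> = (\<Sum>a\<in>UNIV. \<Sum>b\<in>UNIV. J p a i * J p b j * ricci \<Gamma>' d (\<phi> p) a b)"
    unfolding ricci_def by (simp add: sum_2 algebra_simps)
  finally show ?thesis .
qed

lemma lie_conn_natural:
  assumes p: "p \<in> Dom" and rel: "\<And>q. q \<in> Dom \<Longrightarrow> conn_related (J q) (H q) (\<Gamma> c q) (\<Gamma>' d (\<phi> q))"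
    and X: "\<And>q a. q \<in> Dom \<Longrightarrow> X' d (\<phi> q) a = (\<Sum>i\<in>UNIV. J q a i * X c q i)"
    and s: "\<And>q k. q \<in> Dom \<Longrightarrow> smooth_at c q (\<lambda>q. X c q k)"
    and s': "\<And>q a. q \<in> Dom \<Longrightarrow> smooth_at d (\<phi> q) (\<lambda>q. X' d q a)"
    and g: "\<And>i j k. smooth_at c p (\<lambda>q. \<Gamma> c q i j k)"
    and g': "\<And>i j k. smooth_at d (\<phi> p) (\<lambda>q. \<Gamma>' d q i j k)"
    and sym: "\<And>i j k. \<Gamma> c p i j k = \<Gamma> c p j i k" "\<And>i j k. \<Gamma>' d (\<phi> p) i j k = \<Gamma>' d (\<phi> p) j i k"
  shows "(\<Sum>k\<in>UNIV. J p f k * lie_conn X \<Gamma> c p i j k)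
    = (\<Sum>e\<in>UNIV. \<Sum>b\<in>UNIV. J p e i * J p b j * lie_conn X' \<Gamma>' d (\<phi> p) e b f)"
proof -
  have cn: "(\<Sum>k\<in>UNIV. J p f k * curv \<Gamma> c p i j n k)
      = (\<Sum>e\<in>UNIV. \<Sum>b\<in>UNIV. \<Sum>g\<in>UNIV. J p e i * J p b j * J p g n * curv \<Gamma>' d (\<phi> p) e b g f)" for f i j n
    by (rule curv_natural[where \<Gamma> = \<Gamma> and \<Gamma>' = \<Gamma>', OF p rel g g' sym])
  have hn: "(\<Sum>k\<in>UNIV. J p f k * hess_vec \<Gamma> X c p i j k)
      = (\<Sum>e\<in>UNIV. \<Sum>b\<in>UNIV. J p e i * J p b j * hess_vec \<Gamma>' X' d (\<phi> p) e b f)"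
    by (rule hess_vec_natural[where \<Gamma> = \<Gamma> and \<Gamma>' = \<Gamma>' and X = X and X' = X', OF p rel X s s' g g'])
  have "(\<Sum>k\<in>UNIV. J p f k * lie_conn X \<Gamma> c p i j k) = (\<Sum>k\<in>UNIV. J p f k * hess_vec \<Gamma> X c p i j k)
      + (\<Sum>m\<in>UNIV. X c p m * (\<Sum>k\<in>UNIV. J p f k * curv \<Gamma> c p m i j k))"
    unfolding lie_conn_def by (simp add: sum_2 algebra_simps)
  also have "\<dots> = (\<Sum>e\<in>UNIV. \<Sum>b\<in>UNIV. J p e i * J p b j * hess_vec \<Gamma>' X' d (\<phi> p) e b f)
      + (\<Sum>m\<in>UNIV. X c p m * (\<Sum>e\<in>UNIV. \<Sum>b\<in>UNIV. \<Sum>g\<in>UNIV.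
          J p e m * J p b i * J p g j * curv \<Gamma>' d (\<phi> p) e b g f))"
    unfolding cn hn ..
  also have "\<dots> = (\<Sum>e\<in>UNIV. \<Sum>b\<in>UNIV. J p e i * J p b j * lie_conn X' \<Gamma>' d (\<phi> p) e b f)"
    unfolding lie_conn_def X[OF p] by (simp add: sum_2 algebra_simps)
  finally show ?thesis .
qed

end

section \<open>The curvature one-form and its class\<close>

lemma (in smooth_surface) chart_map_id:
  "c \<in> A \<Longrightarrow> d \<in> A \<Longrightarrow> chart_map M A id id c d"
  by unfold_locales (auto simp: smooth_map_id)

lemma (in smooth_surface) tr2_compose:
  assumes "smooth_map \<phi>" "smooth_map \<theta>" "c \<in> A" "e \<in> A" "d \<in> A"
    "p \<in> fst c" "\<phi> p \<in> fst e" "\<theta> (\<phi> p) \<in> fst d" "T e (\<phi> p) = tr2 \<theta> e d T' (\<phi> p)"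
  shows "tr2 \<phi> c e T p = tr2 (\<lambda>q. \<theta> (\<phi> q)) c d T' p"
  unfolding tr2_def assms(9) D1_chain[OF assms(1-8)] by (simp add: fun_eq_iff sum_2 algebra_simps)

context smooth_surface
begin

lemma on_charts_apply: "c \<in> A \<Longrightarrow> p \<in> fst c \<Longrightarrow> on_charts T c p = T c p"
  by (simp add: on_charts_def)

lemma on_charts_idem [simp]: "on_charts (on_charts T) = on_charts T"
  by (simp add: on_charts_def fun_eq_iff)

lemma smooth_at_cong_chart:
  assumes "c \<in> A" "p \<in> fst c" "\<And>q. q \<in> fst c \<Longrightarrow> f q = g q" "smooth_at c p f"
  shows "smooth_at c p g"
  by (rule smooth_at_cong[OF assms(4), of "fst c"]) (use assms chart_open in auto)

lemma pd_cong_chart: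
  assumes "c \<in> A" "p \<in> fst c" "\<And>q. q \<in> fst c \<Longrightarrow> f q = g q"
  shows "pd c i f p = pd c i g p"
  by (rule pd_cong[of c p "fst c"]) (use assms chart_open in auto)

lemma affine_connectionD:
  assumes "\<Gamma> \<in> affine_connections"
  shows "c \<in> A \<Longrightarrow> p \<in> fst c \<Longrightarrow> smooth_at c p (\<lambda>q. \<Gamma> c q i j k)"
    "c \<in> A \<Longrightarrow> d \<in> A \<Longrightarrow> p \<in> fst c \<Longrightarrow> p \<in> fst d \<Longrightarrow> \<Gamma> c p = tr_conn id id c d \<Gamma> p"
proof -
  show "c \<in> A \<Longrightarrow> p \<in> fst c \<Longrightarrow> smooth_at c p (\<lambda>q. \<Gamma> c q i j k)"
    using assms by (simp add: affine_connections_def smooth_comp_iff)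
  show "c \<in> A \<Longrightarrow> d \<in> A \<Longrightarrow> p \<in> fst c \<Longrightarrow> p \<in> fst d \<Longrightarrow> \<Gamma> c p = tr_conn id id c d \<Gamma> p"
    using assms unfolding affine_connections_def by blast
qed

lemma affine_connection_related:
  assumes "\<Gamma> \<in> affine_connections" "c \<in> A" "d \<in> A" "p \<in> fst c" "p \<in> fst d"
  shows "conn_related (D1 id c d p) (D2 id c d p) (\<Gamma> c p) (\<Gamma> d p)"
proof -
  interpret chart_map M A id id c d by (rule chart_map_id) fact+
  show ?thesis
    using conn_related_iff_tr_conn[of p \<Gamma> \<Gamma>] affine_connectionD(2)[OF assms] assms by simp
qed

lemma conn_related_chain:
  assumes "smooth_map \<phi>" "smooth_map \<theta>" "c \<in> A" "e \<in> A" "d \<in> A"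
    "p \<in> fst c" "\<phi> p \<in> fst e" "\<theta> (\<phi> p) \<in> fst d"
    "conn_related (D1 \<phi> c e p) (D2 \<phi> c e p) G G'"
    "conn_related (D1 \<theta> e d (\<phi> p)) (D2 \<theta> e d (\<phi> p)) G' G''"
  shows "conn_related (D1 (\<lambda>q. \<theta> (\<phi> q)) c d p) (D2 (\<lambda>q. \<theta> (\<phi> q)) c d p) G G''"
  by (rule conn_related_compose[OF assms(9,10)]) (rule D1_chain[OF assms(1-8)] D2_chain[OF assms(1-8)])+

end

section \<open>Pullback of two-forms and connections by a diffeomorphism\<close>

locale smooth_diffeo = smooth_surface M A for M :: "'a topology" and A :: "'a chart set" +
  fixes \<phi> :: "'a \<Rightarrow> 'a"
  assumes diffeo: "diffeo \<phi>"
begin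

lemma smooth_diffeo: "smooth_map \<phi>" "smooth_map (inv_map \<phi>)"
  using diffeo by (auto simp: diffeo_def)

lemma diffeo_in: "q \<in> topspace M \<Longrightarrow> \<phi> q \<in> topspace M"
  using diffeo bij_betw_apply by (auto simp: diffeo_def)

lemma inv_map_left: "q \<in> topspace M \<Longrightarrow> inv_map \<phi> (\<phi> q) = q"
  using diffeo by (simp add: diffeo_def bij_betw_def)

lemma inv_map_right: "q \<in> topspace M \<Longrightarrow> \<phi> (inv_map \<phi> q) = q" "q \<in> topspace M \<Longrightarrow> inv_map \<phi> q \<in> topspace M"
  using diffeo by (auto simp: diffeo_def bij_betw_def f_inv_into_f inv_into_into)

lemma chart_map_diffeo: "c \<in> A \<Longrightarrow> d \<in> A \<Longrightarrow> chart_map M A \<phi> (inv_map \<phi>) c d"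
  by unfold_locales (use smooth_diffeo inv_map_left in auto)

lemma target_chart:
  assumes "c \<in> A" "p \<in> fst c"
  shows "chart_at (\<phi> p) \<in> A" "\<phi> p \<in> fst (chart_at (\<phi> p))"
  using chart_exists diffeo_in chart_subset assms by blast+

lemma pull2_apply:
  assumes "T \<in> two_forms" "c \<in> A" "d \<in> A" "p \<in> fst c" "\<phi> p \<in> fst d"
  shows "pull2 \<phi> T c p = tr2 \<phi> c d T p"
proof -
  note t = target_chart[OF assms(2,4)]
  have "T (chart_at (\<phi> p)) (\<phi> p) = tr2 id (chart_at (\<phi> p)) d T (\<phi> p)"
    using assms t unfolding two_forms_def by blast
  then show ?thesis
    unfolding pull2_def on_charts_apply[OF assms(2,4)]
    using tr2_compose[OF smooth_diffeo(1) smooth_map_id assms(2) t(1) assms(3,4) t(2)] assms(5) by simp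
qed

text \<open>The pullback is computed in \<open>chart_at (\<phi> p)\<close>, which may jump with p.
  Composing with the change of chart at \<phi> p gives the law for any target chart; smoothness can
  then be checked with a fixed one.\<close>

lemma pull_conn_related:
  assumes "\<Gamma> \<in> affine_connections" "c \<in> A" "d \<in> A" "p \<in> fst c" "\<phi> p \<in> fst d"
  shows "conn_related (D1 \<phi> c d p) (D2 \<phi> c d p) (pull_conn \<phi> \<Gamma> c p) (\<Gamma> d (\<phi> p))"
proof -
  let ?e = "chart_at (\<phi> p)"
  note t = target_chart[OF assms(2,4)]
  interpret chart_map M A \<phi> "inv_map \<phi>" c ?e by (rule chart_map_diffeo) (use assms t in auto)
  have "conn_related (D1 \<phi> c ?e p) (D2 \<phi> c ?e p) (pull_conn \<phi> \<Gamma> c p) (\<Gamma> ?e (\<phi> p))"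
    using conn_related_iff_tr_conn[of p "pull_conn \<phi> \<Gamma>" \<Gamma>] assms t
    by (simp add: pull_conn_def on_charts_apply)
  from conn_related_chain[OF smooth_diffeo(1) smooth_map_id assms(2) t(1) assms(3,4) t(2) _ this
      affine_connection_related[OF assms(1) t(1) assms(3) t(2) assms(5)]]
  show ?thesis using assms(5) by simp
qed

lemma pull_conn_apply:
  assumes "\<Gamma> \<in> affine_connections" "c \<in> A" "d \<in> A" "p \<in> fst c" "\<phi> p \<in> fst d"
  shows "pull_conn \<phi> \<Gamma> c p = tr_conn \<phi> (inv_map \<phi>) c d \<Gamma> p"
proof -
  interpret chart_map M A \<phi> "inv_map \<phi>" c d by (rule chart_map_diffeo) (use assms in auto)
  show ?thesis
    using conn_related_iff_tr_conn[of p "pull_conn \<phi> \<Gamma>" \<Gamma>] pull_conn_related[OF assms] assms by simp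
qed

lemma pull_conn_affine:
  assumes "\<Gamma> \<in> affine_connections"
  shows "pull_conn \<phi> \<Gamma> \<in> affine_connections"
  unfolding affine_connections_def
proof (intro CollectI conjI ballI allI)
  show "on_charts (pull_conn \<phi> \<Gamma>) = pull_conn \<phi> \<Gamma>" by (simp add: pull_conn_def)
next
  fix c i j k assume c: "c \<in> A"
  show "smooth_comp c (\<lambda>q. pull_conn \<phi> \<Gamma> c q i j k)"
  proof (subst smooth_comp_iff[OF c], rule ballI)
    fix p assume p: "p \<in> fst c"
    let ?d = "chart_at (\<phi> p)"
    note t = target_chart[OF c p]
    interpret chart_map M A \<phi> "inv_map \<phi>" c ?d by (rule chart_map_diffeo) (use c t in auto)
    have pD: "p \<in> Dom" using p t by simp
    have "smooth_at c p (\<lambda>q. tr_conn \<phi> (inv_map \<phi>) c ?d \<Gamma> q i j k)"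
      unfolding tr_conn_def
      using c p smooth_K[OF pD] smooth_H[OF pD] smooth_J[OF pD]
        smooth_pull[OF pD affine_connectionD(1)[OF assms t]]
      by (intro smooth_at_sum smooth_at_mult smooth_at_add) auto
    then show "smooth_at c p (\<lambda>q. pull_conn \<phi> \<Gamma> c q i j k)"
      by (rule smooth_at_cong[OF _ openin_Dom pD]) (use pull_conn_apply[OF assms c t(1)] in auto)
  qed
next
  fix c c' p assume c: "c \<in> A" "c' \<in> A" and p: "p \<in> fst c \<inter> fst c'"
  let ?d = "chart_at (\<phi> p)"
  have pc: "p \<in> fst c" "p \<in> fst c'" using p by auto
  note t = target_chart[OF c(1) pc(1)]
  \<comment> \<open>The coordinate change of the pullback is identified by uniqueness: through c' it
    satisfies the same relation to \<Gamma> in \<open>?d\<close> as the components in c do directly,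
    and the Jacobian is invertible.\<close>
  let ?G = "tr_conn id id c c' (pull_conn \<phi> \<Gamma>) p"
  interpret i: chart_map M A id id c c' by (rule chart_map_id) fact+
  interpret f: chart_map M A \<phi> "inv_map \<phi>" c ?d by (rule chart_map_diffeo) (use c t in auto)
  have "conn_related (D1 id c c' p) (D2 id c c' p) ?G (pull_conn \<phi> \<Gamma> c' p)"
    using i.conn_related_iff_tr_conn[of p "\<lambda>_ _. ?G" "pull_conn \<phi> \<Gamma>"] p by simp
  from conn_related_chain[OF smooth_map_id smooth_diffeo(1) c t(1) pc(1) _ _ this, simplified, OF pc(2) t(2)
      pull_conn_related[OF assms c(2) t(1) pc(2) t(2)]]
  have "conn_related (D1 \<phi> c ?d p) (D2 \<phi> c ?d p) ?G (\<Gamma> ?d (\<phi> p))" .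
  then show "pull_conn \<phi> \<Gamma> c p = ?G"
    using conn_related_unique[OF pull_conn_related[OF assms c(1) t(1) pc(1) t(2)] _ f.KJ] pc t by auto
qed

end

section \<open>Naturality of the curvature one-form\<close>

context symplectic_surface
begin

lemma symplectic_connectionD:
  assumes "\<Gamma> \<in> symplectic_connections"
  shows "\<Gamma> \<in> affine_connections"
    "c \<in> A \<Longrightarrow> p \<in> fst c \<Longrightarrow> smooth_at c p (\<lambda>q. \<Gamma> c q i j k)"
    "c \<in> A \<Longrightarrow> p \<in> fst c \<Longrightarrow> \<Gamma> c p i j k = \<Gamma> c p j i k"
    "c \<in> A \<Longrightarrow> p \<in> fst c \<Longrightarrow> cov_tensor2 \<Gamma> \<Omega> c p m i j = 0"
  using assms affine_connectionD(1) by (auto simp: symplectic_connections_def)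

lemma Omega_tr2: "c \<in> A \<Longrightarrow> d \<in> A \<Longrightarrow> p \<in> fst c \<Longrightarrow> p \<in> fst d \<Longrightarrow> \<Omega> c p = tr2 id c d \<Omega> p"
  using form unfolding two_forms_def by blast

lemma tr2_Omega:
  "tr2 \<phi> c d \<Omega> p 1 2 = (D1 \<phi> c d p 1 1 * D1 \<phi> c d p 2 2 - D1 \<phi> c d p 2 1 * D1 \<phi> c d p 1 2) * \<Omega> d (\<phi> p) 1 2"
  by (simp add: tr2_def sum_2 Omega_components algebra_simps)

text \<open>Contracting two Jacobians with an antisymmetric array gives their determinant, which
  cancels the determinant in the transformation of \<Omega>_12.\<close>

lemma Omega_up_natural:
  assumes "chart_map M A \<phi> \<psi> c d" "p \<in> fst c" "\<phi> p \<in> fst d" "\<Omega> c p = tr2 \<phi> c d \<Omega> p"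
  shows "(\<Sum>a\<in>UNIV. \<Sum>b\<in>UNIV. D1 \<phi> c d p g a * D1 \<phi> c d p e b * \<Omega>up c p a b) = \<Omega>up d (\<phi> p) g e"
proof -
  interpret chart_map M A \<phi> \<psi> c d by fact
  let ?\<Delta> = "J p 1 1 * J p 2 2 - J p 2 1 * J p 1 2"
  have D: "?\<Delta> \<noteq> 0" using det_J assms by simp
  have w: "\<Omega> c p 1 2 = ?\<Delta> * \<Omega> d (\<phi> p) 1 2" unfolding assms(4) tr2_Omega ..
  have n: "\<Omega> d (\<phi> p) 1 2 \<noteq> 0" using Omega_nonzero charts assms by blast
  have "(\<Sum>a\<in>UNIV. \<Sum>b\<in>UNIV. J p g a * J p e b * \<Omega>up c p a b)
      = (J p g 1 * J p e 2 - J p g 2 * J p e 1) / (?\<Delta> * \<Omega> d (\<phi> p) 1 2)"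
    using Omega_up_components[OF charts(1) assms(2)]
    by (simp add: sum_2 w diff_divide_distrib)
  also have "\<dots> = \<Omega>up d (\<phi> p) g e"
    using exhaust_2[of g] exhaust_2[of e] D n
    by (auto simp: Omega_up_components[OF charts(2) assms(3)] divide_simps)
  finally show ?thesis .
qed

text \<open>The Ricci tensor and its covariant derivative pull back with J, the inverse form pushes
  forward with J; their contraction leaves a single J. The case \<phi> = id is the change of chart,
  the case of a symplectomorphism is equivariance.\<close>

lemma curvature_one_form_natural:
  assumes "chart_map M A \<phi> \<psi> c d" "p \<in> fst c" "\<phi> p \<in> fst d"
    and \<Gamma>: "\<Gamma> \<in> symplectic_connections" "\<Gamma>' \<in> symplectic_connections"
    and rel: "\<And>q. q \<in> fst c \<Longrightarrow> \<phi> q \<in> fst d \<Longrightarrow> conn_related (D1 \<phi> c d q) (D2 \<phi> c d q) (\<Gamma> c q) (\<Gamma>' d (\<phi> q))"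
    and \<Omega>: "\<Omega> c p = tr2 \<phi> c d \<Omega> p"
  shows "curvature_one_form \<Gamma> c p = tr1 \<phi> c d (curvature_one_form \<Gamma>') p"
proof
  fix i
  interpret chart_map M A \<phi> \<psi> c d by fact
  have p: "p \<in> Dom" using assms by simp
  note s = symplectic_connectionD(2)[OF \<Gamma>(1) charts(1)] symplectic_connectionD(2)[OF \<Gamma>(2) charts(2)]
  note sym = symplectic_connectionD(3)[OF \<Gamma>(1) charts(1)] symplectic_connectionD(3)[OF \<Gamma>(2) charts(2)]
  have ric: "ricci \<Gamma> c q i j = (\<Sum>a\<in>UNIV. \<Sum>b\<in>UNIV. J q a i * J q b j * ricci \<Gamma>' d (\<phi> q) a b)"
    if "q \<in> Dom" for q i j
    by (rule ricci_natural[where \<Gamma> = \<Gamma> and \<Gamma>' = \<Gamma>', OF that]) (use that rel s sym in auto)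
  have cov: "cov_tensor2 \<Gamma> (ricci \<Gamma>) c p m i j = (\<Sum>e\<in>UNIV. \<Sum>a\<in>UNIV. \<Sum>b\<in>UNIV.
      J p e m * J p a i * J p b j * cov_tensor2 \<Gamma>' (ricci \<Gamma>') d (\<phi> p) e a b)" for m i j
    by (rule cov_tensor2_natural[where T = "ricci \<Gamma>" and T' = "ricci \<Gamma>'", OF p])
      (use p rel ric s smooth_at_ricci charts in auto)
  have "(\<Sum>a\<in>UNIV. \<Sum>b\<in>UNIV. \<Omega>up c p a b * cov_tensor2 \<Gamma> (ricci \<Gamma>) c p b i a)
      = (\<Sum>f\<in>UNIV. J p f i * (\<Sum>g\<in>UNIV. \<Sum>e\<in>UNIV.
          (\<Sum>a\<in>UNIV. \<Sum>b\<in>UNIV. J p g a * J p e b * \<Omega>up c p a b) * cov_tensor2 \<Gamma>' (ricci \<Gamma>') d (\<phi> p) e f g))"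
    unfolding cov by (simp add: sum_2 algebra_simps)
  then show "curvature_one_form \<Gamma> c p i = tr1 \<phi> c d (curvature_one_form \<Gamma>') p i"
    unfolding tr1_def curvature_one_form_def on_charts_apply[OF charts(1) assms(2)]
      on_charts_apply[OF charts(2) assms(3)] Omega_up_natural[OF assms(1-3) \<Omega>]
    by (simp add: sum_distrib_left mult_ac)
qed

lemma curvature_one_form_change_chart:
  assumes "\<Gamma> \<in> symplectic_connections" "c \<in> A" "d \<in> A" "p \<in> fst c" "p \<in> fst d"
  shows "curvature_one_form \<Gamma> c p = tr1 id c d (curvature_one_form \<Gamma>) p"
proof -
  have "\<Omega> c p = tr2 id c d \<Omega> p" by (rule Omega_tr2) fact+
  then show ?thesis
    by (intro curvature_one_form_natural[OF chart_map_id[OF assms(2,3)] assms(4) _ assms(1,1)])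
      (use assms affine_connection_related[OF symplectic_connectionD(1)[OF assms(1)] assms(2,3)] in simp_all)
qed

lemma smooth_at_Omega_up:
  assumes "c \<in> A" "p \<in> fst c"
  shows "smooth_at c p (\<lambda>q. \<Omega>up c q a b)"
proof -
  have i: "smooth_at c p (\<lambda>q. inverse (\<Omega> c q 1 2))"
    by (rule smooth_at_inverse) (use assms Omega_smooth Omega_nonzero in auto)
  have "\<exists>k. \<forall>q\<in>fst c. k * inverse (\<Omega> c q 1 2) = \<Omega>up c q a b"
    using exhaust_2[of a] exhaust_2[of b] Omega_up_components[OF assms(1)]
    by (auto simp: divide_inverse intro: exI[of _ 0] exI[of _ 1] exI[of _ "- 1"])
  then obtain k where k: "\<And>q. q \<in> fst c \<Longrightarrow> k * inverse (\<Omega> c q 1 2) = \<Omega>up c q a b"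
    by blast
  show ?thesis
    by (rule smooth_at_cong_chart[OF assms k smooth_at_cmult[OF i]])
qed

lemma smooth_at_curvature_one_form:
  assumes "\<Gamma> \<in> symplectic_connections" "c \<in> A" "p \<in> fst c"
  shows "smooth_at c p (\<lambda>q. curvature_one_form \<Gamma> c q i)"
proof (rule smooth_at_cong_chart[OF assms(2,3)])
  show "2 * (\<Sum>a\<in>UNIV. \<Sum>b\<in>UNIV. \<Omega>up c q a b * cov_tensor2 \<Gamma> (ricci \<Gamma>) c q b i a) = curvature_one_form \<Gamma> c q i"
    if "q \<in> fst c" for q
    unfolding curvature_one_form_def on_charts_apply[OF assms(2) that] ..
  show "smooth_at c p (\<lambda>q. 2 * (\<Sum>a\<in>UNIV. \<Sum>b\<in>UNIV. \<Omega>up c q a b * cov_tensor2 \<Gamma> (ricci \<Gamma>) c q b i a))"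
    using symplectic_connectionD(2)[OF assms] assms
    by (intro smooth_at_cmult smooth_at_sum smooth_at_mult smooth_at_Omega_up smooth_at_cov_tensor2 smooth_at_ricci) auto
qed

lemma curvature_one_form_in_one_forms:
  assumes "\<Gamma> \<in> symplectic_connections"
  shows "(\<lambda>c p i. - (1/2) * curvature_one_form \<Gamma> c p i) \<in> one_forms"
  unfolding one_forms_def
proof (intro CollectI conjI ballI allI)
  show "on_charts (\<lambda>c p i. - (1/2) * curvature_one_form \<Gamma> c p i) = (\<lambda>c p i. - (1/2) * curvature_one_form \<Gamma> c p i)"
    by (auto simp: on_charts_def curvature_one_form_def fun_eq_iff)
  show "smooth_comp c (\<lambda>q. - (1/2) * curvature_one_form \<Gamma> c q i)" if "c \<in> A" for c i
    unfolding smooth_comp_iff[OF that]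
    using that by (intro ballI smooth_at_cmult smooth_at_curvature_one_form[OF assms])
  fix c d p assume "c \<in> A" "d \<in> A" "p \<in> fst c \<inter> fst d"
  then have "curvature_one_form \<Gamma> c p = tr1 id c d (curvature_one_form \<Gamma>) p"
    using curvature_one_form_change_chart[OF assms] by blast
  then show "(\<lambda>i. - (1/2) * curvature_one_form \<Gamma> c p i) = tr1 id c d (\<lambda>c p i. - (1/2) * curvature_one_form \<Gamma> c p i) p"
    by (simp add: tr1_def fun_eq_iff sum_2 field_simps)
qed

subsection \<open>Exact forms\<close>

definition exact_form :: "('a \<Rightarrow> real) \<Rightarrow> 'a field1" where
  "exact_form f = on_charts (\<lambda>c p i. pd c i f p)"

definition smooth_scalar :: "('a \<Rightarrow> real) \<Rightarrow> bool" where
  "smooth_scalar f \<longleftrightarrow> (\<forall>c\<in>A. \<forall>p\<in>fst c. smooth_at c p f)"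

text \<open>Since \<Omega> is parallel, the covariant derivative of f \<Omega> involves only df. The
  result does not contain \<Gamma>, so the connection chosen inside \<open>codiff\<close> is
  immaterial.\<close>

lemma codiff_wrt_eq_exact:
  assumes "\<Gamma> \<in> symplectic_connections" "smooth_scalar f"
    "\<And>c q i j. c \<in> A \<Longrightarrow> q \<in> fst c \<Longrightarrow> \<beta> c q i j = f q * \<Omega> c q i j"
  shows "codiff_wrt \<Gamma> \<beta> = exact_form (\<lambda>p. - f p)"
proof (intro ext)
  fix c p i
  show "codiff_wrt \<Gamma> \<beta> c p i = exact_form (\<lambda>p. - f p) c p i"
  proof (cases "c \<in> A \<and> p \<in> fst c")
    case True
    then have cp: "c \<in> A" "p \<in> fst c" by auto
    have sf: "smooth_at c p f" using assms(2) cp by (simp add: smooth_scalar_def)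
    have pdb: "pd c m (\<lambda>q. \<beta> c q i j) p = f p * pd c m (\<lambda>q. \<Omega> c q i j) p + pd c m f p * \<Omega> c p i j" for m i j
      using pd_cong_chart[OF cp, of "\<lambda>q. \<beta> c q i j" "\<lambda>q. f q * \<Omega> c q i j" m] assms(3)[OF cp(1)]
        pd_mult[OF sf Omega_smooth[OF cp]] by simp
    have "cov_tensor2 \<Gamma> \<beta> c p m i j = f p * cov_tensor2 \<Gamma> \<Omega> c p m i j + pd c m f p * \<Omega> c p i j" for m i j
      unfolding cov_tensor2_def pdb assms(3)[OF cp] by (simp add: sum_2 algebra_simps)
    then have "cov_tensor2 \<Gamma> \<beta> c p m i j = pd c m f p * \<Omega> c p i j" for m i j
      using symplectic_connectionD(4)[OF assms(1) cp] by simp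
    then have "codiff_wrt \<Gamma> \<beta> c p i = - (\<Sum>a\<in>UNIV. \<Sum>b\<in>UNIV. \<Omega>up c p a b * (pd c b f p * \<Omega> c p a i))"
      by (simp add: codiff_wrt_def on_charts_apply[OF cp])
    also have "\<dots> = - pd c i f p"
      using exhaust_2[of i] Omega_up_components[OF cp] Omega_nonzero[OF cp]
      by (auto simp: sum_2 Omega_components)
    finally show ?thesis
      by (simp add: exact_form_def on_charts_apply[OF cp] pd_minus[OF sf])
  qed (auto simp: codiff_wrt_def exact_form_def on_charts_def)
qed

text \<open>\<beta> and \<Omega> scale by the same Jacobian determinant, so the quotient of their
  components does not depend on the chart.\<close>

lemma two_form_scalar:
  assumes "\<beta> \<in> two_forms"
  obtains f where "smooth_scalar f" "\<And>c q i j. c \<in> A \<Longrightarrow> q \<in> fst c \<Longrightarrow> \<beta> c q i j = f q * \<Omega> c q i j"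
proof
  let ?f = "\<lambda>p. \<beta> (chart_at p) p 1 2 / \<Omega> (chart_at p) p 1 2"
  have asym: "\<beta> c p i j = - \<beta> c p j i" for c p i j
    using assms unfolding two_forms_def by blast
  have comps: "\<beta> c p 1 1 = 0" "\<beta> c p 2 2 = 0" "\<beta> c p 2 1 = - \<beta> c p 1 2" for c p
    using asym[of c p 1 1] asym[of c p 2 2] asym[of c p 2 1] by auto
  have f: "?f q = \<beta> c q 1 2 / \<Omega> c q 1 2" if cq: "c \<in> A" "q \<in> fst c" for c q
  proof -
    let ?e = "chart_at q"
    have e: "?e \<in> A" "q \<in> fst ?e" using chart_exists cq chart_subset by blast+
    interpret chart_map M A id id c ?e by (rule chart_map_id) (use cq e in auto)
    let ?\<Delta> = "J q 1 1 * J q 2 2 - J q 2 1 * J q 1 2"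
    have D: "?\<Delta> \<noteq> 0" using det_J cq e by simp
    have "\<beta> c q = tr2 id c ?e \<beta> q" using assms cq e unfolding two_forms_def by blast
    then have "\<beta> c q 1 2 = ?\<Delta> * \<beta> ?e q 1 2"
      by (simp add: tr2_def sum_2 comps algebra_simps)
    moreover have "\<Omega> c q 1 2 = ?\<Delta> * \<Omega> ?e q 1 2"
      by (rule Omega_change_chart) (use cq e in auto)
    ultimately show ?thesis using D by simp
  qed
  show "\<beta> c q i j = ?f q * \<Omega> c q i j" if cq: "c \<in> A" "q \<in> fst c" for c q i j
    unfolding f[OF cq] using exhaust_2[of i] exhaust_2[of j] Omega_nonzero[OF cq]
    by (auto simp: comps Omega_components)
  show "smooth_scalar ?f"
    unfolding smooth_scalar_def
  proof (intro ballI)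
    fix c p assume cp: "c \<in> A" "p \<in> fst c"
    have "smooth_at c p (\<lambda>q. \<beta> c q 1 2)"
      using assms cp by (simp add: two_forms_def smooth_comp_iff)
    moreover have "smooth_at c p (\<lambda>q. inverse (\<Omega> c q 1 2))"
      by (rule smooth_at_inverse) (use cp Omega_smooth Omega_nonzero in auto)
    ultimately have "smooth_at c p (\<lambda>q. \<beta> c q 1 2 * inverse (\<Omega> c q 1 2))"
      by (rule smooth_at_mult)
    then show "smooth_at c p ?f"
      by (rule smooth_at_cong_chart[OF cp, rotated]) (use f[OF cp(1)] in \<open>simp add: divide_inverse\<close>)
  qed
qed

lemma scalar_two_form:
  assumes "smooth_scalar f"
  shows "on_charts (\<lambda>c p i j. f p * \<Omega> c p i j) \<in> two_forms"
  unfolding two_forms_def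
proof (intro CollectI conjI ballI allI)
  show "smooth_comp c (\<lambda>q. on_charts (\<lambda>c p i j. f p * \<Omega> c p i j) c q i j)" if c: "c \<in> A" for c i j
    unfolding smooth_comp_iff[OF c]
  proof
    fix p assume p: "p \<in> fst c"
    show "smooth_at c p (\<lambda>q. on_charts (\<lambda>c p i j. f p * \<Omega> c p i j) c q i j)"
      by (rule smooth_at_cong_chart[OF c p, of "\<lambda>q. f q * \<Omega> c q i j"])
        (use assms c p Omega_smooth[OF c p] in \<open>auto simp: on_charts_apply smooth_scalar_def intro: smooth_at_mult\<close>)
  qed
  fix c d p assume c: "c \<in> A" "d \<in> A" "p \<in> fst c \<inter> fst d"
  then have "\<Omega> c p = tr2 id c d \<Omega> p" using Omega_tr2 by blast
  then have "f p * \<Omega> c p i j = tr2 id c d (\<lambda>c p i j. f p * \<Omega> c p i j) p i j" for i j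
    by (simp add: tr2_def sum_2 algebra_simps)
  then show "on_charts (\<lambda>c p i j. f p * \<Omega> c p i j) c p = tr2 id c d (on_charts (\<lambda>c p i j. f p * \<Omega> c p i j)) p"
    using c by (simp add: fun_eq_iff on_charts_apply tr2_def)
next
  show "on_charts (\<lambda>c p i j. f p * \<Omega> c p i j) c p i j = - on_charts (\<lambda>c p i j. f p * \<Omega> c p i j) c p j i" for c p i j
    using exhaust_2[of i] exhaust_2[of j] by (auto simp: on_charts_def Omega_components)
qed simp

lemma smooth_scalar_minus: "smooth_scalar f \<Longrightarrow> smooth_scalar (\<lambda>p. - f p)"
  by (simp add: smooth_scalar_def smooth_at_minus)

text \<open>The given \<Gamma> guarantees that the \<open>SOME\<close> in \<open>codiff\<close>
  picks a symplectic connection. The sign in d'(f \<Omega>) = -df is absorbed by replacing f with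
  -f.\<close>

lemma form_class_eq:
  assumes "\<Gamma> \<in> symplectic_connections"
  shows "form_class \<alpha> = {\<alpha> + exact_form f | f. smooth_scalar f}"
proof -
  define \<Gamma>0 where "\<Gamma>0 = (SOME \<Gamma>. \<Gamma> \<in> symplectic_connections)"
  have \<Gamma>0: "\<Gamma>0 \<in> symplectic_connections"
    unfolding \<Gamma>0_def by (rule someI[of "\<lambda>\<Gamma>. \<Gamma> \<in> symplectic_connections", OF assms])
  have "\<exists>f. smooth_scalar f \<and> codiff \<beta> = exact_form f" if "\<beta> \<in> two_forms" for \<beta>
  proof -
    obtain f where "smooth_scalar f" "\<And>c q i j. c \<in> A \<Longrightarrow> q \<in> fst c \<Longrightarrow> \<beta> c q i j = f q * \<Omega> c q i j"
      using two_form_scalar[OF \<open>\<beta> \<in> two_forms\<close>] by blast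
    then show ?thesis
      using codiff_wrt_eq_exact[OF \<Gamma>0] smooth_scalar_minus unfolding codiff_def \<Gamma>0_def[symmetric] by blast
  qed
  moreover have "\<exists>\<beta>. \<beta> \<in> two_forms \<and> codiff \<beta> = exact_form f" if "smooth_scalar f" for f
  proof -
    have m: "smooth_scalar (\<lambda>p. - f p)" using that by (rule smooth_scalar_minus)
    have "codiff (on_charts (\<lambda>c p i j. - f p * \<Omega> c p i j)) = exact_form (\<lambda>p. - (- f p))"
      unfolding codiff_def \<Gamma>0_def[symmetric]
      by (rule codiff_wrt_eq_exact[OF \<Gamma>0 m]) (simp add: on_charts_apply)
    then show ?thesis using scalar_two_form[OF m] by auto
  qed
  ultimately show ?thesis
    unfolding form_class_def by (auto 0 4) metis+
qed

subsection \<open>Equivariance\<close>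

text \<open>Torsion stays zero because second derivatives of \<phi> are symmetric. The derivative of
  \<Omega> pulls back to the derivative of the pulled back form, which is \<Omega> again.\<close>

lemma pull_conn_symplectic:
  assumes "\<phi> \<in> Symp" "\<Gamma> \<in> symplectic_connections"
  shows "pull_conn \<phi> \<Gamma> \<in> symplectic_connections"
    and "curvature_one_form (pull_conn \<phi> \<Gamma>) = pull1 \<phi> (curvature_one_form \<Gamma>)"
proof -
  have d: "diffeo \<phi>" "pull2 \<phi> \<Omega> = \<Omega>" using assms(1) by (auto simp: Symp_def)
  interpret smooth_diffeo M A \<phi> by unfold_locales (rule d)
  note aff = symplectic_connectionD(1)[OF assms(2)]
  note rel = pull_conn_related[OF aff]
  have \<Omega>: "\<Omega> c p = tr2 \<phi> c d \<Omega> p" if "c \<in> A" "d \<in> A" "p \<in> fst c" "\<phi> p \<in> fst d" for c d p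
    using pull2_apply[OF form that] d(2) by simp
  show P: "pull_conn \<phi> \<Gamma> \<in> symplectic_connections"
    unfolding symplectic_connections_def
  proof (intro CollectI conjI ballI allI)
    show "pull_conn \<phi> \<Gamma> \<in> affine_connections" by (rule pull_conn_affine[OF aff])
    fix c p i j k assume cp: "c \<in> A" "p \<in> fst c"
    let ?d = "chart_at (\<phi> p)"
    note t = target_chart[OF cp]
    interpret chart_map M A \<phi> "inv_map \<phi>" c ?d by (rule chart_map_diffeo) (use cp t in auto)
    have pD: "p \<in> Dom" using cp t by simp
    have "tr_conn \<phi> (inv_map \<phi>) c ?d \<Gamma> p i j k = tr_conn \<phi> (inv_map \<phi>) c ?d \<Gamma> p j i k"
    proof -
      have "H p m i j + (\<Sum>a\<in>UNIV. \<Sum>b\<in>UNIV. J p a i * J p b j * \<Gamma> ?d (\<phi> p) a b m)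
        = H p m j i + (\<Sum>a\<in>UNIV. \<Sum>b\<in>UNIV. J p a j * J p b i * \<Gamma> ?d (\<phi> p) a b m)" for m
        using H_sym[OF pD, of m i j] symplectic_connectionD(3)[OF assms(2) t, of 1 2 m]
        by (simp add: sum_2 algebra_simps)
      then show ?thesis by (simp add: tr_conn_def)
    qed
    then show "pull_conn \<phi> \<Gamma> c p i j k = pull_conn \<phi> \<Gamma> c p j i k"
      using pull_conn_apply[OF aff cp(1) t(1) cp(2) t(2)] by simp
  next
    fix c p m i j assume cp: "c \<in> A" "p \<in> fst c"
    let ?d = "chart_at (\<phi> p)"
    note t = target_chart[OF cp]
    interpret chart_map M A \<phi> "inv_map \<phi>" c ?d by (rule chart_map_diffeo) (use cp t in auto)
    have pD: "p \<in> Dom" using cp t by simp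
    have "cov_tensor2 (pull_conn \<phi> \<Gamma>) \<Omega> c p m i j =
      (\<Sum>e\<in>UNIV. \<Sum>a\<in>UNIV. \<Sum>b\<in>UNIV. J p e m * J p a i * J p b j * cov_tensor2 \<Gamma> \<Omega> ?d (\<phi> p) e a b)"
    proof (rule cov_tensor2_natural[OF pD])
      show "conn_related (J p) (H p) (pull_conn \<phi> \<Gamma> c p) (\<Gamma> ?d (\<phi> p))"
        by (rule rel) (use cp t in auto)
      show "\<Omega> c q i j = (\<Sum>a\<in>UNIV. \<Sum>b\<in>UNIV. J q a i * J q b j * \<Omega> ?d (\<phi> q) a b)" if "q \<in> Dom" for q i j
        using \<Omega>[OF cp(1) t(1), of q] that by (simp add: tr2_def)
      show "smooth_at ?d (\<phi> p) (\<lambda>q. \<Omega> ?d q a b)" for a b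
        by (rule Omega_smooth[OF t])
    qed
    then show "cov_tensor2 (pull_conn \<phi> \<Gamma>) \<Omega> c p m i j = 0"
      by (simp add: symplectic_connectionD(4)[OF assms(2) t])
  qed
  show "curvature_one_form (pull_conn \<phi> \<Gamma>) = pull1 \<phi> (curvature_one_form \<Gamma>)"
  proof (intro ext)
    fix c p i
    show "curvature_one_form (pull_conn \<phi> \<Gamma>) c p i = pull1 \<phi> (curvature_one_form \<Gamma>) c p i"
    proof (cases "c \<in> A \<and> p \<in> fst c")
      case True
      then have cp: "c \<in> A" "p \<in> fst c" by auto
      note t = target_chart[OF cp]
      have "curvature_one_form (pull_conn \<phi> \<Gamma>) c p = tr1 \<phi> c (chart_at (\<phi> p)) (curvature_one_form \<Gamma>) p"
        by (rule curvature_one_form_natural[OF chart_map_diffeo[OF cp(1) t(1)] cp(2) t(2) P assms(2)])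
          (use cp t rel \<Omega> in auto)
      then show ?thesis by (simp add: pull1_def on_charts_apply[OF cp])
    qed (auto simp: curvature_one_form_def pull1_def on_charts_def)
  qed
qed

text \<open>Classes are sets, so two inclusions are needed: pullback sends df to the differential of
  f after \<phi>, and precomposition with the inverse map shows that every exact form arises in this
  way.\<close>

lemma curvature_moment_equivariant:
  assumes "\<phi> \<in> Symp" "\<Gamma> \<in> symplectic_connections"
  shows "curvature_moment (pull_conn \<phi> \<Gamma>) = pull_class \<phi> (curvature_moment \<Gamma>)"
proof -
  interpret smooth_diffeo M A \<phi> by unfold_locales (use assms in \<open>auto simp: Symp_def\<close>)
  let ?\<rho> = "\<lambda>\<Gamma> c p i. - (1/2) * curvature_one_form \<Gamma> c p i"
  have \<rho>: "pull1 \<phi> (?\<rho> \<Gamma> + exact_form f) = ?\<rho> (pull_conn \<phi> \<Gamma>) + exact_form (\<lambda>p. f (\<phi> p))"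
    if f: "smooth_scalar f" for f
  proof (intro ext)
    fix c p i
    show "pull1 \<phi> (?\<rho> \<Gamma> + exact_form f) c p i = (?\<rho> (pull_conn \<phi> \<Gamma>) + exact_form (\<lambda>p. f (\<phi> p))) c p i"
    proof (cases "c \<in> A \<and> p \<in> fst c")
      case True
      then have cp: "c \<in> A" "p \<in> fst c" by auto
      note t = target_chart[OF cp]
      have "pd c i (\<lambda>q. f (\<phi> q)) p = (\<Sum>a\<in>UNIV. D1 \<phi> c (chart_at (\<phi> p)) p a i * pd (chart_at (\<phi> p)) a f (\<phi> p))"
        by (rule smooth_at_compose(2)[OF smooth_diffeo(1) cp]) (use f t in \<open>auto simp: smooth_scalar_def\<close>)
      then show ?thesis
        unfolding pull_conn_symplectic(2)[OF assms]
        by (simp add: pull1_def on_charts_apply[OF cp] exact_form_def tr1_def sum_2 on_charts_apply[OF t] algebra_simps)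
    qed (auto simp: curvature_one_form_def pull1_def exact_form_def on_charts_def)
  qed
  have s: "smooth_scalar (\<lambda>p. f (\<phi> p))" if "smooth_scalar f" for f
    unfolding smooth_scalar_def
    using smooth_at_compose(1)[OF smooth_diffeo(1)] target_chart that by (meson smooth_scalar_def)
  have s': "smooth_scalar (\<lambda>p. f (inv_map \<phi> p))" if "smooth_scalar f" for f
    unfolding smooth_scalar_def
  proof (intro ballI)
    fix c p assume cp: "c \<in> A" "p \<in> fst c"
    then have "inv_map \<phi> p \<in> topspace M" using inv_map_right(2) chart_subset by blast
    then have "smooth_at (chart_at (inv_map \<phi> p)) (inv_map \<phi> p) f"
      using that chart_exists by (simp add: smooth_scalar_def)
    then show "smooth_at c p (\<lambda>p. f (inv_map \<phi> p))"
      by (rule smooth_at_compose(1)[OF smooth_diffeo(2) cp])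
  qed
  have cancel: "exact_form (\<lambda>p. f (inv_map \<phi> (\<phi> p))) = exact_form f" for f
  proof (intro ext)
    fix c p i
    show "exact_form (\<lambda>p. f (inv_map \<phi> (\<phi> p))) c p i = exact_form f c p i"
    proof (cases "c \<in> A \<and> p \<in> fst c")
      case True
      then have "inv_map \<phi> (\<phi> q) = q" if "q \<in> fst c" for q
        using that chart_subset by (intro inv_map_left) blast
      then show ?thesis
        using pd_cong_chart[of c p "\<lambda>p. f (inv_map \<phi> (\<phi> p))" f i] True
        by (simp add: exact_form_def on_charts_apply)
    qed (auto simp: exact_form_def on_charts_def)
  qed
  show ?thesis
    unfolding curvature_moment_def pull_class_def form_class_eq[OF assms(2)]
  proof (intro equalityI subsetI)
    fix \<alpha> assume "\<alpha> \<in> {?\<rho> (pull_conn \<phi> \<Gamma>) + exact_form f |f. smooth_scalar f}"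
    then obtain f where f: "smooth_scalar f" "\<alpha> = ?\<rho> (pull_conn \<phi> \<Gamma>) + exact_form f" by blast
    have "\<alpha> = pull1 \<phi> (?\<rho> \<Gamma> + exact_form (\<lambda>p. f (inv_map \<phi> p)))"
      unfolding \<rho>[OF s'[OF f(1)]] cancel f(2) ..
    then show "\<alpha> \<in> pull1 \<phi> ` {?\<rho> \<Gamma> + exact_form f |f. smooth_scalar f}"
      using s'[OF f(1)] by blast
  next
    fix \<alpha> assume "\<alpha> \<in> pull1 \<phi> ` {?\<rho> \<Gamma> + exact_form f |f. smooth_scalar f}"
    then obtain f where f: "smooth_scalar f" "\<alpha> = pull1 \<phi> (?\<rho> \<Gamma> + exact_form f)" by blast
    then show "\<alpha> \<in> {?\<rho> (pull_conn \<phi> \<Gamma>) + exact_form f |f. smooth_scalar f}"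
      unfolding f(2) \<rho>[OF f(1)] using s[OF f(1)] by blast
  qed
qed

lemma curvature_moment_in_quotient:
  "\<Gamma> \<in> symplectic_connections \<Longrightarrow> curvature_moment \<Gamma> \<in> form_quotient"
  using curvature_one_form_in_one_forms by (auto simp: curvature_moment_def form_quotient_def)

end

section \<open>Variation of the curvature one-form\<close>

text \<open>The next lemma is the integration by parts behind the moment map property. In local coordinates
  \<open>N = \<nabla>Z\<close>, \<open>hess = \<nabla>\<nabla>Z\<close>, \<open>P\<close> has components \<open>\<Pi>\<^sub>i\<^sub>j\<^sup>k\<close>, \<open>B\<^sub>i\<^sub>j = \<nabla>\<^sub>k \<Pi>\<^sub>i\<^sub>j\<^sup>k\<close>, \<open>covB = \<nabla>B\<close>, and a
  prefixed \<open>d\<close> marks partial derivatives. The right hand side is the coordinate divergence of the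
  vector density \<open>\<epsilon>\<^sup>a\<^sup>b Z\<^sup>i B\<^sub>i\<^sub>a - \<epsilon>\<^sup>c\<^sup>a N\<^sub>a\<^sup>i \<Pi>\<^sub>i\<^sub>c\<^sup>b\<close>.\<close>

lemma second_variation_divergence:
  fixes G P hess :: "2 \<Rightarrow> 2 \<Rightarrow> 2 \<Rightarrow> real" and Z :: "2 \<Rightarrow> real" and dP :: "2 \<Rightarrow> 2 \<Rightarrow> 2 \<Rightarrow> 2 \<Rightarrow> real"
  assumes G: "\<And>k. G 2 1 k = G 1 2 k"
    and P: "\<And>k. P 2 1 k = P 1 2 k" "P 1 2 2 = - P 1 1 1" "P 2 2 2 = - P 1 2 1"
    and dP: "\<And>m k. dP m 2 1 k = dP m 1 2 k"
    and N: "\<And>a i. N a i = dZ a i + (\<Sum>n\<in>UNIV. G a n i * Z n)"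
    and B: "\<And>i j. B i j = (\<Sum>m\<in>UNIV. dP m i j m
        + (\<Sum>n\<in>UNIV. G m n m * P i j n - G m i n * P n j m - G m j n * P i n m))"
    and hess: "\<And>b a i. hess b a i = dN b a i - (\<Sum>n\<in>UNIV. G b a n * N n i) + (\<Sum>n\<in>UNIV. G b n i * N a n)"
    and covB: "\<And>m i j. covB m i j = dB m i j - (\<Sum>n\<in>UNIV. G m i n * B n j) - (\<Sum>n\<in>UNIV. G m j n * B i n)"
  shows "(\<Sum>i\<in>UNIV. Z i * (covB 2 i 1 - covB 1 i 2))
      + (\<Sum>j\<in>UNIV. \<Sum>m\<in>UNIV. hess 1 j m * P 2 m j - hess 2 j m * P 1 m j)
    = - (\<Sum>i\<in>UNIV. Z i * dB 1 i 2 + dZ 1 i * B i 2)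
      - (\<Sum>i\<in>UNIV. N 2 i * dP 1 i 1 1 + dN 1 2 i * P i 1 1 - (N 1 i * dP 1 i 2 1 + dN 1 1 i * P i 2 1))
      + ((\<Sum>i\<in>UNIV. Z i * dB 2 i 1 + dZ 2 i * B i 1)
      - (\<Sum>i\<in>UNIV. N 2 i * dP 2 i 1 2 + dN 2 2 i * P i 1 2 - (N 1 i * dP 2 i 2 2 + dN 2 1 i * P i 2 2)))"
proof -
  have dZ: "dZ a i = N a i - (\<Sum>n\<in>UNIV. G a n i * Z n)" for a i
    by (simp add: N)
  have Z: "(\<Sum>i\<in>UNIV. Z i * (covB 2 i 1 - covB 1 i 2))
    = (\<Sum>i\<in>UNIV. Z i * dB 2 i 1 + dZ 2 i * B i 1) - (\<Sum>i\<in>UNIV. Z i * dB 1 i 2 + dZ 1 i * B i 2)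
      - (\<Sum>i\<in>UNIV. N 2 i * B i 1 - N 1 i * B i 2)"
    unfolding covB dZ by (simp add: sum_2 G algebra_simps)
  have H: "(\<Sum>j\<in>UNIV. \<Sum>m\<in>UNIV. hess 1 j m * P 2 m j - hess 2 j m * P 1 m j)
    = (\<Sum>i\<in>UNIV. N 2 i * B i 1 - N 1 i * B i 2)
      - (\<Sum>i\<in>UNIV. N 2 i * dP 1 i 1 1 + dN 1 2 i * P i 1 1 - (N 1 i * dP 1 i 2 1 + dN 1 1 i * P i 2 1))
      - (\<Sum>i\<in>UNIV. N 2 i * dP 2 i 1 2 + dN 2 2 i * P i 1 2 - (N 1 i * dP 2 i 2 2 + dN 2 1 i * P i 2 2))"
    unfolding hess B by (simp add: sum_2 G P dP algebra_simps)
  show ?thesis unfolding Z H by simp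
qed

text \<open>Inserting the curvature in terms of Ricci turns both sides into Z^i (P_i2^j ric_1j -
  P_i1^j ric_2j). It matches the curvature term of the Lie derivative with the Ricci terms of the
  variation.\<close>

lemma trace_free_contraction:
  fixes P R :: "2 \<Rightarrow> 2 \<Rightarrow> 2 \<Rightarrow> real"
  assumes "\<And>k. P 2 1 k = P 1 2 k" "ric 1 2 = ric 2 1"
    and "\<And>j. R4 1 2 j 1 = ric 2 j" "\<And>j. R4 1 2 j 2 = - ric 1 j"
    and "\<And>p i j m. R4 p i j m = - R4 i p j m"
  shows "(\<Sum>i\<in>UNIV. Z i * ((\<Sum>n\<in>UNIV. P 2 i n * ric n 1) - (\<Sum>n\<in>UNIV. P 1 i n * ric n 2)))
    = (\<Sum>j\<in>UNIV. \<Sum>m\<in>UNIV. (\<Sum>p\<in>UNIV. Z p * R4 p 1 j m) * P 2 m j - (\<Sum>p\<in>UNIV. Z p * R4 p 2 j m) * P 1 m j)"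
proof -
  have "R4 2 1 j m = - R4 1 2 j m" "R4 1 1 j m = 0" "R4 2 2 j m = 0" for j m
    using assms(5)[of 2 1 j m] assms(5)[of 1 1 j m] assms(5)[of 2 2 j m] by auto
  then show ?thesis
    by (simp add: sum_2 assms(1-4) algebra_simps)
qed

section \<open>Ricci curvature along \<nabla> + t \<Pi>\<close>

context symplectic_surface
begin

text \<open>The difference tensor \<Pi>_ij^k by which a tangent vector moves the connection.\<close>

definition raise_last :: "'a field3 \<Rightarrow> 'a field3" where
  "raise_last P c p i j k = (\<Sum>m\<in>UNIV. \<Omega>up c p k m * P c p i j m)"

lemma sym3_tensorD:
  assumes "P \<in> sym3_tensors"
  shows "c \<in> A \<Longrightarrow> p \<in> fst c \<Longrightarrow> smooth_at c p (\<lambda>q. P c q i j k)"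
    "c \<in> A \<Longrightarrow> d \<in> A \<Longrightarrow> p \<in> fst c \<Longrightarrow> p \<in> fst d \<Longrightarrow> P c p = tr3 id c d P p"
    "P c p i j k = P c p j i k" "P c p i j k = P c p i k j"
proof -
  show "c \<in> A \<Longrightarrow> p \<in> fst c \<Longrightarrow> smooth_at c p (\<lambda>q. P c q i j k)"
    using assms by (simp add: sym3_tensors_def smooth_comp_iff)
  show "c \<in> A \<Longrightarrow> d \<in> A \<Longrightarrow> p \<in> fst c \<Longrightarrow> p \<in> fst d \<Longrightarrow> P c p = tr3 id c d P p"
    using assms unfolding sym3_tensors_def by blast
  show "P c p i j k = P c p j i k" "P c p i j k = P c p i k j"
    using assms unfolding sym3_tensors_def by blast+
qed

lemma smooth_at_raise_last:
  assumes "P \<in> sym3_tensors" "c \<in> A" "p \<in> fst c"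
  shows "smooth_at c p (\<lambda>q. raise_last P c q i j k)"
  unfolding raise_last_def using assms sym3_tensorD(1)
  by (intro smooth_at_sum smooth_at_mult smooth_at_Omega_up) auto

lemma raise_last_components:
  assumes "c \<in> A" "p \<in> fst c"
  shows "raise_last P c p i j 1 = P c p i j 2 / \<Omega> c p 1 2" "raise_last P c p i j 2 = - P c p i j 1 / \<Omega> c p 1 2"
  using Omega_up_components[OF assms] by (simp_all add: raise_last_def sum_2)

lemma raise_last_sym:
  assumes "P \<in> sym3_tensors"
  shows "raise_last P c p i j k = raise_last P c p j i k"
  unfolding raise_last_def using sym3_tensorD(3)[OF assms] by metis

text \<open>Both traces contract the antisymmetric \<open>\<Omega>up\<close> with two symmetric
  indices of P. The first two equations are these traces solved for one component.\<close>

lemma raise_last_trace: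
  assumes "P \<in> sym3_tensors" "c \<in> A" "p \<in> fst c"
  shows "raise_last P c p 1 2 2 = - raise_last P c p 1 1 1" "raise_last P c p 2 2 2 = - raise_last P c p 1 2 1"
    "(\<Sum>m\<in>UNIV. raise_last P c p m j m) = 0" "(\<Sum>m\<in>UNIV. raise_last P c p j m m) = 0"
proof -
  note s = sym3_tensorD(3,4)[OF assms(1)]
  show a: "raise_last P c p 1 2 2 = - raise_last P c p 1 1 1" "raise_last P c p 2 2 2 = - raise_last P c p 1 2 1"
    using s(2)[of c p 1 2 1] s(2)[of c p 2 2 1] s(1)[of c p 1 2 2]
    by (simp_all add: raise_last_components[OF assms(2,3)])
  show "(\<Sum>m\<in>UNIV. raise_last P c p m j m) = 0" "(\<Sum>m\<in>UNIV. raise_last P c p j m m) = 0"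
    using exhaust_2[of j] a raise_last_sym[OF assms(1), of c p 2 1] by (auto simp: sum_2)
qed

lemma raise_last_natural:
  assumes "P \<in> sym3_tensors" "c \<in> A" "d \<in> A" "p \<in> fst c" "p \<in> fst d"
  shows "(\<Sum>k\<in>UNIV. D1 id c d p m k * raise_last P c p i j k)
    = (\<Sum>a\<in>UNIV. \<Sum>b\<in>UNIV. D1 id c d p a i * D1 id c d p b j * raise_last P d p a b m)"
proof -
  let ?J = "D1 id c d p"
  have up: "(\<Sum>a\<in>UNIV. \<Sum>b\<in>UNIV. ?J g a * ?J e b * \<Omega>up c p a b) = \<Omega>up d p g e" for g e
    using Omega_up_natural[OF chart_map_id[OF assms(2,3)] assms(4)] assms(5) Omega_tr2[OF assms(2-5)] by simp
  have "(\<Sum>k\<in>UNIV. ?J m k * raise_last P c p i j k)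
    = (\<Sum>a\<in>UNIV. \<Sum>b\<in>UNIV. ?J a i * ?J b j * (\<Sum>e\<in>UNIV.
        (\<Sum>k\<in>UNIV. \<Sum>n\<in>UNIV. ?J m k * ?J e n * \<Omega>up c p k n) * P d p a b e))"
    unfolding raise_last_def sym3_tensorD(2)[OF assms] tr3_def
    by (simp add: sum_2 algebra_simps)
  then show ?thesis
    unfolding up raise_last_def .
qed

lemma translate_apply:
  "c \<in> A \<Longrightarrow> p \<in> fst c \<Longrightarrow> translate \<Gamma> t P c p i j k = \<Gamma> c p i j k + t * raise_last P c p i j k"
  by (simp add: translate_def on_charts_apply raise_last_def)

text \<open>The difference tensor transforms without second derivatives, so the connection law
  persists. The derivative of \<Omega> changes by a multiple of \<Pi>_mij - \<Pi>_mji, which is zero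
  by symmetry.\<close>

lemma translate_symplectic:
  assumes "\<Gamma> \<in> symplectic_connections" "P \<in> sym3_tensors"
  shows "translate \<Gamma> t P \<in> symplectic_connections"
  unfolding symplectic_connections_def affine_connections_def
proof (intro CollectI conjI ballI allI)
  show "on_charts (translate \<Gamma> t P) = translate \<Gamma> t P" by (simp add: translate_def)
next
  fix c i j k assume c: "c \<in> A"
  show "smooth_comp c (\<lambda>q. translate \<Gamma> t P c q i j k)"
    unfolding smooth_comp_iff[OF c]
  proof
    fix p assume p: "p \<in> fst c"
    show "smooth_at c p (\<lambda>q. translate \<Gamma> t P c q i j k)"
      by (rule smooth_at_cong_chart[OF c p, of "\<lambda>q. \<Gamma> c q i j k + t * raise_last P c q i j k"])
        (use c p translate_apply symplectic_connectionD(2)[OF assms(1) c p] smooth_at_raise_last[OF assms(2) c p]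
          in \<open>auto intro!: smooth_at_add smooth_at_cmult\<close>)
  qed
next
  fix c d p assume c: "c \<in> A" "d \<in> A" and p: "p \<in> fst c \<inter> fst d"
  then have pc: "p \<in> fst c" "p \<in> fst d" by auto
  interpret chart_map M A id id c d by (rule chart_map_id) fact+
  have "conn_related (J p) (H p) (translate \<Gamma> t P c p) (translate \<Gamma> t P d p)"
    unfolding conn_related_def
  proof (intro allI)
    fix i j m
    have "(\<Sum>k\<in>UNIV. J p m k * translate \<Gamma> t P c p i j k)
      = (\<Sum>k\<in>UNIV. J p m k * \<Gamma> c p i j k) + t * (\<Sum>k\<in>UNIV. J p m k * raise_last P c p i j k)"
      using c pc by (simp add: translate_apply sum_2 algebra_simps)
    also have "\<dots> = H p m i j + (\<Sum>a\<in>UNIV. \<Sum>b\<in>UNIV. J p a i * J p b j * translate \<Gamma> t P d p a b m)"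
      unfolding raise_last_natural[OF assms(2) c pc]
        conn_relatedD[OF affine_connection_related[OF symplectic_connectionD(1)[OF assms(1)] c pc]]
      using c pc by (simp add: translate_apply sum_2 algebra_simps)
    finally show "(\<Sum>k\<in>UNIV. J p m k * translate \<Gamma> t P c p i j k)
      = H p m i j + (\<Sum>a\<in>UNIV. \<Sum>b\<in>UNIV. J p a i * J p b j * translate \<Gamma> t P d p a b m)" .
  qed
  then show "translate \<Gamma> t P c p = tr_conn id id c d (translate \<Gamma> t P) p"
    using conn_related_iff_tr_conn[of p "translate \<Gamma> t P" "translate \<Gamma> t P"] pc by simp
next
  fix c p i j k assume cp: "c \<in> A" "p \<in> fst c"
  show "translate \<Gamma> t P c p i j k = translate \<Gamma> t P c p j i k"
    using symplectic_connectionD(3)[OF assms(1) cp] raise_last_sym[OF assms(2)]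
    by (simp add: translate_apply[OF cp])
next
  fix c p m i j assume cp: "c \<in> A" "p \<in> fst c"
  note s = sym3_tensorD(3,4)[OF assms(2)]
  have "cov_tensor2 (translate \<Gamma> t P) \<Omega> c p m i j = cov_tensor2 \<Gamma> \<Omega> c p m i j
    - t * ((\<Sum>a\<in>UNIV. raise_last P c p m i a * \<Omega> c p a j) + (\<Sum>a\<in>UNIV. raise_last P c p m j a * \<Omega> c p i a))"
    unfolding cov_tensor2_def translate_apply[OF cp] by (simp add: sum_2 algebra_simps)
  moreover have "(\<Sum>a\<in>UNIV. raise_last P c p m i a * \<Omega> c p a j) + (\<Sum>a\<in>UNIV. raise_last P c p m j a * \<Omega> c p i a) = 0"
    using exhaust_2[of i] exhaust_2[of j] s(2)[of c p m 1 2] Omega_nonzero[OF cp]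
    by (auto simp: sum_2 raise_last_components[OF cp] Omega_components)
  ultimately show "cov_tensor2 (translate \<Gamma> t P) \<Omega> c p m i j = 0"
    using symplectic_connectionD(4)[OF assms(1) cp] by simp
qed

text \<open>The covariant divergence \<nabla>_m Q_ij^m in coordinates; for the difference tensor it
  is the first variation of the Ricci tensor.\<close>

definition div_tensor :: "'a field3 \<Rightarrow> 'a field3 \<Rightarrow> 'a field2" where
  "div_tensor \<Gamma> Q c p i j = (\<Sum>m\<in>UNIV. pd c m (\<lambda>q. Q c q i j m) p
     + (\<Sum>n\<in>UNIV. \<Gamma> c p m n m * Q c p i j n - \<Gamma> c p m i n * Q c p n j m - \<Gamma> c p m j n * Q c p i n m))"

definition quad_tensor :: "'a field3 \<Rightarrow> 'a field2" where
  "quad_tensor Q c p i j = (\<Sum>m\<in>UNIV. \<Sum>n\<in>UNIV. Q c p i n m * Q c p m j n)"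

lemma ricci_formula:
  assumes "\<Gamma> \<in> symplectic_connections" "c \<in> A" "p \<in> fst c"
  shows "ricci \<Gamma> c p i j = (\<Sum>m\<in>UNIV. pd c m (\<lambda>q. \<Gamma> c q i j m) p - pd c i (\<lambda>q. \<Gamma> c q m j m) p
        + (\<Sum>n\<in>UNIV. \<Gamma> c p m n m * \<Gamma> c p i j n - \<Gamma> c p i n m * \<Gamma> c p m j n))"
  unfolding ricci_def
  by (rule sum.cong[OF refl], rule curv_formula) (use assms symplectic_connectionD in blast)+

text \<open>In the general variation there also occur the derivative of the trace \<Pi>_mj^m and its
  product with \<Pi>_ij^n; both vanish because \<Pi> is trace-free. What remains is quadratic in
  t.\<close>

lemma ricci_translate:
  assumes "\<Gamma> \<in> symplectic_connections" "P \<in> sym3_tensors" "c \<in> A" "p \<in> fst c"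
  shows "ricci (translate \<Gamma> t P) c p i j = ricci \<Gamma> c p i j
     + t * div_tensor \<Gamma> (raise_last P) c p i j + t\<^sup>2 * (- quad_tensor (raise_last P) c p i j)"
proof -
  let ?Q = "raise_last P"
  note cp = assms(3,4)
  note tr = raise_last_trace(3)[OF assms(2) cp]
  have pt: "pd c m (\<lambda>q. translate \<Gamma> t P c q i j k) p = pd c m (\<lambda>q. \<Gamma> c q i j k) p + t * pd c m (\<lambda>q. ?Q c q i j k) p" for m i j k
  proof -
    have "pd c m (\<lambda>q. translate \<Gamma> t P c q i j k) p = pd c m (\<lambda>q. \<Gamma> c q i j k + t * ?Q c q i j k) p"
      by (rule pd_cong_chart[OF cp]) (rule translate_apply[OF cp(1)])
    then show ?thesis
      using symplectic_connectionD(2)[OF assms(1) cp] smooth_at_raise_last[OF assms(2) cp]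
      by (simp add: pd_add pd_cmult smooth_at_cmult)
  qed
  have dtr: "(\<Sum>m\<in>UNIV. pd c i (\<lambda>q. ?Q c q m j m) p) = 0"
  proof -
    have "(\<Sum>m\<in>UNIV. pd c i (\<lambda>q. ?Q c q m j m) p) = pd c i (\<lambda>q. \<Sum>m\<in>UNIV. ?Q c q m j m) p"
      by (rule pd_sum[symmetric]) (use cp smooth_at_raise_last[OF assms(2)] in auto)
    also have "\<dots> = pd c i (\<lambda>q. 0) p"
      by (rule pd_cong_chart[OF cp]) (rule raise_last_trace(3)[OF assms(2) cp(1)])
    finally show ?thesis by simp
  qed
  have G: "\<Gamma> c p 2 1 k = \<Gamma> c p 1 2 k" for k by (rule symplectic_connectionD(3)[OF assms(1) cp])
  have Q: "?Q c p 2 1 k = ?Q c p 1 2 k" for k by (rule raise_last_sym[OF assms(2)])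
  have ij: "i = 1 \<or> i = 2" "j = 1 \<or> j = 2" using exhaust_2 by blast+
  have "ricci (translate \<Gamma> t P) c p i j
    = ricci \<Gamma> c p i j + t * (\<Sum>m\<in>UNIV. pd c m (\<lambda>q. ?Q c q i j m) p
         + (\<Sum>n\<in>UNIV. \<Gamma> c p m n m * ?Q c p i j n - \<Gamma> c p i n m * ?Q c p m j n - \<Gamma> c p m j n * ?Q c p i n m))
      - t * (\<Sum>m\<in>UNIV. pd c i (\<lambda>q. ?Q c q m j m) p)
      + t * (\<Sum>n\<in>UNIV. (\<Sum>m\<in>UNIV. ?Q c p m n m) * \<Gamma> c p i j n)
      + t\<^sup>2 * ((\<Sum>n\<in>UNIV. (\<Sum>m\<in>UNIV. ?Q c p m n m) * ?Q c p i j n) - quad_tensor ?Q c p i j)"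
    unfolding ricci_formula[OF translate_symplectic[OF assms(1,2)] cp] ricci_formula[OF assms(1) cp]
      pt translate_apply[OF cp] quad_tensor_def
    by (simp add: sum_2 algebra_simps power2_eq_square)
  then show ?thesis
    unfolding tr dtr div_tensor_def using ij by (auto simp: sum_2 G Q algebra_simps)
qed

lemma smooth_at_div_tensor:
  assumes "\<Gamma> \<in> symplectic_connections" "P \<in> sym3_tensors" "c \<in> A" "p \<in> fst c"
  shows "smooth_at c p (\<lambda>q. div_tensor \<Gamma> (raise_last P) c q i j)"
  unfolding div_tensor_def
  using assms symplectic_connectionD(2)[OF assms(1)] smooth_at_raise_last[OF assms(2)]
  by (intro smooth_at_sum smooth_at_add smooth_at_diff smooth_at_mult smooth_at_pd) auto

lemma smooth_at_quad_tensor: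
  assumes "P \<in> sym3_tensors" "c \<in> A" "p \<in> fst c"
  shows "smooth_at c p (\<lambda>q. quad_tensor (raise_last P) c q i j)"
  unfolding quad_tensor_def using assms smooth_at_raise_last[OF assms(1)]
  by (intro smooth_at_sum smooth_at_mult) auto

text \<open>The t-linear coefficient of the covariant derivative of the Ricci tensor: the old
  connection acting on the varied Ricci tensor, and the difference tensor acting on the old
  one.\<close>

definition first_variation :: "'a field3 \<Rightarrow> 'a field3 \<Rightarrow> 'a field3" where
  "first_variation \<Gamma> Q c p m i j = cov_tensor2 \<Gamma> (div_tensor \<Gamma> Q) c p m i j
     - (\<Sum>n\<in>UNIV. Q c p m i n * ricci \<Gamma> c p n j) - (\<Sum>n\<in>UNIV. Q c p m j n * ricci \<Gamma> c p i n)"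

text \<open>A quadratic Ricci tensor differentiated by a connection affine in t gives a cubic. Only
  the degree and the linear coefficient matter later, so the other two coefficients are
  hidden.\<close>

lemma cov_ricci_translate:
  assumes "\<Gamma> \<in> symplectic_connections" "P \<in> sym3_tensors" "c \<in> A" "p \<in> fst c"
  shows "\<exists>k2 k3. \<forall>t. cov_tensor2 (translate \<Gamma> t P) (ricci (translate \<Gamma> t P)) c p m i j
    = cov_tensor2 \<Gamma> (ricci \<Gamma>) c p m i j + t * first_variation \<Gamma> (raise_last P) c p m i j + t\<^sup>2 * k2 + t ^ 3 * k3"
proof -
  let ?Q = "raise_last P" and ?B = "div_tensor \<Gamma> (raise_last P)" and ?C = "quad_tensor (raise_last P)"
  note cp = assms(3,4)
  note smooth = smooth_at_ricci[where \<Gamma> = \<Gamma>, OF cp symplectic_connectionD(2)[OF assms(1) cp]]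
    smooth_at_div_tensor[OF assms] smooth_at_quad_tensor[OF assms(2) cp]
  have pt: "pd c m (\<lambda>q. ricci (translate \<Gamma> t P) c q i j) p
    = pd c m (\<lambda>q. ricci \<Gamma> c q i j) p + t * pd c m (\<lambda>q. ?B c q i j) p + t\<^sup>2 * (- pd c m (\<lambda>q. ?C c q i j) p)" for t
  proof -
    have "pd c m (\<lambda>q. ricci (translate \<Gamma> t P) c q i j) p
      = pd c m (\<lambda>q. ricci \<Gamma> c q i j + t * ?B c q i j + t\<^sup>2 * (- ?C c q i j)) p"
      by (rule pd_cong_chart[OF cp]) (rule ricci_translate[OF assms(1-3)])
    also have "\<dots> = pd c m (\<lambda>q. ricci \<Gamma> c q i j) p + t * pd c m (\<lambda>q. ?B c q i j) p + t\<^sup>2 * (- pd c m (\<lambda>q. ?C c q i j) p)"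
      using smooth by (simp add: pd_add pd_diff pd_cmult smooth_at_add smooth_at_cmult)
    finally show ?thesis .
  qed
  let ?k2 = "- cov_tensor2 \<Gamma> ?C c p m i j - (\<Sum>n\<in>UNIV. ?Q c p m i n * ?B c p n j) - (\<Sum>n\<in>UNIV. ?Q c p m j n * ?B c p i n)"
  let ?k3 = "(\<Sum>n\<in>UNIV. ?Q c p m i n * ?C c p n j) + (\<Sum>n\<in>UNIV. ?Q c p m j n * ?C c p i n)"
  have "cov_tensor2 (translate \<Gamma> t P) (ricci (translate \<Gamma> t P)) c p m i j
    = cov_tensor2 \<Gamma> (ricci \<Gamma>) c p m i j + t * first_variation \<Gamma> ?Q c p m i j + t\<^sup>2 * ?k2 + t ^ 3 * ?k3" for t
    unfolding cov_tensor2_def first_variation_def pt translate_apply[OF cp] ricci_translate[OF assms]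
    by (simp add: sum_2 algebra_simps power2_eq_square power3_eq_cube)
  then show ?thesis by blast
qed

text \<open>The antisymmetric part of Ricci is the curl of the trace of the Christoffel symbols.
  Since \<Omega> is parallel, that trace is the logarithmic derivative of \<Omega>_12, whose curl is
  zero.\<close>

lemma ricci_symmetric:
  assumes "\<Gamma> \<in> symplectic_connections" "c \<in> A" "p \<in> fst c"
  shows "ricci \<Gamma> c p 1 2 = ricci \<Gamma> c p 2 1"
proof -
  let ?w = "\<lambda>q. \<Omega> c q 1 2"
  note cp = assms(2,3)
  have tr: "(\<Sum>m\<in>UNIV. \<Gamma> c q m i m) = pd c i ?w q * inverse (?w q)" if q: "q \<in> fst c" for q i
  proof -
    have "cov_tensor2 \<Gamma> \<Omega> c q i 1 2 = pd c i ?w q - (\<Sum>m\<in>UNIV. \<Gamma> c q i m m) * ?w q"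
      by (simp add: cov_tensor2_def sum_2 Omega_components algebra_simps)
    moreover have "cov_tensor2 \<Gamma> \<Omega> c q i 1 2 = 0"
      by (rule symplectic_connectionD(4)[OF assms(1,2) q])
    moreover have "(\<Sum>m\<in>UNIV. \<Gamma> c q i m m) = (\<Sum>m\<in>UNIV. \<Gamma> c q m i m)"
      using symplectic_connectionD(3)[OF assms(1,2) q] by metis
    ultimately show ?thesis
      using Omega_nonzero[OF assms(2) q] by (simp add: field_simps)
  qed
  have w: "smooth_at c p ?w" "?w p \<noteq> 0" using Omega_smooth[OF cp] Omega_nonzero[OF cp] by auto
  have d: "(\<Sum>m\<in>UNIV. pd c j (\<lambda>q. \<Gamma> c q m i m) p)
      = pd c j (pd c i ?w) p * inverse (?w p) - pd c i ?w p * pd c j ?w p * (inverse (?w p) * inverse (?w p))" for i j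
  proof -
    have "(\<Sum>m\<in>UNIV. pd c j (\<lambda>q. \<Gamma> c q m i m) p) = pd c j (\<lambda>q. \<Sum>m\<in>UNIV. \<Gamma> c q m i m) p"
      by (rule pd_sum[symmetric]) (use cp symplectic_connectionD(2)[OF assms(1)] in auto)
    also have "\<dots> = pd c j (\<lambda>q. pd c i ?w q * inverse (?w q)) p"
      by (rule pd_cong_chart[OF cp]) (rule tr)
    also have "\<dots> = pd c j (pd c i ?w) p * inverse (?w p) - pd c i ?w p * pd c j ?w p * (inverse (?w p) * inverse (?w p))"
      by (subst pd_mult) (use w in \<open>simp_all add: smooth_at_pd smooth_at_inverse pd_inverse\<close>)
    finally show ?thesis .
  qed
  have eq: "(\<Sum>m\<in>UNIV. pd c 1 (\<lambda>q. \<Gamma> c q m 2 m) p) = (\<Sum>m\<in>UNIV. pd c 2 (\<lambda>q. \<Gamma> c q m 1 m) p)"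
    unfolding d using pd_commute[OF w(1), of 1 2] by simp
  have dG: "pd c m (\<lambda>q. \<Gamma> c q 2 1 k) p = pd c m (\<lambda>q. \<Gamma> c q 1 2 k) p" for m k
    by (rule pd_cong_chart[OF cp]) (rule symplectic_connectionD(3)[OF assms(1,2)])
  have G: "\<Gamma> c p 2 1 k = \<Gamma> c p 1 2 k" for k by (rule symplectic_connectionD(3)[OF assms(1) cp])
  show ?thesis
    unfolding ricci_formula[OF assms] using eq by (simp add: sum_2 G dG algebra_simps)
qed

text \<open>With only two index values, one of the two terms of the Ricci trace vanishes by
  antisymmetry, so each Ricci component is a single curvature component.\<close>

lemma curv_from_ricci:
  "curv \<Gamma> c p i j a k = - curv \<Gamma> c p j i a k"
  "curv \<Gamma> c p 1 2 j 1 = ricci \<Gamma> c p 2 j" "curv \<Gamma> c p 1 2 j 2 = - ricci \<Gamma> c p 1 j"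
  by (simp_all add: curv_def ricci_def sum_2)

text \<open>Lowering the last index of the Lie derivative undoes one of the three raisings of P up
  to sign, a second raising produces \<open>raise_last P\<close>, and the factor \<Omega>_12 cancels
  the third, which leaves an antisymmetrisation in the first slot.\<close>

lemma action_pairing_formula:
  assumes "\<Gamma> \<in> symplectic_connections" "P \<in> sym3_tensors" "c \<in> A" "p \<in> fst c"
  shows "\<Omega> c p 1 2 * (\<Sum>i\<in>UNIV. \<Sum>j\<in>UNIV. \<Sum>k\<in>UNIV. inf_action X \<Gamma> c p i j k * raise3 P c p i j k)
    = - (\<Sum>j\<in>UNIV. \<Sum>m\<in>UNIV. lie_conn X \<Gamma> c p 1 j m * raise_last P c p 2 m j
          - lie_conn X \<Gamma> c p 2 j m * raise_last P c p 1 m j)"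
proof -
  note cp = assms(3,4)
  note s = sym3_tensorD(3,4)[OF assms(2)]
  have P: "P c p 2 1 1 = P c p 1 1 2" "P c p 1 2 1 = P c p 1 1 2" "P c p 2 1 2 = P c p 1 2 2" "P c p 2 2 1 = P c p 1 2 2"
    using s(1)[of c p 2 1 1] s(2)[of c p 1 2 1] s(1)[of c p 2 1 2] s(2)[of c p 2 2 1] by auto
  show ?thesis
    using Omega_nonzero[OF cp]
    by (simp add: inf_action_def on_charts_apply[OF cp] raise3_def sum_2 Omega_components
        Omega_up_components[OF cp] raise_last_components[OF cp] P field_simps)
qed

text \<open>The vector density whose coordinate divergence appears in
  \<open>second_variation_divergence\<close>, with free index b and the two values of the
  antisymmetric symbol written out.\<close>

definition density_field :: "'a field3 \<Rightarrow> 'a field3 \<Rightarrow> 'a field1 \<Rightarrow> 'a chart \<Rightarrow> 2 \<Rightarrow> 'a \<Rightarrow> real" where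
  "density_field \<Gamma> Q Z c b q = (if b = 1
     then - (\<Sum>i\<in>UNIV. Z c q i * div_tensor \<Gamma> Q c q i 2)
          - (\<Sum>i\<in>UNIV. cov_vec \<Gamma> Z c q 2 i * Q c q i 1 1 - cov_vec \<Gamma> Z c q 1 i * Q c q i 2 1)
     else (\<Sum>i\<in>UNIV. Z c q i * div_tensor \<Gamma> Q c q i 1)
          - (\<Sum>i\<in>UNIV. cov_vec \<Gamma> Z c q 2 i * Q c q i 1 2 - cov_vec \<Gamma> Z c q 1 i * Q c q i 2 2))"

lemma smooth_at_density_field:
  assumes "\<Gamma> \<in> symplectic_connections" "P \<in> sym3_tensors" "c \<in> A" "p \<in> fst c"
    "\<And>k. smooth_at c p (\<lambda>q. Z c q k)"
  shows "smooth_at c p (density_field \<Gamma> (raise_last P) Z c b)"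
proof -
  note cp = assms(3,4)
  note smooth = assms(5) smooth_at_div_tensor[OF assms(1-4)] smooth_at_raise_last[OF assms(2-4)]
    smooth_at_cov_vec[where \<Gamma> = \<Gamma> and X = Z, OF cp assms(5) symplectic_connectionD(2)[OF assms(1) cp]]
  show ?thesis
    using exhaust_2[of b] unfolding density_field_def
    by (auto intro!: smooth_at_diff smooth_at_minus smooth_at_sum smooth_at_mult smooth cp)
qed

text \<open>Multiplication by \<Omega>_12 turns scalars into densities. By
  \<open>trace_free_contraction\<close> the Ricci terms of the variation cancel the curvature term
  of the Lie derivative; the second-order terms left over form a divergence. Z is a general field
  because the identity is applied to cut-off fields.\<close>

lemma moment_identity:
  assumes "\<Gamma> \<in> symplectic_connections" "P \<in> sym3_tensors" "c \<in> A" "p \<in> fst c"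
    "\<And>k. smooth_at c p (\<lambda>q. Z c q k)"
  shows "\<Omega> c p 1 2 * ((\<Sum>i\<in>UNIV. Z c p i * (\<Sum>a\<in>UNIV. \<Sum>b\<in>UNIV. \<Omega>up c p a b * first_variation \<Gamma> (raise_last P) c p b i a))
      - (\<Sum>i\<in>UNIV. \<Sum>j\<in>UNIV. \<Sum>k\<in>UNIV. inf_action Z \<Gamma> c p i j k * raise3 P c p i j k))
    = (\<Sum>b\<in>UNIV. pd c b (density_field \<Gamma> (raise_last P) Z c b) p)"
proof -
  note cp = assms(3,4)
  let ?Q = "raise_last P"
  let ?B = "div_tensor \<Gamma> ?Q"
  let ?ric = "ricci \<Gamma> c p"
  note sZ = assms(5) and sB = smooth_at_div_tensor[OF assms(1-4)] and sQ = smooth_at_raise_last[OF assms(2-4)]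
  note sN = smooth_at_cov_vec[where \<Gamma> = \<Gamma> and X = Z, OF cp assms(5) symplectic_connectionD(2)[OF assms(1) cp]]
  have Qs: "?Q c q 2 1 k = ?Q c q 1 2 k" for q k by (rule raise_last_sym[OF assms(2)])
  have dQ: "pd c m (\<lambda>q. ?Q c q 2 1 k) p = pd c m (\<lambda>q. ?Q c q 1 2 k) p" for m k
    by (simp only: Qs)
  have "\<Omega> c p 1 2 * (\<Sum>i\<in>UNIV. Z c p i * (\<Sum>a\<in>UNIV. \<Sum>b\<in>UNIV. \<Omega>up c p a b * first_variation \<Gamma> ?Q c p b i a))
    = (\<Sum>i\<in>UNIV. Z c p i * (first_variation \<Gamma> ?Q c p 2 i 1 - first_variation \<Gamma> ?Q c p 1 i 2))"
    using Omega_nonzero[OF cp] by (simp add: sum_2 Omega_up_components[OF cp] field_simps)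
  also have "\<dots> = (\<Sum>i\<in>UNIV. Z c p i * (cov_tensor2 \<Gamma> ?B c p 2 i 1 - cov_tensor2 \<Gamma> ?B c p 1 i 2))
     - (\<Sum>i\<in>UNIV. Z c p i * ((\<Sum>n\<in>UNIV. ?Q c p 2 i n * ?ric n 1) - (\<Sum>n\<in>UNIV. ?Q c p 1 i n * ?ric n 2)))"
    unfolding first_variation_def by (simp add: sum_2 Qs algebra_simps)
  also have "(\<Sum>i\<in>UNIV. Z c p i * ((\<Sum>n\<in>UNIV. ?Q c p 2 i n * ?ric n 1) - (\<Sum>n\<in>UNIV. ?Q c p 1 i n * ?ric n 2)))
    = (\<Sum>j\<in>UNIV. \<Sum>m\<in>UNIV. (\<Sum>n\<in>UNIV. Z c p n * curv \<Gamma> c p n 1 j m) * ?Q c p 2 m j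
         - (\<Sum>n\<in>UNIV. Z c p n * curv \<Gamma> c p n 2 j m) * ?Q c p 1 m j)"
    by (rule trace_free_contraction[OF Qs ricci_symmetric[OF assms(1) cp]]) (rule curv_from_ricci)+
  finally have V: "\<Omega> c p 1 2 * (\<Sum>i\<in>UNIV. Z c p i * (\<Sum>a\<in>UNIV. \<Sum>b\<in>UNIV. \<Omega>up c p a b * first_variation \<Gamma> ?Q c p b i a))
    = (\<Sum>i\<in>UNIV. Z c p i * (cov_tensor2 \<Gamma> ?B c p 2 i 1 - cov_tensor2 \<Gamma> ?B c p 1 i 2))
     - (\<Sum>j\<in>UNIV. \<Sum>m\<in>UNIV. (\<Sum>n\<in>UNIV. Z c p n * curv \<Gamma> c p n 1 j m) * ?Q c p 2 m j
         - (\<Sum>n\<in>UNIV. Z c p n * curv \<Gamma> c p n 2 j m) * ?Q c p 1 m j)" .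
  have "\<Omega> c p 1 2 * ((\<Sum>i\<in>UNIV. Z c p i * (\<Sum>a\<in>UNIV. \<Sum>b\<in>UNIV. \<Omega>up c p a b * first_variation \<Gamma> ?Q c p b i a))
      - (\<Sum>i\<in>UNIV. \<Sum>j\<in>UNIV. \<Sum>k\<in>UNIV. inf_action Z \<Gamma> c p i j k * raise3 P c p i j k))
    = (\<Sum>i\<in>UNIV. Z c p i * (cov_tensor2 \<Gamma> ?B c p 2 i 1 - cov_tensor2 \<Gamma> ?B c p 1 i 2))
      + (\<Sum>j\<in>UNIV. \<Sum>m\<in>UNIV. hess_vec \<Gamma> Z c p 1 j m * ?Q c p 2 m j - hess_vec \<Gamma> Z c p 2 j m * ?Q c p 1 m j)"
    unfolding right_diff_distrib V action_pairing_formula[OF assms(1-4)] lie_conn_def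
    by (simp add: sum_2 algebra_simps)
  also have "\<dots> = - (\<Sum>i\<in>UNIV. Z c p i * pd c 1 (\<lambda>q. ?B c q i 2) p + pd c 1 (\<lambda>q. Z c q i) p * ?B c p i 2)
      - (\<Sum>i\<in>UNIV. cov_vec \<Gamma> Z c p 2 i * pd c 1 (\<lambda>q. ?Q c q i 1 1) p + pd c 1 (\<lambda>q. cov_vec \<Gamma> Z c q 2 i) p * ?Q c p i 1 1
         - (cov_vec \<Gamma> Z c p 1 i * pd c 1 (\<lambda>q. ?Q c q i 2 1) p + pd c 1 (\<lambda>q. cov_vec \<Gamma> Z c q 1 i) p * ?Q c p i 2 1))
      + ((\<Sum>i\<in>UNIV. Z c p i * pd c 2 (\<lambda>q. ?B c q i 1) p + pd c 2 (\<lambda>q. Z c q i) p * ?B c p i 1)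
      - (\<Sum>i\<in>UNIV. cov_vec \<Gamma> Z c p 2 i * pd c 2 (\<lambda>q. ?Q c q i 1 2) p + pd c 2 (\<lambda>q. cov_vec \<Gamma> Z c q 2 i) p * ?Q c p i 1 2
         - (cov_vec \<Gamma> Z c p 1 i * pd c 2 (\<lambda>q. ?Q c q i 2 2) p + pd c 2 (\<lambda>q. cov_vec \<Gamma> Z c q 1 i) p * ?Q c p i 2 2)))"
    by (rule second_variation_divergence[where G = "\<Gamma> c p" and dN = "\<lambda>m a i. pd c m (\<lambda>q. cov_vec \<Gamma> Z c q a i) p"
          and dP = "\<lambda>m i j k. pd c m (\<lambda>q. ?Q c q i j k) p"
          and dB = "\<lambda>m i j. pd c m (\<lambda>q. ?B c q i j) p" and dZ = "\<lambda>m i. pd c m (\<lambda>q. Z c q i) p"])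
      (simp_all add: symplectic_connectionD(3)[OF assms(1) cp, of 2 1] Qs dQ
        raise_last_trace(1,2)[OF assms(2) cp] cov_vec_def hess_vec_def cov_mixed_def cov_tensor2_def div_tensor_def)
  also have "\<dots> = (\<Sum>b\<in>UNIV. pd c b (density_field \<Gamma> ?Q Z c b) p)"
    unfolding density_field_def using sZ sB sQ sN cp
    by (simp add: sum_2[where 'a = real] pd_add pd_diff pd_minus pd_mult smooth_at_add smooth_at_diff smooth_at_minus smooth_at_mult)
  finally show ?thesis .
qed

end

section \<open>The moment map\<close>

context symplectic_surface
begin

lemma vector_fieldD:
  assumes "X \<in> vector_fields"
  shows "c \<in> A \<Longrightarrow> p \<in> fst c \<Longrightarrow> smooth_at c p (\<lambda>q. X c q k)"
    "c \<in> A \<Longrightarrow> d \<in> A \<Longrightarrow> p \<in> fst c \<Longrightarrow> p \<in> fst d \<Longrightarrow> X c p k = (\<Sum>m\<in>UNIV. D1 id d c p k m * X d p m)"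
    "\<not> (c \<in> A \<and> p \<in> fst c) \<Longrightarrow> X c p k = 0"
proof -
  show "c \<in> A \<Longrightarrow> p \<in> fst c \<Longrightarrow> smooth_at c p (\<lambda>q. X c q k)"
    using assms by (simp add: vector_fields_def smooth_comp_iff)
  show "c \<in> A \<Longrightarrow> d \<in> A \<Longrightarrow> p \<in> fst c \<Longrightarrow> p \<in> fst d \<Longrightarrow> X c p k = (\<Sum>m\<in>UNIV. D1 id d c p k m * X d p m)"
    using assms unfolding vector_fields_def by blast
  have "on_charts X = X" using assms by (simp add: vector_fields_def)
  then have "X c p = on_charts X c p" by simp
  then show "\<not> (c \<in> A \<and> p \<in> fst c) \<Longrightarrow> X c p k = 0"
    by (auto simp: on_charts_def)
qed

lemma chart_around:
  assumes "c \<in> A" "p \<in> fst c"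
  shows "chart_at p \<in> A" "p \<in> fst (chart_at p)"
  using chart_exists subsetD[OF chart_subset[OF assms(1)] assms(2)] by auto

section \<open>Scalar contractions and their independence of the chart\<close>

definition covariant :: "'a field1 \<Rightarrow> bool" where
  "covariant \<alpha> \<longleftrightarrow> (\<forall>c\<in>A. \<forall>p\<in>fst c. (\<forall>i. smooth_at c p (\<lambda>q. \<alpha> c q i)) \<and>
     (\<forall>d\<in>A. p \<in> fst d \<longrightarrow> \<alpha> c p = tr1 id c d \<alpha> p))"

lemma covariant_curvature_one_form:
  "\<Gamma> \<in> symplectic_connections \<Longrightarrow> covariant (curvature_one_form \<Gamma>)"
  by (simp add: covariant_def smooth_at_curvature_one_form curvature_one_form_change_chart)

lemma covariant_exact_form:
  assumes "smooth_scalar f"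
  shows "covariant (exact_form f)"
  unfolding covariant_def
proof (intro ballI conjI allI impI)
  fix c p i assume cp: "c \<in> A" "p \<in> fst c"
  have sf: "smooth_at c p f" using assms cp by (simp add: smooth_scalar_def)
  show "smooth_at c p (\<lambda>q. exact_form f c q i)"
    by (rule smooth_at_cong_chart[OF cp _ smooth_at_pd[OF sf, of i]])
      (simp add: exact_form_def on_charts_apply cp)
  fix d assume d: "d \<in> A" "p \<in> fst d"
  have "pd c i (\<lambda>q. f (id q)) p = (\<Sum>a\<in>UNIV. D1 id c d p a i * pd d a f (id p))" for i
    by (rule smooth_at_compose(2)[OF smooth_map_id cp]) (use assms d in \<open>auto simp: smooth_scalar_def\<close>)
  then show "exact_form f c p = tr1 id c d (exact_form f) p"
    by (simp add: fun_eq_iff exact_form_def on_charts_apply cp d tr1_def)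
qed

definition contract :: "'a field1 \<Rightarrow> 'a field1 \<Rightarrow> 'a \<Rightarrow> real" where
  "contract X \<alpha> p = (\<Sum>i\<in>UNIV. X (chart_at p) p i * \<alpha> (chart_at p) p i)"

lemma contract_in_chart:
  assumes "X \<in> vector_fields" "covariant \<alpha>" "c \<in> A" "p \<in> fst c"
  shows "contract X \<alpha> p = (\<Sum>i\<in>UNIV. X c p i * \<alpha> c p i)"
proof -
  let ?e = "chart_at p"
  note e = chart_around[OF assms(3,4)]
  have X: "X ?e p a = (\<Sum>i\<in>UNIV. D1 id c ?e p a i * X c p i)" for a
    by (rule vector_fieldD(2)[OF assms(1)]) (use assms e in auto)
  have \<alpha>: "\<alpha> c p = tr1 id c ?e \<alpha> p"
    using assms e unfolding covariant_def by blast
  show ?thesis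
    unfolding contract_def X \<alpha> tr1_def by (simp add: sum_2 algebra_simps)
qed

definition supported_in :: "'a field1 \<Rightarrow> 'a set \<Rightarrow> bool" where
  "supported_in X K \<longleftrightarrow> (\<forall>c p k. p \<notin> K \<longrightarrow> X c p k = 0)"

lemma supported_inD: "supported_in X K \<Longrightarrow> p \<notin> K \<Longrightarrow> X c p k = 0"
  unfolding supported_in_def by blast

lemma test_function_contract:
  assumes "X \<in> vector_fields" "covariant \<alpha>" "compactin M K" "supported_in X K"
  shows "test_function (contract X \<alpha>)"
proof (rule test_functionI[OF _ assms(3)])
  fix c p assume cp: "c \<in> A" "p \<in> fst c"
  show "smooth_at c p (contract X \<alpha>)"
    by (rule smooth_at_cong_chart[OF cp, of "\<lambda>q. \<Sum>i\<in>UNIV. X c q i * \<alpha> c q i"])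
      (use contract_in_chart[OF assms(1,2) cp(1)] vector_fieldD(1)[OF assms(1) cp] assms(2) cp in
        \<open>auto simp: covariant_def intro!: smooth_at_sum smooth_at_mult\<close>)
next
  show "contract X \<alpha> p = 0" if "p \<notin> K" for p
    by (simp add: contract_def supported_inD[OF assms(4) that])
qed

lemma supported_vector_field_vanishes:
  assumes "compactin M K" "supported_in X K" "c \<in> A" "p \<in> fst c" "p \<notin> K"
  shows "cov_vec \<Gamma> X c p i k = 0" "lie_conn X \<Gamma> c p i j k = 0"
proof -
  have W: "openin M (topspace M - K)" using closedin_compact[OF assms(1)] by blast
  have in_W: "q \<in> topspace M - K" if "q \<in> fst c" "q \<notin> K" for q using that chart_subset[OF assms(3)] by blast
  have X0: "X c q k = 0" if "q \<notin> K" for q k by (rule supported_inD[OF assms(2) that])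
  have N0: "cov_vec \<Gamma> X c q i k = 0" if "q \<in> fst c" "q \<notin> K" for q i k
  proof -
    have "pd c i (\<lambda>q. X c q k) q = pd c i (\<lambda>q. 0) q"
      by (rule pd_cong[OF assms(3) that(1) W in_W[OF that]]) (simp add: X0)
    then show ?thesis by (simp add: cov_vec_def X0[OF that(2)])
  qed
  then show "cov_vec \<Gamma> X c p i k = 0" using assms by blast
  have "pd c i (\<lambda>q. cov_vec \<Gamma> X c q j k) p = pd c i (\<lambda>q. 0) p"
    by (rule pd_cong[OF assms(3,4) W in_W[OF assms(4,5)]]) (simp add: N0)
  then show "lie_conn X \<Gamma> c p i j k = 0"
    using N0[OF assms(4,5)] X0[OF assms(5)] by (simp add: lie_conn_def hess_vec_def cov_mixed_def)
qed

definition action_scalar :: "'a field3 \<Rightarrow> 'a field3 \<Rightarrow> 'a field1 \<Rightarrow> 'a \<Rightarrow> real" where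
  "action_scalar \<Gamma> P X p = (let c = chart_at p in
     \<Sum>i\<in>UNIV. \<Sum>j\<in>UNIV. \<Sum>k\<in>UNIV. inf_action X \<Gamma> c p i j k * raise3 P c p i j k)"

lemma inf_action_change_chart:
  assumes "\<Gamma> \<in> symplectic_connections" "X \<in> vector_fields" "c \<in> A" "d \<in> A" "p \<in> fst c" "p \<in> fst d"
  shows "inf_action X \<Gamma> c p = tr3 id c d (inf_action X \<Gamma>) p"
proof (intro ext)
  fix i j k
  interpret chart_map M A id id c d by (rule chart_map_id) fact+
  have pD: "p \<in> Dom" using assms by simp
  have L: "(\<Sum>m\<in>UNIV. J p f m * lie_conn X \<Gamma> c p i j m)
    = (\<Sum>e\<in>UNIV. \<Sum>b\<in>UNIV. J p e i * J p b j * lie_conn X \<Gamma> d (id p) e b f)" for f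
  proof (rule lie_conn_natural[OF pD])
    show "conn_related (J q) (H q) (\<Gamma> c q) (\<Gamma> d (id q))" if "q \<in> Dom" for q
      using affine_connection_related[OF symplectic_connectionD(1)[OF assms(1)] charts] that by simp
    show "X d (id q) a = (\<Sum>i\<in>UNIV. J q a i * X c q i)" if "q \<in> Dom" for q a
      using vector_fieldD(2)[OF assms(2) charts(2,1)] that by simp
  qed (use assms vector_fieldD(1)[OF assms(2)] symplectic_connectionD(2,3)[OF assms(1)] in auto)
  have \<Omega>: "\<Omega> c p m k = (\<Sum>f\<in>UNIV. \<Sum>n\<in>UNIV. J p f m * J p n k * \<Omega> d p f n)" for m
    using Omega_tr2[OF assms(3-6)] by (simp add: tr2_def)
  have "inf_action X \<Gamma> c p i j k
    = (\<Sum>f\<in>UNIV. \<Sum>n\<in>UNIV. (\<Sum>m\<in>UNIV. J p f m * lie_conn X \<Gamma> c p i j m) * J p n k * \<Omega> d p f n)"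
    unfolding inf_action_def on_charts_apply[OF assms(3,5)] \<Omega> by (simp add: sum_2 algebra_simps)
  also have "\<dots> = tr3 id c d (inf_action X \<Gamma>) p i j k"
    unfolding L tr3_def inf_action_def id_apply on_charts_apply[OF assms(4,6)] by (simp add: sum_2 algebra_simps)
  finally show "inf_action X \<Gamma> c p i j k = tr3 id c d (inf_action X \<Gamma>) p i j k" .
qed

text \<open>The three index pairs are moved from c to d one at a time by \<open>slot\<close>. Here
  \<alpha>1 and \<alpha>2 carry two and one indices still in c, the others already in d; P1 and P2
  likewise.\<close>

lemma contraction_change_chart:
  assumes "c \<in> A" "d \<in> A" "p \<in> fst c" "p \<in> fst d" "\<alpha> c p = tr3 id c d \<alpha> p" "P c p = tr3 id c d P p"
  shows "(\<Sum>i\<in>UNIV. \<Sum>j\<in>UNIV. \<Sum>k\<in>UNIV. \<alpha> c p i j k * raise3 P c p i j k)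
    = (\<Sum>i\<in>UNIV. \<Sum>j\<in>UNIV. \<Sum>k\<in>UNIV. \<alpha> d p i j k * raise3 P d p i j k)"
proof -
  let ?J = "D1 id c d p"
  have up: "(\<Sum>a\<in>UNIV. \<Sum>b\<in>UNIV. ?J g a * ?J e b * \<Omega>up c p a b) = \<Omega>up d p g e" for g e
    using Omega_up_natural[OF chart_map_id[OF assms(1,2)] assms(3)] assms(4) Omega_tr2[OF assms(1-4)] by simp
  have slot: "(\<Sum>i\<in>UNIV. \<Sum>a\<in>UNIV. \<Omega>up c p i a * F i a) = (\<Sum>g\<in>UNIV. \<Sum>f\<in>UNIV. \<Omega>up d p g f * F' g f)"
    if F: "\<And>i a. F i a = (\<Sum>g\<in>UNIV. \<Sum>f\<in>UNIV. ?J g i * ?J f a * F' g f)" for F F' :: "2 \<Rightarrow> 2 \<Rightarrow> real"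
    unfolding F up[symmetric] by (simp add: sum_2 algebra_simps)
  have nest: "(\<Sum>i\<in>UNIV. \<Sum>j\<in>UNIV. \<Sum>k\<in>UNIV. \<alpha> c p i j k * raise3 P c p i j k)
    = (\<Sum>i\<in>UNIV. \<Sum>a\<in>UNIV. \<Omega>up c p i a * (\<Sum>j\<in>UNIV. \<Sum>b\<in>UNIV. \<Omega>up c p j b *
        (\<Sum>k\<in>UNIV. \<Sum>e\<in>UNIV. \<Omega>up c p k e * (\<alpha> c p i j k * P c p a b e))))"
    if "c \<in> A" "p \<in> fst c" for c
    unfolding raise3_def by (simp add: sum_2 Omega_up_components[OF that] algebra_simps)
  define \<alpha>2 where "\<alpha>2 i b n = (\<Sum>e\<in>UNIV. ?J e i * \<alpha> d p e b n)" for i b n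
  define \<alpha>1 where "\<alpha>1 i j n = (\<Sum>b\<in>UNIV. ?J b j * \<alpha>2 i b n)" for i j n
  define P2 where "P2 i b n = (\<Sum>e\<in>UNIV. ?J e i * P d p e b n)" for i b n
  define P1 where "P1 i j n = (\<Sum>b\<in>UNIV. ?J b j * P2 i b n)" for i j n
  have \<alpha>c: "\<alpha> c p i j k = (\<Sum>n\<in>UNIV. ?J n k * \<alpha>1 i j n)" for i j k
    unfolding assms(5) tr3_def \<alpha>1_def \<alpha>2_def by (simp add: sum_2 algebra_simps)
  have Pc: "P c p i j k = (\<Sum>n\<in>UNIV. ?J n k * P1 i j n)" for i j k
    unfolding assms(6) tr3_def P1_def P2_def by (simp add: sum_2 algebra_simps)
  have 1: "(\<Sum>k\<in>UNIV. \<Sum>e\<in>UNIV. \<Omega>up c p k e * (\<alpha> c p i j k * P c p a b e))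
    = (\<Sum>k\<in>UNIV. \<Sum>e\<in>UNIV. \<Omega>up d p k e * (\<alpha>1 i j k * P1 a b e))" for i j a b
    by (rule slot) (simp add: \<alpha>c Pc sum_2 algebra_simps)
  have 2: "(\<Sum>j\<in>UNIV. \<Sum>b\<in>UNIV. \<Omega>up c p j b * (\<Sum>k\<in>UNIV. \<Sum>e\<in>UNIV. \<Omega>up d p k e * (\<alpha>1 i j k * P1 a b e)))
    = (\<Sum>j\<in>UNIV. \<Sum>b\<in>UNIV. \<Omega>up d p j b * (\<Sum>k\<in>UNIV. \<Sum>e\<in>UNIV. \<Omega>up d p k e * (\<alpha>2 i j k * P2 a b e)))" for i a
    by (rule slot) (simp add: \<alpha>1_def P1_def sum_2 algebra_simps)
  have 3: "(\<Sum>i\<in>UNIV. \<Sum>a\<in>UNIV. \<Omega>up c p i a * (\<Sum>j\<in>UNIV. \<Sum>b\<in>UNIV. \<Omega>up d p j b *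
        (\<Sum>k\<in>UNIV. \<Sum>e\<in>UNIV. \<Omega>up d p k e * (\<alpha>2 i j k * P2 a b e))))
    = (\<Sum>i\<in>UNIV. \<Sum>a\<in>UNIV. \<Omega>up d p i a * (\<Sum>j\<in>UNIV. \<Sum>b\<in>UNIV. \<Omega>up d p j b *
        (\<Sum>k\<in>UNIV. \<Sum>e\<in>UNIV. \<Omega>up d p k e * (\<alpha> d p i j k * P d p a b e))))"
    by (rule slot) (simp add: \<alpha>2_def P2_def sum_2 Omega_up_components[OF assms(2,4)] algebra_simps)
  show ?thesis
    unfolding nest[OF assms(1,3)] nest[OF assms(2,4)] 1 2 3 ..
qed

lemma action_scalar_in_chart:
  assumes "\<Gamma> \<in> symplectic_connections" "P \<in> sym3_tensors" "X \<in> vector_fields" "c \<in> A" "p \<in> fst c"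
  shows "action_scalar \<Gamma> P X p = (\<Sum>i\<in>UNIV. \<Sum>j\<in>UNIV. \<Sum>k\<in>UNIV. inf_action X \<Gamma> c p i j k * raise3 P c p i j k)"
  unfolding action_scalar_def Let_def
  by (rule contraction_change_chart)
    (use assms chart_around[OF assms(4,5)] inf_action_change_chart[OF assms(1,3)] sym3_tensorD(2)[OF assms(2)] in simp_all)

lemma test_function_action_scalar:
  assumes "\<Gamma> \<in> symplectic_connections" "P \<in> sym3_tensors" "X \<in> vector_fields" "compactin M K" "supported_in X K"
  shows "test_function (action_scalar \<Gamma> P X)"
proof (rule test_functionI[OF _ assms(4)])
  fix c p assume cp: "c \<in> A" "p \<in> fst c"
  have sl: "smooth_at c p (\<lambda>q. lie_conn X \<Gamma> c q i j k)" for i j k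
    by (rule smooth_at_lie_conn[where X = X and \<Gamma> = \<Gamma>, OF cp vector_fieldD(1)[OF assms(3) cp] symplectic_connectionD(2)[OF assms(1) cp]])
  have "smooth_at c p (\<lambda>q. \<Sum>m\<in>UNIV. lie_conn X \<Gamma> c q i j m * \<Omega> c q m k)" for i j k
    using cp sl Omega_smooth[OF cp] by (intro smooth_at_sum smooth_at_mult) auto
  then have si: "smooth_at c p (\<lambda>q. inf_action X \<Gamma> c q i j k)" for i j k
    by (rule smooth_at_cong_chart[OF cp, rotated]) (simp add: inf_action_def on_charts_apply cp)
  have "smooth_at c p (\<lambda>q. raise3 P c q i j k)" for i j k
    unfolding raise3_def using cp sym3_tensorD(1)[OF assms(2) cp] smooth_at_Omega_up[OF cp]
    by (intro smooth_at_sum smooth_at_mult) auto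
  with si have "smooth_at c p (\<lambda>q. \<Sum>i\<in>UNIV. \<Sum>j\<in>UNIV. \<Sum>k\<in>UNIV. inf_action X \<Gamma> c q i j k * raise3 P c q i j k)"
    using cp by (intro smooth_at_sum smooth_at_mult) auto
  then show "smooth_at c p (action_scalar \<Gamma> P X)"
    by (rule smooth_at_cong_chart[OF cp, rotated]) (rule action_scalar_in_chart[OF assms(1-3) cp(1), symmetric])
next
  fix p assume p: "p \<in> topspace M" "p \<notin> K"
  note e = chart_exists[OF p(1)]
  show "action_scalar \<Gamma> P X p = 0"
    by (simp add: action_scalar_def Let_def inf_action_def on_charts_apply[OF e]
        supported_vector_field_vanishes(2)[OF assms(4,5) e p(2)])
qed

section \<open>The pairing as a cubic polynomial in t\<close>

definition rho_pairing :: "'a field3 \<Rightarrow> 'a field3 \<Rightarrow> 'a field1 \<Rightarrow> real \<Rightarrow> 'a \<Rightarrow> real" where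
  "rho_pairing \<Gamma> P X t = contract X (curvature_one_form (translate \<Gamma> t P))"

lemma rho_pairing_cubic:
  assumes "\<Gamma> \<in> symplectic_connections" "P \<in> sym3_tensors" "X \<in> vector_fields" "c \<in> A" "p \<in> fst c"
  shows "\<exists>k0 k2 k3. \<forall>t. rho_pairing \<Gamma> P X t p = k0 + t * (2 * (\<Sum>i\<in>UNIV. X c p i *
      (\<Sum>a\<in>UNIV. \<Sum>b\<in>UNIV. \<Omega>up c p a b * first_variation \<Gamma> (raise_last P) c p b i a))) + t\<^sup>2 * k2 + t ^ 3 * k3"
proof -
  note cp = assms(4,5)
  obtain k2 k3 where k: "\<And>t m i j. cov_tensor2 (translate \<Gamma> t P) (ricci (translate \<Gamma> t P)) c p m i j
    = cov_tensor2 \<Gamma> (ricci \<Gamma>) c p m i j + t * first_variation \<Gamma> (raise_last P) c p m i j + t\<^sup>2 * k2 m i j + t ^ 3 * k3 m i j"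
    using cov_ricci_translate[OF assms(1,2) cp] by metis
  let ?S = "\<lambda>F. 2 * (\<Sum>i\<in>UNIV. X c p i * (\<Sum>a\<in>UNIV. \<Sum>b\<in>UNIV. \<Omega>up c p a b * F b i a))"
  have "rho_pairing \<Gamma> P X t p = ?S (cov_tensor2 \<Gamma> (ricci \<Gamma>) c p) + t * ?S (first_variation \<Gamma> (raise_last P) c p)
     + t\<^sup>2 * ?S k2 + t ^ 3 * ?S k3" for t
  proof -
    have "rho_pairing \<Gamma> P X t p = (\<Sum>i\<in>UNIV. X c p i * curvature_one_form (translate \<Gamma> t P) c p i)"
      unfolding rho_pairing_def
      by (rule contract_in_chart[OF assms(3) covariant_curvature_one_form[OF translate_symplectic[OF assms(1,2)]] cp])
    then show ?thesis
      unfolding curvature_one_form_def on_charts_apply[OF cp] k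
      by (simp add: sum_2 Omega_up_components[OF cp] algebra_simps)
  qed
  then show ?thesis by blast
qed

text \<open>Interpolation at 0, 1, -1, 2, -2: the odd combinations f(1) - f(-1) = 2 k1 + 2 k3 and
  f(2) - f(-2) = 4 k1 + 16 k3 determine k1 and k3, and the even one at 1 gives k2. The nested sums
  of multiples fit the closure and linearity rules for test functions.\<close>

lemma cubic_coefficients:
  fixes f :: "real \<Rightarrow> real"
  assumes "\<And>t. f t = k0 + t * k1 + t\<^sup>2 * k2 + t ^ 3 * k3"
  shows "k0 = f 0" "k1 = 2/3 * f 1 + (- (2/3) * f (- 1) + (- (1/12) * f 2 + 1/12 * f (- 2)))"
    "k2 = 1/2 * f 1 + (1/2 * f (- 1) + - 1 * f 0)"
    "k3 = - (1/6) * f 1 + (1/6 * f (- 1) + (1/12 * f 2 + - (1/12) * f (- 2)))"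
  unfolding assms by (simp_all add: field_simps)

text \<open>The derivative at t = 0 written as the five-point difference formula, exact on cubics.
  As a combination of scalar test functions it is itself one, so \<open>first_variation\<close>
  needs no transformation law.\<close>

definition rho_variation :: "'a field3 \<Rightarrow> 'a field3 \<Rightarrow> 'a field1 \<Rightarrow> 'a \<Rightarrow> real" where
  "rho_variation \<Gamma> P X p = (let f = \<lambda>t. rho_pairing \<Gamma> P X t p in
     2/3 * f 1 + (- (2/3) * f (- 1) + (- (1/12) * f 2 + 1/12 * f (- 2))))"

lemma rho_variation_in_chart:
  assumes "\<Gamma> \<in> symplectic_connections" "P \<in> sym3_tensors" "X \<in> vector_fields" "c \<in> A" "p \<in> fst c"
  shows "rho_variation \<Gamma> P X p = 2 * (\<Sum>i\<in>UNIV. X c p i *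
      (\<Sum>a\<in>UNIV. \<Sum>b\<in>UNIV. \<Omega>up c p a b * first_variation \<Gamma> (raise_last P) c p b i a))"
proof -
  obtain k0 k2 k3 where "\<And>t. rho_pairing \<Gamma> P X t p = k0 + t * (2 * (\<Sum>i\<in>UNIV. X c p i *
      (\<Sum>a\<in>UNIV. \<Sum>b\<in>UNIV. \<Omega>up c p a b * first_variation \<Gamma> (raise_last P) c p b i a))) + t\<^sup>2 * k2 + t ^ 3 * k3"
    using rho_pairing_cubic[OF assms] by blast
  from cubic_coefficients(2)[of "\<lambda>t. rho_pairing \<Gamma> P X t p", OF this]
  show ?thesis unfolding rho_variation_def Let_def by simp
qed

lemma test_function_rho_pairing:
  assumes "\<Gamma> \<in> symplectic_connections" "P \<in> sym3_tensors" "X \<in> vector_fields" "compactin M K" "supported_in X K"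
  shows "test_function (rho_pairing \<Gamma> P X t)"
  unfolding rho_pairing_def
  by (rule test_function_contract[OF assms(3) covariant_curvature_one_form[OF translate_symplectic[OF assms(1,2)]] assms(4,5)])

lemma test_function_rho_variation:
  assumes "\<Gamma> \<in> symplectic_connections" "P \<in> sym3_tensors" "X \<in> vector_fields" "compactin M K" "supported_in X K"
  shows "test_function (rho_variation \<Gamma> P X)"
  unfolding rho_variation_def Let_def
  by (intro test_function_add test_function_cmult test_function_rho_pairing[OF assms])

lemma surface_integral_cong:
  assumes "\<And>p. p \<in> topspace M \<Longrightarrow> f p = g p"
  shows "surface_integral f = surface_integral g"
proof -
  have s: "support f = support g"
    unfolding support_def using assms by (metis (no_types, lifting))
  have "chart_integral (C j) (\<lambda>p. u j p * f p) = chart_integral (C j) (\<lambda>p. u j p * g p)"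
    if "partition_of_unity K n C u" "j < n" for K n C u j
  proof (rule chart_integral_cong)
    fix p assume "p \<in> fst (C j)"
    moreover have "C j \<in> A" using that by (simp add: partition_of_unity_def)
    ultimately have "p \<in> topspace M" using chart_subset by blast
    then show "u j p * f p = u j p * g p" using assms by simp
  qed
  then have eq: "partition_of_unity K n C u \<Longrightarrow>
      (\<Sum>j<n. chart_integral (C j) (\<lambda>p. u j p * f p)) = (\<Sum>j<n. chart_integral (C j) (\<lambda>p. u j p * g p))" for K n C u
    by (intro sum.cong) auto
  then show ?thesis
    unfolding surface_integral_def s
    by (intro arg_cong[where f = The] ext iff_exI conj_cong refl) (simp add: eq)
qed

lemma surface_integral_sum:
  assumes "\<And>j. j < n \<Longrightarrow> test_function (f j)"
  shows "surface_integral (\<lambda>p. \<Sum>j<n. f j p) = (\<Sum>j<(n::nat). surface_integral (f j))"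
    and "test_function (\<lambda>p. \<Sum>j<n. f j p)"
proof -
  have z: "test_function (\<lambda>p. 0)"
    by (rule test_functionI[of _ "{}"]) (auto intro: smooth_at_const)
  have "test_function (\<lambda>p. \<Sum>j<n. f j p) \<and>
      surface_integral (\<lambda>p. \<Sum>j<n. f j p) = (\<Sum>j<(n::nat). surface_integral (f j))"
    using assms
  proof (induction n)
    case 0
    then show ?case using z surface_integral_cmult[OF z, of 0] by simp
  next
    case (Suc n)
    then show ?case by (simp add: surface_integral_add test_function_add)
  qed
  then show "surface_integral (\<lambda>p. \<Sum>j<n. f j p) = (\<Sum>j<(n::nat). surface_integral (f j))"
    "test_function (\<lambda>p. \<Sum>j<n. f j p)" by auto
qed

section \<open>The integral of the difference of the two sides of the moment identity\<close>

definition moment_defect :: "'a field3 \<Rightarrow> 'a field3 \<Rightarrow> 'a field1 \<Rightarrow> 'a \<Rightarrow> real" where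
  "moment_defect \<Gamma> P X p = 1/2 * rho_variation \<Gamma> P X p + (- 1) * action_scalar \<Gamma> P X p"

lemma test_function_moment_defect:
  assumes "\<Gamma> \<in> symplectic_connections" "P \<in> sym3_tensors" "X \<in> vector_fields" "compactin M K" "supported_in X K"
  shows "test_function (moment_defect \<Gamma> P X)"
  unfolding moment_defect_def
  by (intro test_function_add test_function_cmult test_function_rho_variation[OF assms] test_function_action_scalar[OF assms])

text \<open>When the support of X lies in one chart, that of the density field does too, and the
  coordinate divergence there has integral zero.\<close>

lemma moment_defect_local:
  assumes "\<Gamma> \<in> symplectic_connections" "P \<in> sym3_tensors" "X \<in> vector_fields" "compactin M K" "supported_in X K"
    "c \<in> A" "K \<subseteq> fst c"
  shows "surface_integral (moment_defect \<Gamma> P X) = 0"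
proof (rule surface_integral_divergence[where Y = "density_field \<Gamma> (raise_last P) X c" and c = c and K = K])
  show "test_function (moment_defect \<Gamma> P X)" by (rule test_function_moment_defect[OF assms(1-5)])
  show "smooth_at c p (density_field \<Gamma> (raise_last P) X c i)" if "p \<in> fst c" for p i
    by (rule smooth_at_density_field[where Z = X, OF assms(1,2,6) that vector_fieldD(1)[OF assms(3,6) that]])
  have X0: "X e p k = 0" if "p \<notin> K" for e p k
    by (rule supported_inD[OF assms(5) that])
  show "density_field \<Gamma> (raise_last P) X c i p = 0" if "p \<in> fst c" "p \<notin> K" for p i
    by (simp add: density_field_def X0[OF that(2)] supported_vector_field_vanishes(1)[OF assms(4-6) that])
  show "moment_defect \<Gamma> P X p = 0" if p: "p \<in> topspace M" "p \<notin> K" for p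
  proof -
    note e = chart_exists[OF p(1)]
    show ?thesis
      unfolding moment_defect_def rho_variation_in_chart[OF assms(1-3) e] action_scalar_in_chart[OF assms(1-3) e]
      by (simp add: X0[OF p(2)] inf_action_def on_charts_apply[OF e]
          supported_vector_field_vanishes(2)[OF assms(4,5) e p(2)])
  qed
  show "\<Omega> c p 1 2 * moment_defect \<Gamma> P X p = (\<Sum>i\<in>UNIV. pd c i (density_field \<Gamma> (raise_last P) X c i) p)"
    if p: "p \<in> fst c" for p
    unfolding moment_identity[where Z = X, OF assms(1,2,6) p vector_fieldD(1)[OF assms(3,6) p], symmetric]
      moment_defect_def rho_variation_in_chart[OF assms(1-3,6) p] action_scalar_in_chart[OF assms(1-3,6) p]
    by simp
qed (use assms in auto)

lemma lie_conn_sum: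
  fixes Z :: "nat \<Rightarrow> 'a field1"
  assumes "\<Gamma> \<in> symplectic_connections" "c \<in> A" "p \<in> fst c"
    "\<And>j q k. j < n \<Longrightarrow> q \<in> fst c \<Longrightarrow> smooth_at c q (\<lambda>q. Z j c q k)"
  shows "lie_conn (\<lambda>c q k. \<Sum>j<n. Z j c q k) \<Gamma> c p a b k = (\<Sum>j<n. lie_conn (Z j) \<Gamma> c p a b k)"
proof -
  have N: "cov_vec \<Gamma> (\<lambda>c q k. \<Sum>j<n. Z j c q k) c q m k = (\<Sum>j<n. cov_vec \<Gamma> (Z j) c q m k)" if "q \<in> fst c" for q m k
  proof -
    have "pd c m (\<lambda>q. \<Sum>j<n. Z j c q k) q = (\<Sum>j<n. pd c m (\<lambda>q. Z j c q k) q)"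
      by (rule pd_sum) (use assms that in auto)
    then show ?thesis
      by (simp add: cov_vec_def sum.distrib sum_distrib_left sum_2)
  qed
  have "pd c m (\<lambda>q. cov_vec \<Gamma> (\<lambda>c q k. \<Sum>j<n. Z j c q k) c q i k) p = (\<Sum>j<n. pd c m (\<lambda>q. cov_vec \<Gamma> (Z j) c q i k) p)" for m i k
  proof -
    have "pd c m (\<lambda>q. cov_vec \<Gamma> (\<lambda>c q k. \<Sum>j<n. Z j c q k) c q i k) p = pd c m (\<lambda>q. \<Sum>j<n. cov_vec \<Gamma> (Z j) c q i k) p"
      by (rule pd_cong_chart[OF assms(2,3)]) (rule N)
    also have "\<dots> = (\<Sum>j<n. pd c m (\<lambda>q. cov_vec \<Gamma> (Z j) c q i k) p)"
      by (rule pd_sum[OF assms(2,3)])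
        (use assms smooth_at_cov_vec symplectic_connectionD(2)[OF assms(1-3)] in auto)
    finally show ?thesis .
  qed
  then show ?thesis
    unfolding lie_conn_def hess_vec_def cov_mixed_def N[OF assms(3)]
    by (simp add: sum_2 sum.distrib sum_subtractf sum_distrib_left sum_distrib_right)
qed

lemma moment_defect_sum:
  fixes Z :: "nat \<Rightarrow> 'a field1"
  assumes "\<Gamma> \<in> symplectic_connections" "\<And>j. j < n \<Longrightarrow> Z j \<in> vector_fields" "p \<in> topspace M"
  shows "moment_defect \<Gamma> P (\<lambda>c q k. \<Sum>j<n. Z j c q k) p = (\<Sum>j<n. moment_defect \<Gamma> P (Z j) p)"
proof -
  note e = chart_exists[OF assms(3)]
  have "rho_pairing \<Gamma> P (\<lambda>c q k. \<Sum>j<n. Z j c q k) t p = (\<Sum>j<n. rho_pairing \<Gamma> P (Z j) t p)" for t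
    by (simp add: rho_pairing_def contract_def sum_2 sum.distrib sum_distrib_right)
  then have r: "rho_variation \<Gamma> P (\<lambda>c q k. \<Sum>j<n. Z j c q k) p = (\<Sum>j<n. rho_variation \<Gamma> P (Z j) p)"
    by (simp only: rho_variation_def Let_def sum.distrib sum_distrib_left)
  have "lie_conn (\<lambda>c q k. \<Sum>j<n. Z j c q k) \<Gamma> (chart_at p) p a b k = (\<Sum>j<n. lie_conn (Z j) \<Gamma> (chart_at p) p a b k)" for a b k
    by (rule lie_conn_sum[OF assms(1) e]) (use assms(2) vector_fieldD(1) e in blast)
  then have "inf_action (\<lambda>c q k. \<Sum>j<n. Z j c q k) \<Gamma> (chart_at p) p a b k = (\<Sum>j<n. inf_action (Z j) \<Gamma> (chart_at p) p a b k)" for a b k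
    by (simp add: inf_action_def on_charts_apply[OF e] sum_2 sum.distrib sum_distrib_right)
  then have "action_scalar \<Gamma> P (\<lambda>c q k. \<Sum>j<n. Z j c q k) p = (\<Sum>j<n. action_scalar \<Gamma> P (Z j) p)"
    by (simp add: action_scalar_def Let_def sum_2 sum.distrib sum_distrib_right)
  with r show ?thesis
    by (simp only: moment_defect_def sum.distrib sum_distrib_left)
qed

lemma scaled_vector_field:
  assumes "X \<in> vector_fields" "\<And>c p. c \<in> A \<Longrightarrow> p \<in> fst c \<Longrightarrow> smooth_at c p u"
  shows "(\<lambda>c p k. u p * X c p k) \<in> vector_fields"
  unfolding vector_fields_def
proof (intro CollectI conjI ballI allI)
  show "on_charts (\<lambda>c p k. u p * X c p k) = (\<lambda>c p k. u p * X c p k)"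
    using vector_fieldD(3)[OF assms(1)] by (auto simp: on_charts_def fun_eq_iff)
  show "smooth_comp c (\<lambda>q. u q * X c q k)" if c: "c \<in> A" for c k
    unfolding smooth_comp_iff[OF c] using smooth_at_mult[OF assms(2)[OF c] vector_fieldD(1)[OF assms(1) c]] by blast
  fix c d p k assume "c \<in> A" "d \<in> A" "p \<in> fst c \<inter> fst d"
  then have "X c p k = (\<Sum>m\<in>UNIV. D1 id d c p k m * X d p m)"
    using vector_fieldD(2)[OF assms(1)] by blast
  then show "u p * X c p k = (\<Sum>m\<in>UNIV. D1 id d c p k m * (u p * X d p m))"
    by (simp add: sum_2 algebra_simps)
qed

lemma supported_in_support:
  assumes "X \<in> vector_fields"
  shows "supported_in (\<lambda>c p k. u p * X c p k) (support u)"
  unfolding supported_in_def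
proof (intro allI impI)
  fix c p k assume p: "p \<notin> support u"
  show "u p * X c p k = 0"
  proof (cases "c \<in> A \<and> p \<in> fst c")
    case True
    then have "p \<in> topspace M" using chart_subset by blast
    then show ?thesis using notin_support p by simp
  qed (simp add: vector_fieldD(3)[OF assms])
qed

text \<open>X is the sum of the fields u j X everywhere: on K the weights add up to 1 and off K the
  field vanishes. The defect is additive in X, and each summand lives in one chart.\<close>

lemma moment_defect_integral:
  assumes "\<Gamma> \<in> symplectic_connections" "P \<in> sym3_tensors" "X \<in> vector_fields" "compactin M K" "supported_in X K"
  shows "surface_integral (moment_defect \<Gamma> P X) = 0"
proof -
  obtain n C u where u: "partition_of_unity K n C u"
    using partition_of_unity_exists[OF assms(4)] .
  have C: "C j \<in> A" "\<And>c p. c \<in> A \<Longrightarrow> p \<in> fst c \<Longrightarrow> smooth_at c p (u j)"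
    "compactin M (support (u j))" "support (u j) \<subseteq> fst (C j)" if "j < n" for j
    using u that by (auto simp: partition_of_unity_def smooth_comp_iff)
  let ?Z = "\<lambda>j c p k. u j p * X c p k"
  have Z: "?Z j \<in> vector_fields" if "j < n" for j
    by (rule scaled_vector_field[OF assms(3) C(2)[OF that]])
  note sup = supported_in_support[OF assms(3)]
  have X: "X = (\<lambda>c q k. \<Sum>j<n. ?Z j c q k)"
  proof (intro ext)
    fix c q k
    show "X c q k = (\<Sum>j<n. u j q * X c q k)"
    proof (cases "q \<in> K")
      case True
      then have "(\<Sum>j<n. u j q) = 1" using u by (simp add: partition_of_unity_def)
      then show ?thesis by (simp flip: sum_distrib_right)
    next
      case False
      then have "X c q k = 0" by (rule supported_inD[OF assms(5)])
      then show ?thesis by simp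
    qed
  qed
  have test: "test_function (moment_defect \<Gamma> P (?Z j))" if "j < n" for j
    by (rule test_function_moment_defect[OF assms(1,2) Z[OF that] C(3)[OF that] sup])
  have zero: "surface_integral (moment_defect \<Gamma> P (?Z j)) = 0" if "j < n" for j
    by (rule moment_defect_local[OF assms(1,2) Z[OF that] C(3)[OF that] sup C(1,4)[OF that]])
  have "surface_integral (moment_defect \<Gamma> P X) = surface_integral (\<lambda>p. \<Sum>j<n. moment_defect \<Gamma> P (?Z j) p)"
  proof (rule surface_integral_cong)
    fix p assume p: "p \<in> topspace M"
    have "moment_defect \<Gamma> P X p = moment_defect \<Gamma> P (\<lambda>c q k. \<Sum>j<n. ?Z j c q k) p"
      by (rule arg_cong[where f = "\<lambda>X. moment_defect \<Gamma> P X p", OF X])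
    also have "\<dots> = (\<Sum>j<n. moment_defect \<Gamma> P (?Z j) p)"
      by (rule moment_defect_sum[where Z = ?Z, OF assms(1) Z p])
    finally show "moment_defect \<Gamma> P X p = (\<Sum>j<n. moment_defect \<Gamma> P (?Z j) p)" .
  qed
  also have "\<dots> = 0"
    using surface_integral_sum(1)[of n "\<lambda>j. moment_defect \<Gamma> P (?Z j)", OF test] zero by simp
  finally show ?thesis .
qed

subsection \<open>The functional defined by a class\<close>

text \<open>The lowered field has components -\<Omega>_12 X^2 and \<Omega>_12 X^1, so its closedness
  is the vanishing of the coordinate divergence of \<Omega>_12 X.\<close>

lemma symp_fieldD:
  assumes "X \<in> symp_fields"
  obtains K where "X \<in> vector_fields" "compactin M K" "supported_in X K"
    "\<And>c p. c \<in> A \<Longrightarrow> p \<in> fst c \<Longrightarrow> (\<Sum>i\<in>UNIV. pd c i (\<lambda>q. \<Omega> c q 1 2 * X c q i) p) = 0"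
proof -
  let ?S = "{p \<in> topspace M. \<exists>c\<in>A. p \<in> fst c \<and> (\<exists>k. X c p k \<noteq> 0)}"
  have X: "X \<in> vector_fields" "compactin M (M closure_of ?S)"
    and cl: "\<And>c p i j. c \<in> A \<Longrightarrow> p \<in> fst c \<Longrightarrow> pd c i (\<lambda>q. flat X c q j) p = pd c j (\<lambda>q. flat X c q i) p"
    using assms by (auto simp: symp_fields_def)
  have "supported_in X (M closure_of ?S)"
    unfolding supported_in_def
  proof (intro allI impI)
    fix c p k assume p: "p \<notin> M closure_of ?S"
    then have "p \<notin> ?S" using closure_of_subset[of ?S M] by blast
    then show "X c p k = 0"
      using vector_fieldD(3)[OF X(1), of c p k] chart_subset by blast
  qed
  moreover have "(\<Sum>i\<in>UNIV. pd c i (\<lambda>q. \<Omega> c q 1 2 * X c q i) p) = 0" if cp: "c \<in> A" "p \<in> fst c" for c p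
  proof -
    have s: "smooth_at c p (\<lambda>q. \<Omega> c q 1 2 * X c q 2)"
      by (rule smooth_at_mult[OF Omega_smooth[OF cp] vector_fieldD(1)[OF X(1) cp]])
    have "pd c 1 (\<lambda>q. flat X c q 2) p = pd c 1 (\<lambda>q. \<Omega> c q 1 2 * X c q 1) p"
      by (rule pd_cong_chart[OF cp]) (simp add: flat_def on_charts_apply cp sum_2 Omega_components)
    moreover have "pd c 2 (\<lambda>q. flat X c q 1) p = pd c 2 (\<lambda>q. - (\<Omega> c q 1 2 * X c q 2)) p"
      by (rule pd_cong_chart[OF cp]) (simp add: flat_def on_charts_apply cp sum_2 Omega_components)
    ultimately show ?thesis
      using cl[OF cp, of 1 2] pd_minus[OF s] by (simp add: sum_2)
  qed
  ultimately show thesis using that X by blast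
qed

lemma symp_field_support:
  assumes "X \<in> symp_fields"
  obtains K where "X \<in> vector_fields" "compactin M K" "supported_in X K"
  by (rule symp_fieldD[OF assms])

text \<open>Integration by parts against a divergence-free X. The potential f is localised, as u j
  f, while X stays closed; in each chart \<Omega>_12 X^i times the derivative of g is the divergence
  of \<Omega>_12 X^i g.\<close>

lemma exact_form_pairing_zero:
  assumes "X \<in> symp_fields" "smooth_scalar f"
  shows "surface_integral (contract X (exact_form f)) = 0"
proof -
  obtain K where X: "X \<in> vector_fields" and K: "compactin M K" "supported_in X K"
    and div: "\<And>c p. c \<in> A \<Longrightarrow> p \<in> fst c \<Longrightarrow> (\<Sum>i\<in>UNIV. pd c i (\<lambda>q. \<Omega> c q 1 2 * X c q i) p) = 0"
    using symp_fieldD[OF assms(1)] by blast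
  obtain n C u where u: "partition_of_unity K n C u"
    using partition_of_unity_exists[OF K(1)] .
  have C: "C j \<in> A" "\<And>c p. c \<in> A \<Longrightarrow> p \<in> fst c \<Longrightarrow> smooth_at c p (u j)"
    "compactin M (support (u j))" "support (u j) \<subseteq> fst (C j)" if "j < n" for j
    using u that by (auto simp: partition_of_unity_def smooth_comp_iff)
  define g where "g j p = u j p * f p" for j p
  have g: "smooth_scalar (g j)" if "j < n" for j
    unfolding g_def smooth_scalar_def using C(2)[OF that] assms(2)
    by (auto simp: smooth_scalar_def intro: smooth_at_mult)
  have g0: "pd c i (g j) p = 0" if "c \<in> A" "p \<in> fst c" "p \<notin> support (u j)" for c p i j
  proof -
    have "pd c i (g j) p = pd c i (\<lambda>q. 0) p"
      by (rule pd_cong[OF that(1,2), of "topspace M - support (u j)"])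
        (use closedin_support[of "u j"] subsetD[OF chart_subset[OF that(1)] that(2)] that in \<open>auto simp: g_def notin_support\<close>)
    then show ?thesis by simp
  qed
  have test: "test_function (contract X (exact_form (g j)))" if "j < n" for j
    by (rule test_function_contract[OF X covariant_exact_form[OF g[OF that]] K])
  have zero: "surface_integral (contract X (exact_form (g j))) = 0" if j: "j < n" for j
  proof (rule surface_integral_divergence[where c = "C j" and K = "support (u j)"
        and Y = "\<lambda>i q. \<Omega> (C j) q 1 2 * X (C j) q i * g j q"])
    note Cj = C[OF j]
    fix p assume p: "p \<in> fst (C j)"
    have sg: "smooth_at (C j) p (g j)" using g[OF j] Cj(1) p by (simp add: smooth_scalar_def)
    have sw: "smooth_at (C j) p (\<lambda>q. \<Omega> (C j) q 1 2 * X (C j) q i)" for i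
      by (rule smooth_at_mult[OF Omega_smooth[OF Cj(1) p] vector_fieldD(1)[OF X Cj(1) p]])
    show "smooth_at (C j) p (\<lambda>q. \<Omega> (C j) q 1 2 * X (C j) q i * g j q)" for i
      by (rule smooth_at_mult[OF sw sg])
    have "contract X (exact_form (g j)) p = (\<Sum>i\<in>UNIV. X (C j) p i * pd (C j) i (g j) p)"
      using contract_in_chart[OF X covariant_exact_form[OF g[OF j]] Cj(1) p]
      by (simp add: exact_form_def on_charts_apply[OF Cj(1) p])
    moreover have "(\<Sum>i\<in>UNIV. pd (C j) i (\<lambda>q. \<Omega> (C j) q 1 2 * X (C j) q i * g j q) p)
      = \<Omega> (C j) p 1 2 * (\<Sum>i\<in>UNIV. X (C j) p i * pd (C j) i (g j) p)
        + (\<Sum>i\<in>UNIV. pd (C j) i (\<lambda>q. \<Omega> (C j) q 1 2 * X (C j) q i) p) * g j p"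
      unfolding pd_mult[OF sw sg] by (simp add: sum_2 algebra_simps)
    ultimately show "\<Omega> (C j) p 1 2 * contract X (exact_form (g j)) p
      = (\<Sum>i\<in>UNIV. pd (C j) i (\<lambda>q. \<Omega> (C j) q 1 2 * X (C j) q i * g j q) p)"
      by (simp add: div[OF Cj(1) p])
  next
    fix p assume p: "p \<in> topspace M" "p \<notin> support (u j)"
    show "contract X (exact_form (g j)) p = 0"
      using g0[OF chart_exists[OF p(1)] p(2)] chart_exists[OF p(1)]
      by (simp add: contract_def exact_form_def on_charts_apply)
  next
    fix p i assume p: "p \<in> fst (C j)" "p \<notin> support (u j)"
    then show "\<Omega> (C j) p 1 2 * X (C j) p i * g j p = 0"
      using notin_support[of p "u j"] chart_subset[OF C(1)[OF j]] by (auto simp: g_def)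
  qed (use C[OF j] test[OF j] in auto)
  have "surface_integral (contract X (exact_form f)) = surface_integral (\<lambda>p. \<Sum>j<n. contract X (exact_form (g j)) p)"
  proof (rule surface_integral_cong)
    fix p assume pM: "p \<in> topspace M"
    let ?e = "chart_at p"
    note e = chart_exists[OF pM]
    show "contract X (exact_form f) p = (\<Sum>j<n. contract X (exact_form (g j)) p)"
    \<comment> \<open>The weights add up to 1 only on K, so their derivatives are controlled only in
      its interior. Where X is nonzero at p it is nonzero nearby and p is interior to K; where X
      vanishes at p both sides are zero.\<close>
    proof (cases "\<exists>k. X ?e p k \<noteq> 0")
      case True
      then obtain k where k: "X ?e p k \<noteq> 0" by blast
      \<comment> \<open>The square turns nonvanishing into positivity, which persists on a
        neighbourhood.\<close>
      then have pos: "X ?e p k * X ?e p k > 0"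
        by (auto simp: zero_less_mult_iff neq_iff)
      have sX: "smooth_at ?e p (\<lambda>q. X ?e q k * X ?e q k)"
        by (intro smooth_at_mult vector_fieldD(1)[OF X e])
      obtain W where W: "openin M W" "p \<in> W" "\<And>q. q \<in> W \<Longrightarrow> X ?e q k * X ?e q k > 0"
        using smooth_at_pos_nbhd[where f = "\<lambda>q. X ?e q k * X ?e q k", OF sX pos] by blast
      have WK: "q \<in> K" if "q \<in> W" for q
      proof (rule ccontr)
        assume "q \<notin> K"
        then have "X ?e q k = 0" by (rule supported_inD[OF K(2)])
        then show False using W(3)[OF that] by simp
      qed
      have "pd ?e i f p = (\<Sum>j<n. pd ?e i (g j) p)" for i
      proof -
        have "pd ?e i f p = pd ?e i (\<lambda>q. \<Sum>j<n. g j q) p"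
        proof (rule pd_cong[OF e W(1,2)])
          fix q assume "q \<in> W"
          then have "(\<Sum>j<n. u j q) = 1" using u WK by (simp add: partition_of_unity_def)
          then show "f q = (\<Sum>j<n. g j q)" by (simp add: g_def flip: sum_distrib_right)
        qed
        also have "\<dots> = (\<Sum>j<n. pd ?e i (g j) p)"
          by (rule pd_sum[OF e]) (use g e in \<open>auto simp: smooth_scalar_def\<close>)
        finally show ?thesis .
      qed
      then show ?thesis
        by (simp add: contract_def exact_form_def on_charts_apply[OF e] sum_2 sum.distrib sum_distrib_left)
    qed (simp add: contract_def)
  qed
  also have "\<dots> = 0"
    using surface_integral_sum(1)[of n "\<lambda>j. contract X (exact_form (g j))", OF test] zero by simp
  finally show ?thesis .
qed

lemma pairing1_flat:
  assumes "X \<in> vector_fields"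
  shows "pairing1 (flat X) \<mu> = surface_integral (\<lambda>p. - 1 * contract X \<mu> p)"
proof -
  have "(\<Sum>i\<in>UNIV. flat X (chart_at p) p i * raise1 \<mu> (chart_at p) p i) = - 1 * contract X \<mu> p" for p
  proof (cases "chart_at p \<in> A \<and> p \<in> fst (chart_at p)")
    case True
    then have e: "chart_at p \<in> A" "p \<in> fst (chart_at p)" by auto
    show ?thesis
      using Omega_nonzero[OF e]
      by (simp add: flat_def on_charts_apply[OF e] raise1_def contract_def sum_2 Omega_components Omega_up_components[OF e])
  next
    \<comment> \<open>Here \<open>chart_at p\<close> does not provide a chart around p; the
      normalisation of component families makes both sides zero.\<close>
    case False
    then show ?thesis
      using vector_fieldD(3)[OF assms False] by (auto simp: flat_def on_charts_def contract_def)
  qed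
  then show ?thesis by (simp add: pairing1_def Let_def)
qed

end

section \<open>The functional of the curvature class and its derivative\<close>

context symplectic_surface
begin

text \<open>The sign of the pairing and the factor -1/2 combine to +1/2. Exact representatives
  contribute nothing, so the value is common to the whole class.\<close>

lemma class_pairing_curvature_moment:
  assumes "X \<in> symp_fields" "\<Gamma> \<in> symplectic_connections"
  shows "class_pairing X (curvature_moment \<Gamma>) = 1/2 * surface_integral (contract X (curvature_one_form \<Gamma>))"
proof -
  obtain K where X: "X \<in> vector_fields" and K: "compactin M K" "supported_in X K"
    by (rule symp_field_support[OF assms(1)])
  let ?\<mu> = "\<lambda>c p i. - (1/2) * curvature_one_form \<Gamma> c p i"
  have t: "test_function (contract X (curvature_one_form \<Gamma>))"
    by (rule test_function_contract[OF X covariant_curvature_one_form[OF assms(2)] K])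
  have *: "pairing1 (flat X) (?\<mu> + exact_form f) = 1/2 * surface_integral (contract X (curvature_one_form \<Gamma>))"
    if f: "smooth_scalar f" for f
  proof -
    have tf: "test_function (contract X (exact_form f))"
      by (rule test_function_contract[OF X covariant_exact_form[OF f] K])
    have "(\<lambda>p. - 1 * contract X (?\<mu> + exact_form f) p)
      = (\<lambda>p. 1/2 * contract X (curvature_one_form \<Gamma>) p + - 1 * contract X (exact_form f) p)"
      by (simp add: fun_eq_iff contract_def sum_2 algebra_simps)
    then show ?thesis
      unfolding pairing1_flat[OF X]
      by (simp only: surface_integral_add[OF test_function_cmult[OF t] test_function_cmult[OF tf]]
          surface_integral_cmult[OF t] surface_integral_cmult[OF tf] exact_form_pairing_zero[OF assms(1) f])
  qed
  have s0: "smooth_scalar (\<lambda>p. 0)" by (simp add: smooth_scalar_def smooth_at_const)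
  show ?thesis
    unfolding class_pairing_def curvature_moment_def form_class_eq[OF assms(2)]
  proof (rule the_equality)
    show "\<forall>\<mu>\<in>{?\<mu> + exact_form f |f. smooth_scalar f}. pairing1 (flat X) \<mu> = 1/2 * surface_integral (contract X (curvature_one_form \<Gamma>))"
      using * by blast
    show "r = 1/2 * surface_integral (contract X (curvature_one_form \<Gamma>))"
      if "\<forall>\<mu>\<in>{?\<mu> + exact_form f |f. smooth_scalar f}. pairing1 (flat X) \<mu> = r" for r
    proof -
      \<comment> \<open>Uniqueness of the common value needs a member of the class; the zero
        potential supplies one.\<close>
      have "?\<mu> + exact_form (\<lambda>p. 0) \<in> {?\<mu> + exact_form f |f. smooth_scalar f}" using s0 by blast
      from bspec[OF that this] show ?thesis unfolding *[OF s0] by (rule sym)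
    qed
  qed
qed

text \<open>After integration the pairing is a cubic in t with constant coefficients. Its derivative
  at 0 is half the integral of \<open>rho_variation\<close>, which equals the integral of the action
  scalar because the moment defect has integral zero.\<close>

lemma moment_derivative:
  assumes "\<Gamma> \<in> symplectic_connections" "X \<in> symp_fields" "P \<in> sym3_tensors"
  shows "((\<lambda>t. class_pairing X (curvature_moment (translate \<Gamma> t P)))
           has_real_derivative conn_form \<Gamma> (inf_action X \<Gamma>) P) (at 0)"
proof -
  obtain K where X: "X \<in> vector_fields" and K: "compactin M K" "supported_in X K"
    by (rule symp_field_support[OF assms(2)])
  let ?f = "rho_pairing \<Gamma> P X"
  let ?k1 = "rho_variation \<Gamma> P X"
  define k2 where "k2 p = 1/2 * ?f 1 p + (1/2 * ?f (- 1) p + - 1 * ?f 0 p)" for p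
  define k3 where "k3 p = - (1/6) * ?f 1 p + (1/6 * ?f (- 1) p + (1/12 * ?f 2 p + - (1/12) * ?f (- 2) p))" for p
  note tf = test_function_rho_pairing[OF assms(1,3) X K]
  note t1 = test_function_rho_variation[OF assms(1,3) X K]
  have t2: "test_function k2" and t3: "test_function k3"
    unfolding k2_def k3_def by (intro test_function_add test_function_cmult tf)+
  have expand: "?f t p = ?f 0 p + (t * ?k1 p + (t\<^sup>2 * k2 p + t ^ 3 * k3 p))" if p: "p \<in> topspace M" for t p
  proof -
    obtain k0 l1 l2 l3 where k: "\<And>t. ?f t p = k0 + t * l1 + t\<^sup>2 * l2 + t ^ 3 * l3"
      using rho_pairing_cubic[OF assms(1,3) X chart_exists[OF p]] by blast
    note c = cubic_coefficients[of "\<lambda>t. ?f t p", OF k]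
    show ?thesis
      using k[of t, unfolded c] unfolding rho_variation_def Let_def k2_def k3_def by (simp only: add.assoc)
  qed
  have int: "surface_integral (?f t) = surface_integral (?f 0) + (t * surface_integral ?k1 + (t\<^sup>2 * surface_integral k2 + t ^ 3 * surface_integral k3))" for t
  proof -
    have "surface_integral (?f t) = surface_integral (\<lambda>p. ?f 0 p + (t * ?k1 p + (t\<^sup>2 * k2 p + t ^ 3 * k3 p)))"
      by (rule surface_integral_cong) (rule expand)
    note this
    also note surface_integral_add[OF tf test_function_add[OF test_function_cmult[OF t1]
        test_function_add[OF test_function_cmult[OF t2] test_function_cmult[OF t3]]]]
    also note surface_integral_add[OF test_function_cmult[OF t1]
        test_function_add[OF test_function_cmult[OF t2] test_function_cmult[OF t3]]]
    also note surface_integral_add[OF test_function_cmult[OF t2] test_function_cmult[OF t3]]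
    finally show ?thesis
      unfolding surface_integral_cmult[OF t1] surface_integral_cmult[OF t2] surface_integral_cmult[OF t3] .
  qed
  have eq: "class_pairing X (curvature_moment (translate \<Gamma> t P))
      = 1/2 * (surface_integral (?f 0) + (t * surface_integral ?k1 + (t\<^sup>2 * surface_integral k2 + t ^ 3 * surface_integral k3)))" for t
    unfolding class_pairing_curvature_moment[OF assms(2) translate_symplectic[OF assms(1,3)]] rho_pairing_def[symmetric]
    by (rule arg_cong[OF int])
  have "((\<lambda>t. class_pairing X (curvature_moment (translate \<Gamma> t P))) has_real_derivative 1/2 * surface_integral ?k1) (at 0)"
    unfolding eq by (auto intro!: derivative_eq_intros)
  moreover have "conn_form \<Gamma> (inf_action X \<Gamma>) P = 1/2 * surface_integral ?k1"
  proof -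
    note ts = test_function_action_scalar[OF assms(1,3) X K]
    have "0 = surface_integral (\<lambda>p. 1/2 * ?k1 p + - 1 * action_scalar \<Gamma> P X p)"
      using moment_defect_integral[OF assms(1,3) X K] by (simp add: moment_defect_def[abs_def])
    also have "\<dots> = 1/2 * surface_integral ?k1 + - 1 * surface_integral (action_scalar \<Gamma> P X)"
      unfolding surface_integral_add[OF test_function_cmult[OF t1] test_function_cmult[OF ts]]
        surface_integral_cmult[OF t1] surface_integral_cmult[OF ts] ..
    finally show ?thesis
      by (simp add: conn_form_def pairing3_def action_scalar_def[abs_def])
  qed
  ultimately show ?thesis by (simp only:)
qed

end

theorem theorem1p2:
  fixes M :: "'a topology" and A :: "'a chart set" and \<Omega> :: "'a field2"
  assumes "symplectic_surface M A \<Omega>"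
  shows "symplectic_surface.equivariant_moment_map M A \<Omega>
           (symplectic_surface.curvature_moment A \<Omega>)"
proof -
  interpret symplectic_surface M A \<Omega> by fact
  show ?thesis
    unfolding equivariant_moment_map_def
    using curvature_moment_in_quotient pull_conn_symplectic(1) curvature_moment_equivariant moment_derivative
    by blast
qed

end
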